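(* Let $\phi=\tilde p/p$ be a degree $(n,1)$ rational inner function as in the context and let $\alpha\in\mathbb{T}$ be an exceptional value with, after reordering, $\phi^*(\tau_k,\lambda_k)=\alpha$ exactly for $k=1,\dots,\ell$. Write $B_\alpha=b_\alpha^1/b_\alpha^2$ with coprime polynomials $b_\alpha^1,b_\alpha^2$ of degree $n-\ell$. For $j=1,\dots,\ell$ put $$R_j(z)=d_j^\alpha\bigl(b_\alpha^2(z_1)-z_2b_\alpha^1(z_1)\bigr)\prod_{1\le k\le\ell,\,k\ne j}(z_1-\tau_k),$$ where $d_j^\alpha>0$ is chosen so that $c_j^\alpha\,\|(R_j/p)(\tau_j,\cdot)\|^2_{H^2(\mathbb{D})}=1$ (this is possible since $(R_j/p)(\tau_j,\cdot)$ is a nonzero element of $H^2(\mathbb{D})$ when $d_j^\alpha=1$). Then there exist polynomials $R_{\ell+1},\dots,R_n,Q\in\mathbb{C}[z_1,z_2]$ with $\deg Q\le(n,0)$ and $\deg R_j\le(n-1,1)$ for all $j$, such that for all $z,w\in\mathbb{C}^2$ $$p(z)\overline{p(w)}-\tilde p(z)\overline{\tilde p(w)}=(1-z_1\bar w_1)\sum_{j=1}^nR_j(z)\overline{R_j(w)}+(1-z_2\bar w_2)Q(z)\overline{Q(w)}.$$ Moreover $R_1/p,\dots,R_\ell/p$ form an orthonormal set in $K_\phi$.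
   Context: $\mathbb{D}$ is the open unit disk, $\mathbb{T}$ the unit circle. Fix $n\ge1$. Let $p\in\mathbb{C}[z_1,z_2]$ have no zeros on $\mathbb{D}^2$, degree at most $n$ in $z_1$ and at most $1$ in $z_2$; write $p(z)=p_1(z_1)+z_2p_2(z_1)$. Set $\tilde p(z)=z_1^nz_2\overline{p(1/\bar z_1,1/\bar z_2)}=z_2\tilde p_1(z_1)+\tilde p_2(z_1)$ with $\tilde p_i(z)=z^n\overline{p_i(1/\bar z)}$. Assume $\tilde p$ has degree exactly $(n,1)$ and $p,\tilde p$ have no common factor, so $\phi=\tilde p/p$ is a degree $(n,1)$ rational inner function. The zeros of $p$ on $\mathbb{T}^2$ are distinct points $(\tau_1,\lambda_1),\dots,(\tau_m,\lambda_m)$; $\phi^*$ (non-tangential limit) exists and is unimodular on $\mathbb{T}^2$; $\alpha$ is exceptional if $\phi^*(\tau_k,\lambda_k)=\alpha$ for some $k$. $B_\alpha$ is $\frac{\tilde p_1-\alpha p_2}{\alpha p_1-\tilde p_2}$ with common factors cancelled (a finite Blaschke product, of degree $n-\ell$ in the situation of the claim). For $\phi^*(\tau_j,\lambda_j)=\alpha$, $z_2\mapsto\partial_{z_1}\phi(\tau_j,z_2)$ is a nonzero constant on $\overline{\mathbb{D}}\setminus\{\lambda_j\}$ and $c_j^\alpha$ is the reciprocal of its modulus (equivalently, the weight of $\delta_{\tau_j}\otimes m$ in the Clark measure $\sigma_\alpha$). $K_\phi=H^2(\mathbb{D}^2)\ominus\phi H^2(\mathbb{D}^2)$ is the model space.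 *)

theory Defs
  imports "HOL-Analysis.Analysis" "HOL-Computational_Algebra.Polynomial_Factorial"
begin

text \<open>Polynomials in C[z1,z2] are represented as elements of C[z1][z2], i.e. as
  complex poly poly: the outer variable is z2, the coefficients are polynomials in z1.\<close>

definition eval2 :: "complex poly poly \<Rightarrow> complex \<Rightarrow> complex \<Rightarrow> complex" where
  "eval2 P z1 z2 = poly (map_poly (\<lambda>c. poly c z1) P) z2"

definition deg_z1_le :: "complex poly poly \<Rightarrow> nat \<Rightarrow> bool" where
  "deg_z1_le P n \<longleftrightarrow> (\<forall>i. degree (coeff P i) \<le> n)"

text \<open>Reflection of a polynomial of bidegree at most (n,m):
  z1^n z2^m conj(P(1/conj z1, 1/conj z2)), written out on coefficients.\<close>
definition refl2 :: "nat \<Rightarrow> nat \<Rightarrow> complex poly poly \<Rightarrow> complex poly poly" where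
  "refl2 n m P = (\<Sum>i\<le>m. monom (\<Sum>j\<le>n. monom (cnj (coeff (coeff P (m - i)) (n - j))) j) i)"

definition Z1 :: "complex poly poly" where "Z1 = [:[:0, 1:]:]"
definition Z2 :: "complex poly poly" where "Z2 = [:0, 1:]"

definition rif :: "complex poly poly \<Rightarrow> complex poly poly \<Rightarrow> complex \<Rightarrow> complex \<Rightarrow> complex" where
  "rif P Pt z1 z2 = eval2 Pt z1 z2 / eval2 P z1 z2"

definition nt_region :: "complex \<times> complex \<Rightarrow> real \<Rightarrow> (complex \<times> complex) set" where
  "nt_region \<zeta> c = {z. cmod (fst z) < 1 \<and> cmod (snd z) < 1 \<and>
      cmod (fst z - fst \<zeta>) + cmod (snd z - snd \<zeta>) < c * (1 - max (cmod (fst z)) (cmod (snd z)))}"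

definition has_nt_limit :: "(complex \<Rightarrow> complex \<Rightarrow> complex) \<Rightarrow> complex \<times> complex \<Rightarrow> complex \<Rightarrow> bool" where
  "has_nt_limit f \<zeta> L \<longleftrightarrow>
     (\<forall>c>0. ((\<lambda>z. f (fst z) (snd z)) \<longlongrightarrow> L) (at \<zeta> within nt_region \<zeta> c))"

definition holo_bidisc :: "(complex \<Rightarrow> complex \<Rightarrow> complex) \<Rightarrow> bool" where
  "holo_bidisc f \<longleftrightarrow>
     continuous_on (ball 0 1 \<times> ball 0 1) (\<lambda>z. f (fst z) (snd z)) \<and>
     (\<forall>z2\<in>ball 0 1. (\<lambda>z1. f z1 z2) holomorphic_on ball 0 1) \<and>
     (\<forall>z1\<in>ball 0 1. (\<lambda>z2. f z1 z2) holomorphic_on ball 0 1)"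

definition torus_mean :: "(complex \<Rightarrow> complex \<Rightarrow> complex) \<Rightarrow> (complex \<Rightarrow> complex \<Rightarrow> complex) \<Rightarrow> real \<Rightarrow> complex" where
  "torus_mean f g r = integral (cbox (0,0) (2*pi, 2*pi))
      (\<lambda>(s,t). f (r * cis s) (r * cis t) * cnj (g (r * cis s) (r * cis t))) / (4 * pi^2)"

definition torus_sqmean :: "(complex \<Rightarrow> complex \<Rightarrow> complex) \<Rightarrow> real \<Rightarrow> real" where
  "torus_sqmean f r = integral (cbox (0,0) (2*pi, 2*pi))
      (\<lambda>(s,t). (cmod (f (r * cis s) (r * cis t)))^2) / (4 * pi^2)"

definition in_H2 :: "(complex \<Rightarrow> complex \<Rightarrow> complex) \<Rightarrow> bool" where
  "in_H2 f \<longleftrightarrow> holo_bidisc f \<and> bdd_above (torus_sqmean f ` {0<..<1})"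

definition H2_inner :: "(complex \<Rightarrow> complex \<Rightarrow> complex) \<Rightarrow> (complex \<Rightarrow> complex \<Rightarrow> complex) \<Rightarrow> complex" where
  "H2_inner f g = Lim (at_left (1::real)) (torus_mean f g)"

definition model_space :: "(complex \<Rightarrow> complex \<Rightarrow> complex) \<Rightarrow> (complex \<Rightarrow> complex \<Rightarrow> complex) set" where
  "model_space \<phi> = {f. in_H2 f \<and> (\<forall>g. in_H2 g \<longrightarrow> H2_inner f (\<lambda>z1 z2. \<phi> z1 z2 * g z1 z2) = 0)}"

definition H2_disc_normsq :: "(complex \<Rightarrow> complex) \<Rightarrow> real" where
  "H2_disc_normsq f = (SUP r\<in>{0<..<1::real}. integral {0..2*pi} (\<lambda>t. (cmod (f (r * cis t)))^2) / (2 * pi))"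

text \<open>The Clark weight c_j: reciprocal of the modulus of the z1-derivative of phi at
  (tau, z2); this is constant in z2 on the closed disc minus lambda_j, we evaluate at z2 = 0.\<close>
definition clark_weight :: "complex poly poly \<Rightarrow> complex poly poly \<Rightarrow> complex \<Rightarrow> real" where
  "clark_weight P Pt \<tau> = 1 / cmod (deriv (\<lambda>w. rif P Pt w 0) \<tau>)"

end

theory Submission
  imports Defs "HOL-Complex_Analysis.Complex_Analysis"
    "HOL-Computational_Algebra.Fundamental_Theorem_Algebra"
begin

text \<open>Write \<open>p = p1 + z2 p2\<close> and \<open>pt = pt2 + z2 pt1\<close> for its reflection. At the exceptional
  value, \<open>pt - \<alpha> p = - c PI (b2 - z2 b1)\<close> with \<open>PI\<close> the monic polynomial with zeros \<open>\<tau> j\<close>, so up to a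
  constant \<open>R j / p = (\<alpha> - phi) / (z1 - \<tau> j)\<close>.

  For the identity, choose \<open>Q\<close> with \<open>\<bar>Q\<bar>\<^sup>2 = \<bar>p1\<bar>\<^sup>2 - \<bar>p2\<bar>\<^sup>2\<close> on the circle (Fejer--Riesz); it is
  divisible by \<open>PI\<close>. On the curve \<open>z2 b1 = b2\<close> the first \<open>l\<close> squares vanish and the identity becomes
  the Schur--Cohn decomposition of \<open>b2 b2* - b1 b1*\<close>, which determines the other \<open>R j\<close>, multiples of
  \<open>PI\<close>, through a Bezout equation. On the lines \<open>z1 = \<tau> j\<close> it reduces to the normalization of
  \<open>R j\<close>, where the angular derivative of \<open>phi(z1, 0)\<close> enters. Vanishing on the curve and on the lines
  leaves a one-dimensional space, which is killed by \<open>z1 = 1 / cnj w1\<close>.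

  The identity bounds \<open>(1 - \<bar>z1\<bar>\<^sup>2) \<bar>R j / p\<bar>\<^sup>2\<close> by \<open>1 - \<bar>phi\<bar>\<^sup>2\<close>. Together with harmonicity in \<open>z2\<close> this
  bounds the means of \<open>\<bar>R j / p\<bar>\<^sup>2\<close> over the \<open>z2\<close>-circles uniformly, although \<open>R j / p\<close> itself can be
  unbounded, and inner products are then limits by bounded convergence in \<open>z1\<close> alone.\<close>

section \<open>Polynomials on the unit circle\<close>

text \<open>The Clark weight enters through one scalar relation. On the line z1 = \<tau> j both
  \<open>p\<close> and \<open>b2 - z2 b1\<close> are multiples of
  \<open>1 - cnj (lam j) * z2\<close>, so \<open>R j / p\<close> is constant there, of modulus d_j
  A_j / |c|, where A_j > 0 is the angular derivative of phi(z1, 0) at \<tau> j. The weight is 1 /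
  A_j, and the hypothesis on the norm becomes d_j^2 A_j = |c|^2. The number of new squares is no
  accident: once \<open>PI\<close> is cancelled, \<open>b1\<close> and \<open>b2\<close> have degree
  bound n - l, and Schur--Cohn produces one square per degree. The obstacle in comparing the two
  sides is that the curve gives vanishing only when both points z and w lie on it. The difference is
  Hermitian and of bidegree (n, 1) in each point, so the uniqueness argument is run twice: with w on
  the curve, and then with w arbitrary. The additional zero comes for free: at z1 = 1 / cnj w1 the
  factor in front of the squares of the \<open>R j\<close> vanishes, whatever they are, and what
  remains is the factorization that defines \<open>Q\<close>.\<close>

definition crefl :: "nat \<Rightarrow> complex poly \<Rightarrow> complex poly" where
  "crefl n p = (\<Sum>j\<le>n. monom (cnj (coeff p (n - j))) j)"

lemma coeff_crefl: "coeff (crefl n p) j = (if j \<le> n then cnj (coeff p (n - j)) else 0)"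
  by (simp add: crefl_def coeff_sum)

lemma degree_crefl: "degree (crefl n p) \<le> n"
  by (rule degree_le) (simp add: coeff_crefl)

lemma crefl_crefl: "degree p \<le> n \<Longrightarrow> crefl n (crefl n p) = p"
  by (rule poly_eqI) (auto simp: coeff_crefl coeff_eq_0)

lemma crefl_eq_0_iff: "degree p \<le> n \<Longrightarrow> crefl n p = 0 \<longleftrightarrow> p = 0"
  by (metis crefl_crefl coeff_crefl coeff_0 complex_cnj_zero poly_eqI)

lemma crefl_diff: "crefl n (p - q) = crefl n p - crefl n q"
  by (rule poly_eqI) (simp add: coeff_crefl)

lemma crefl_smult: "crefl n (smult a p) = smult (cnj a) (crefl n p)"
  by (rule poly_eqI) (simp add: coeff_crefl)

lemma poly_eq_sum_le: "degree p \<le> n \<Longrightarrow> poly p x = (\<Sum>i\<le>n. coeff p i * x ^ i)"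
  for p :: "'a::comm_semiring_1 poly"
  by (subst poly_altdef, rule sum.mono_neutral_left) (auto simp: coeff_eq_0)

lemma poly_crefl:
  assumes "degree p \<le> n" "z \<noteq> 0"
  shows "poly (crefl n p) z = z ^ n * cnj (poly p (1 / cnj z))"
proof -
  have "poly (crefl n p) z = (\<Sum>j\<le>n. cnj (coeff p (n - j)) * z ^ j)"
    by (simp add: crefl_def poly_sum poly_monom)
  also have "\<dots> = (\<Sum>j\<le>n. cnj (coeff p j) * z ^ (n - j))"
    by (rule sum.reindex_bij_witness[of _ "\<lambda>j. n - j" "\<lambda>j. n - j"]) auto
  also have "\<dots> = (\<Sum>j\<le>n. z ^ n * cnj (coeff p j * (1 / cnj z) ^ j))"
    using assms(2) by (intro sum.cong) (auto simp: power_diff power_divide divide_simps)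
  also have "\<dots> = z ^ n * cnj (poly p (1 / cnj z))"
    by (simp add: poly_eq_sum_le[OF assms(1)] sum_distrib_left)
  finally show ?thesis .
qed

lemma cnj_eq_inverse_circle: "cmod z = 1 \<Longrightarrow> 1 / cnj z = z"
  using complex_norm_square[of z] by (auto simp: divide_simps)

lemma cnj_mult_circle: "cmod z = 1 \<Longrightarrow> z * cnj z = 1"
  using complex_norm_square[of z] by simp

lemma poly_crefl_circle:
  assumes "degree p \<le> n" "cmod z = 1"
  shows "poly (crefl n p) z = z ^ n * cnj (poly p z)"
proof -
  have "z \<noteq> 0" using assms(2) by auto
  thus ?thesis using poly_crefl[OF assms(1)] cnj_eq_inverse_circle[OF assms(2)] by simp
qed

lemma infinite_circle_minus:
  assumes "finite F" shows "infinite ({z::complex. cmod z = 1} - F)"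
proof -
  have "connected (sphere (0::complex) 1)" by (rule connected_sphere) simp
  moreover have "(1::complex) \<in> sphere 0 1" "(-1::complex) \<in> sphere 0 1" by auto
  hence "sphere (0::complex) 1 \<noteq> {}" "\<nexists>x. sphere (0::complex) 1 = {x}"
    by (blast, metis one_neq_neg_one singletonD)
  ultimately have "infinite (sphere (0::complex) 1)" using connected_finite_iff_sing by blast
  moreover have "sphere (0::complex) 1 = {z. cmod z = 1}" by auto
  ultimately have "infinite {z::complex. cmod z = 1}" by simp
  thus ?thesis using assms by (metis Diff_infinite_finite)
qed

lemma poly_eqI_infinite:
  fixes p q :: "complex poly"
  assumes "infinite X" "\<And>z. z \<in> X \<Longrightarrow> poly p z = poly q z"
  shows "p = q"
proof (rule ccontr)
  assume "p \<noteq> q"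
  hence "finite {z. poly (p - q) z = 0}" by (intro poly_roots_finite) auto
  moreover have "X \<subseteq> {z. poly (p - q) z = 0}" using assms(2) by auto
  ultimately show False using assms(1) finite_subset by blast
qed

lemma poly_eqI_circle:
  fixes p q :: "complex poly"
  assumes "finite F" "\<And>z. cmod z = 1 \<Longrightarrow> z \<notin> F \<Longrightarrow> poly p z = poly q z"
  shows "p = q"
  using poly_eqI_infinite[OF infinite_circle_minus[OF assms(1)], of p q] assms(2) by auto

text \<open>On the circle reflection is conjugation times a power of \<open>z\<close>, hence
  multiplicative. The bounds need not be exact degrees: a missing leading coefficient acts as a root
  at infinity, reflected to a root at 0.\<close>

lemma crefl_mult:
  assumes "degree p \<le> m" "degree q \<le> n"
  shows "crefl (m + n) (p * q) = crefl m p * crefl n q"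
proof (rule poly_eqI_circle[of "{}"])
  fix z :: complex assume z: "cmod z = 1"
  have "degree (p * q) \<le> m + n" using assms degree_mult_le[of p q] by linarith
  thus "poly (crefl (m + n) (p * q)) z = poly (crefl m p * crefl n q) z"
    using assms z by (simp add: poly_crefl_circle power_add)
qed auto

lemma crefl_linear: "crefl 1 [:-a, 1:] = [:1, - cnj a:]"
  by (rule poly_eqI) (auto simp: coeff_crefl coeff_pCons split: nat.split)

lemma crefl_1_1: "crefl 1 1 = [:0, 1:]"
  by (rule poly_eqI) (auto simp: coeff_crefl coeff_pCons split: nat.split)

lemma poly_div_root:
  fixes p :: "complex poly"
  assumes "poly p a = 0" "degree p \<le> Suc n"
  obtains p' where "p = [:-a, 1:] * p'" "degree p' \<le> n"
proof -
  obtain p' where p': "p = [:-a, 1:] * p'" using assms(1) by (auto simp: poly_eq_0_iff_dvd)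
  have "degree p' \<le> n"
  proof (cases "p' = 0")
    case False
    hence "degree p = 1 + degree p'" unfolding p' by (subst degree_mult_eq) auto
    thus ?thesis using assms(2) by simp
  qed auto
  thus ?thesis using that p' by blast
qed

subsection \<open>Fejer-Riesz factorization\<close>

text \<open>\<open>t / z ^ n\<close> is a trigonometric polynomial, nonnegative on the circle. The
  finite set \<open>F\<close> lets a factor with a root on the circle be divided out without
  checking the quotient at that root.\<close>

definition circle_nonneg :: "nat \<Rightarrow> complex poly \<Rightarrow> bool" where
  "circle_nonneg n t \<longleftrightarrow>
     (\<exists>F. finite F \<and> (\<forall>z. cmod z = 1 \<longrightarrow> z \<notin> F \<longrightarrow>
        (\<exists>x\<ge>0. poly t z = of_real x * z ^ n)))"

lemma circle_nonneg_self_crefl: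
  assumes "circle_nonneg n t" "degree t \<le> 2 * n"
  shows "crefl (2 * n) t = t"
proof -
  from assms obtain F where F: "finite F"
    "\<And>z. cmod z = 1 \<Longrightarrow> z \<notin> F \<Longrightarrow> \<exists>x\<ge>0. poly t z = of_real x * z ^ n"
    by (auto simp: circle_nonneg_def)
  show ?thesis
  proof (rule poly_eqI_circle[OF F(1)])
    fix z :: complex assume z: "cmod z = 1" "z \<notin> F"
    obtain x where x: "poly t z = of_real x * z ^ n" using F(2)[OF z] by blast
    have "z ^ n * cnj z ^ n = 1" using cnj_mult_circle[OF z(1)] by (metis power_mult_distrib power_one)
    thus "poly (crefl (2 * n) t) z = poly t z"
      using assms(2) z by (simp add: poly_crefl_circle x mult_2 power_add)
  qed
qed

text \<open>On the circle the factor equals \<open>z\<close> times |z - a|^2, so one power of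
  \<open>z\<close> and a positive number are removed. The case a = 0 covers division by
  \<open>z\<close> itself.\<close>

lemma circle_nonneg_div:
  assumes "circle_nonneg (Suc n) t" and t: "t = [:-a, 1:] * [:1, - cnj a:] * t'"
  shows "circle_nonneg n t'"
proof -
  from assms obtain F where F: "finite F"
    "\<And>z. cmod z = 1 \<Longrightarrow> z \<notin> F \<Longrightarrow> \<exists>x\<ge>0. poly t z = of_real x * z ^ Suc n"
    by (auto simp: circle_nonneg_def)
  show ?thesis unfolding circle_nonneg_def
  proof (intro exI[of _ "insert a F"] conjI allI impI)
    fix z :: complex assume z: "cmod z = 1" "z \<notin> insert a F"
    then obtain x where x: "x \<ge> 0" "poly t z = of_real x * z ^ Suc n" using F(2) by blast
    have zz: "z * cnj z = 1" by (rule cnj_mult_circle[OF z(1)])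
    have "(z - a) * (1 - cnj a * z) = z * ((z - a) * (cnj z - cnj a))"
      using zz by (simp add: algebra_simps) 
    also have "\<dots> = z * of_real ((cmod (z - a))\<^sup>2)"
      by (metis complex_cnj_diff complex_norm_square)
    finally have *: "(z - a) * (1 - cnj a * z) = z * of_real ((cmod (z - a))\<^sup>2)" .
    have "poly t z = (z - a) * (1 - cnj a * z) * poly t' z"
      unfolding t by (simp add: algebra_simps)
    hence "z * (of_real ((cmod (z - a))\<^sup>2) * poly t' z) = z * (of_real x * z ^ n)"
      using x(2) unfolding * by (simp only: mult_ac power_Suc)
    moreover have z0: "z \<noteq> 0" "z - a \<noteq> 0" using z by auto
    ultimately have "of_real ((cmod (z - a))\<^sup>2) * poly t' z = of_real x * z ^ n"
      using mult_left_cancel by blast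
    hence "poly t' z = of_real (x / (cmod (z - a))\<^sup>2) * z ^ n"
      using z0 by (simp add: nonzero_eq_divide_eq mult_ac)
    thus "\<exists>x\<ge>0. poly t' z = of_real x * z ^ n"
      using x(1) by (intro exI[of _ "x / (cmod (z - a))\<^sup>2"]) auto
  qed (use F in auto)
qed

text \<open>A simple zero on the circle would make the real function obtained after division by
  \<open>z ^ n\<close> change sign as the angle passes through it.\<close>

lemma circle_nonneg_double_root:
  assumes "circle_nonneg n ([:-a, 1:] * s)" "cmod a = 1"
  shows "poly s a = 0"
proof -
  from assms obtain F where F: "finite F"
    "\<And>z. cmod z = 1 \<Longrightarrow> z \<notin> F \<Longrightarrow> \<exists>x\<ge>0. poly ([:-a, 1:] * s) z = of_real x * z ^ n"
    by (auto simp: circle_nonneg_def)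
  have a0: "a \<noteq> 0" using assms(2) by auto
  \<comment> \<open>\<open>cis \<theta> - 1\<close> is \<open>2 * sin (\<theta> / 2)\<close> times a
    nonvanishing factor; \<open>k\<close> is the nonnegative function with this sign-changing real
    factor divided out, and it is continuous at 0.\<close>
  define k where "k \<theta> = \<i> * a * cis (\<theta> / 2) * poly s (a * cis \<theta>) / (a * cis \<theta>) ^ n" for \<theta> :: real
  have k_eq: "\<exists>x\<ge>0. of_real (2 * sin (\<theta> / 2)) * k \<theta> = of_real x"
    if notF: "a * cis \<theta> \<notin> F" for \<theta>
  proof -
    have "cmod (a * cis \<theta>) = 1" using assms(2) by (simp add: norm_mult)
    have eq: "poly ([:-a, 1:] * s) (a * cis \<theta>) = (a * cis \<theta> - a) * poly s (a * cis \<theta>)"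
      by (simp add: left_diff_distrib)
    obtain x where x: "x \<ge> 0"
      "(a * cis \<theta> - a) * poly s (a * cis \<theta>) = of_real x * (a * cis \<theta>) ^ n"
      using F(2)[OF \<open>cmod (a * cis \<theta>) = 1\<close> notF] unfolding eq by blast
    have "cis \<theta> - 1 = of_real (2 * sin (\<theta> / 2)) * \<i> * cis (\<theta> / 2)"
      using sin_double[of "\<theta> / 2"] cos_double_sin[of "\<theta> / 2"]
      by (auto simp: complex_eq_iff power2_eq_square)
    hence "of_real (2 * sin (\<theta> / 2)) * k \<theta> = (a * cis \<theta> - a) * poly s (a * cis \<theta>) / (a * cis \<theta>) ^ n"
      unfolding k_def by (simp add: algebra_simps)
    also have "\<dots> = of_real x" unfolding x(2) using a0 by simp
    finally show ?thesis using x(1) by blast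
  qed
  have cont: "isCont k 0" unfolding k_def using a0
    by (intro continuous_intros) (auto simp: cis_conv_exp intro!: continuous_intros)
  have ev: "eventually (\<lambda>\<theta>. a * cis \<theta> \<notin> F) (at 0)"
  proof -
    have "((\<lambda>\<theta>. a * cis \<theta>) \<longlongrightarrow> a * cis 0) (at 0)"
      by (auto simp: cis_conv_exp intro!: tendsto_eq_intros)
    moreover have "open (- (F - {a}))" using F(1) by (intro open_Compl finite_imp_closed finite_Diff)
    ultimately have "eventually (\<lambda>\<theta>. a * cis \<theta> \<in> - (F - {a})) (at 0)"
      by (intro topological_tendstoD) auto
    moreover have "eventually (\<lambda>\<theta>. \<theta> \<in> {-pi<..<pi} - {0}) (at (0::real))"
      by (rule eventually_at_in_open) auto
    ultimately show ?thesis
    proof eventually_elim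
      case (elim \<theta>)
      have "sin (\<theta> / 2) \<noteq> 0"
        using elim(2) sin_gt_zero[of "\<theta>/2"] sin_gt_zero[of "-\<theta>/2"] by (cases "\<theta> > 0") auto
      hence "cos \<theta> \<noteq> 1" using cos_double_sin[of "\<theta> / 2"] by auto
      hence "cis \<theta> \<noteq> 1" by (metis cis.simps(1) one_complex.simps(1))
      thus ?case using elim a0 by auto
    qed
  qed
  have lim: "(k \<longlongrightarrow> k 0) (at_right 0)" "(k \<longlongrightarrow> k 0) (at_left 0)"
    using cont by (auto simp: isCont_def filterlim_at_split)
  have evr: "eventually (\<lambda>\<theta>. Re (k \<theta>) \<ge> 0 \<and> Im (k \<theta>) = 0) (at_right 0)"
  proof -
    have "eventually (\<lambda>\<theta>::real. \<theta> \<in> {0<..<pi}) (at_right 0)"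
      by (rule eventually_at_right_real) auto
    moreover have "eventually (\<lambda>\<theta>. a * cis \<theta> \<notin> F) (at_right 0)"
      using ev by (simp add: eventually_at_split)
    ultimately show ?thesis
    proof eventually_elim
      case (elim \<theta>)
      have sn: "sin (\<theta> / 2) > 0" using elim by (intro sin_gt_zero) auto
      obtain x where x: "x \<ge> 0" "of_real (2 * sin (\<theta> / 2)) * k \<theta> = of_real x" using k_eq elim by blast
      have "k \<theta> = of_real (x / (2 * sin (\<theta> / 2)))" using x(2) sn by (simp add: field_simps)
      thus ?case using x(1) sn by simp
    qed
  qed
  have evl: "eventually (\<lambda>\<theta>. Re (k \<theta>) \<le> 0) (at_left 0)"
  proof -
    have "eventually (\<lambda>\<theta>::real. \<theta> \<in> {-pi<..<0}) (at_left 0)"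
      by (rule eventually_at_left_real) auto
    moreover have "eventually (\<lambda>\<theta>. a * cis \<theta> \<notin> F) (at_left 0)"
      using ev by (simp add: eventually_at_split)
    ultimately show ?thesis
    proof eventually_elim
      case (elim \<theta>)
      have sn: "sin (\<theta> / 2) < 0" using elim sin_gt_zero[of "-\<theta>/2"] by auto
      obtain x where x: "x \<ge> 0" "of_real (2 * sin (\<theta> / 2)) * k \<theta> = of_real x" using k_eq elim by blast
      have "k \<theta> = of_real (x / (2 * sin (\<theta> / 2)))" using x(2) sn by (simp add: field_simps)
      thus ?case using x(1) sn by (simp add: divide_le_0_iff)
    qed
  qed
  have "0 \<le> Re (k 0)"
    by (rule tendsto_lowerbound[OF tendsto_Re[OF lim(1)]]) (use evr in \<open>auto elim: eventually_mono\<close>)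
  moreover have "Im (k 0) = 0"
    by (rule tendsto_unique[OF _ tendsto_Im[OF lim(1)]])
       (use evr in \<open>auto intro!: tendsto_eventually elim: eventually_mono\<close>)
  moreover have "Re (k 0) \<le> 0"
    by (rule tendsto_upperbound[OF tendsto_Re[OF lim(2)]]) (use evl in auto)
  ultimately have "k 0 = 0" by (simp add: complex_eq_iff)
  thus ?thesis using a0 by (simp add: k_def)
qed

text \<open>Roots occur in pairs \<open>a\<close>, \<open>1 / cnj a\<close>, and one root of each
  pair goes to \<open>q\<close>. On the circle the pair is a double root; for a = 0 the partner lies
  at infinity.\<close>

lemma fejer_riesz:
  assumes "circle_nonneg n t" "degree t \<le> 2 * n"
  shows "\<exists>q. degree q \<le> n \<and> t = q * crefl n q"
  using assms
proof (induction n arbitrary: t)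
  case 0
  then obtain F where F: "finite F"
    "\<And>z. cmod z = 1 \<Longrightarrow> z \<notin> F \<Longrightarrow> \<exists>x\<ge>0. poly t z = of_real x"
    by (auto simp: circle_nonneg_def)
  obtain c where c: "t = [:c:]" using 0(2) by (auto elim: degree_eq_zeroE)
  have "infinite ({z::complex. cmod z = 1} - F)" by (rule infinite_circle_minus[OF F(1)])
  then obtain z where "cmod z = 1" "z \<notin> F" by (metis (mono_tags, lifting) DiffD1 DiffD2 finite.emptyI mem_Collect_eq equals0I)
  then obtain x where x: "x \<ge> 0" "c = of_real x" using F(2) c by auto
  show ?case
  proof (intro exI[of _ "[:of_real (sqrt x):]"] conjI)
    have "crefl 0 [:of_real (sqrt x):] = [:of_real (sqrt x):]"
      by (rule poly_eqI) (auto simp: coeff_crefl coeff_pCons split: nat.split)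
    thus "t = [:of_real (sqrt x):] * crefl 0 [:of_real (sqrt x):]"
      using x by (simp add: c flip: of_real_mult)
  qed auto
next
  case (Suc n)
  note sr = circle_nonneg_self_crefl[OF Suc.prems]
  have lin: "degree ([:-a, 1:] * q) \<le> Suc n" "crefl (Suc n) ([:-a, 1:] * q) = [:1, - cnj a:] * crefl n q"
    if "degree q \<le> n" for a q
    using that degree_mult_le[of "[:-a, 1:]" q] crefl_mult[of "[:-a, 1:]" 1 q n] crefl_linear[of a] by auto
  have step: ?case if t: "t = [:-a, 1:] * [:1, - cnj a:] * t'" and d: "degree t' \<le> 2 * n" for a t'
  proof -
    obtain q where q: "degree q \<le> n" "t' = q * crefl n q"
      using Suc.IH[OF circle_nonneg_div[OF Suc.prems(1) t] d] by blast
    show ?thesis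
    proof (intro exI conjI)
      show "degree ([:-a, 1:] * q) \<le> Suc n" using lin(1)[OF q(1)] .
      show "t = [:-a, 1:] * q * crefl (Suc n) ([:-a, 1:] * q)"
        unfolding lin(2)[OF q(1)] t by (subst q(2)) (simp only: mult_ac)
    qed
  qed
  consider "t = 0" | "t \<noteq> 0" "coeff t 0 = 0" | "coeff t 0 \<noteq> 0" by auto
  thus ?case
  proof cases
    case 1
    thus ?thesis by (intro exI[of _ 0]) auto
  next
    case 2
    \<comment> \<open>Self-reflection moves the vanishing constant coefficient to the index
      \<open>2 * Suc n\<close>, so dividing by \<open>z\<close> alone lowers the degree bound by
      two.\<close>
    have "coeff t (2 * Suc n) = 0" using arg_cong[OF sr, of "\<lambda>p. coeff p (2 * Suc n)"] 2
      by (simp add: coeff_crefl)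
    hence "degree t \<noteq> 2 * Suc n" using 2(1) leading_coeff_0_iff[of t] by metis
    hence dt: "degree t \<le> Suc (2 * n)" using Suc.prems by simp
    obtain t' where t': "t = [:-0, 1:] * t'" "degree t' \<le> 2 * n"
      by (rule poly_div_root[OF _ dt, of 0]) (use 2 in \<open>auto simp: poly_0_coeff_0\<close>)
    show ?thesis by (rule step[of 0 t']) (use t' in auto)
  next
    case 3
    have "coeff t (2 * Suc n) \<noteq> 0" using arg_cong[OF sr, of "\<lambda>p. coeff p 0"] 3
      by (auto simp: coeff_crefl)
    hence dt: "degree t = 2 * Suc n" using Suc.prems by (metis le_degree le_antisym)
    hence "\<not> constant (poly t)" by (simp add: constant_degree)
    then obtain a where a: "poly t a = 0" using Fundamental_Theorem_Algebra.fundamental_theorem_of_algebra by blast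
    have a0: "a \<noteq> 0" using a 3 by (auto simp: poly_0_coeff_0)
    have "degree t \<le> Suc (2 * n + 1)" using dt by simp
    from poly_div_root[OF a this] obtain s where s: "t = [:-a, 1:] * s" "degree s \<le> 2 * n + 1"
      by blast
    have "poly s (1 / cnj a) = 0"
    proof (cases "cmod a = 1")
      case True
      thus ?thesis using circle_nonneg_double_root[of "Suc n" a s] Suc.prems(1) s(1) cnj_eq_inverse_circle by simp
    next
      case False
      have "poly t (1 / cnj a) = 0"
        using poly_crefl[of t "2 * Suc n" "1 / cnj a"] a0 a Suc.prems(2) unfolding sr by simp
      moreover have "1 / cnj a \<noteq> a"
      proof
        assume "1 / cnj a = a"
        hence "a * cnj a = 1" using a0 by (simp add: field_simps)
        hence "of_real ((cmod a)\<^sup>2) = (1::complex)" by (simp only: complex_norm_square)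
        hence "(cmod a)\<^sup>2 = 1" using of_real_eq_1_iff by blast
        hence "cmod a = 1" using norm_ge_zero[of a] by (simp add: power2_eq_1_iff)
        thus False using False by simp
      qed
      moreover have "poly t x = (x - a) * poly s x" for x
        unfolding s(1) by (simp add: left_diff_distrib)
      ultimately show ?thesis by (metis mult_eq_0_iff right_minus_eq)
    qed
    moreover have "degree s \<le> Suc (2 * n)" using s(2) by simp
    ultimately obtain s' where
      s': "s = [:- (1 / cnj a), 1:] * s'" "degree s' \<le> 2 * n" using poly_div_root by blast
    have "[:- (1 / cnj a), 1:] = smult (- (1 / cnj a)) [:1, - cnj a:]" using a0 by simp
    hence "t = [:-a, 1:] * [:1, - cnj a:] * smult (- (1 / cnj a)) s'"
      unfolding s(1) s'(1) by (simp only: mult_smult_left mult_smult_right mult.assoc)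
    thus ?thesis by (rule step) (use s'(2) in simp)
  qed
qed

subsection \<open>Schur--Cohn sums of squares\<close>

text \<open>For b = f * b' the difference telescopes: the squares of \<open>f\<close> times the
  difference for \<open>b'\<close>, plus the difference for \<open>f\<close> times the reflected
  squares of \<open>b'\<close>. A linear factor with root \<open>a\<close> contributes |a|^2 - 1,
  nonnegative since \<open>b\<close> has no root in the disc.\<close>

lemma schur_cohn_squares:
  assumes "degree b \<le> N" "\<And>z. cmod z < 1 \<Longrightarrow> poly b z \<noteq> 0"
  shows "\<exists>e. (\<forall>i<N. degree (e i) \<le> N - 1) \<and>
     (\<forall>z w. poly b z * cnj (poly b w) - poly (crefl N b) z * cnj (poly (crefl N b) w) =
        (1 - z * cnj w) * (\<Sum>i<N. poly (e i) z * cnj (poly (e i) w)))"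
  using assms
proof (induction N arbitrary: b)
  case 0
  then obtain c where c: "b = [:c:]" by (auto elim: degree_eq_zeroE)
  have "crefl 0 b = [:cnj c:]" unfolding c
    by (rule poly_eqI) (auto simp: coeff_crefl coeff_pCons split: nat.split)
  thus ?case by (simp add: c)
next
  case (Suc N)
  have "\<exists>f b' a0. b = f * b' \<and> degree b' \<le> N \<and> degree f \<le> 1 \<and> 
      (\<forall>z w. poly f z * cnj (poly f w) - poly (crefl 1 f) z * cnj (poly (crefl 1 f) w)
        = (1 - z * cnj w) * (of_real a0 * cnj (of_real a0)))"
  proof (cases "degree b \<le> N")
    case True
    \<comment> \<open>A degree below the bound is a root at infinity: the factor 1, taken with bound
      1, reflects to \<open>z\<close> and contributes the square of the constant 1.\<close>
    have "poly (crefl 1 1) z = z" for z by (simp only: crefl_1_1) simp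
    thus ?thesis using True by (intro exI[of _ "1::complex poly"] exI[of _ b] exI[of _ "1::real"]) simp
  next
    case False
    hence "\<not> constant (poly b)" by (simp add: constant_degree)
    then obtain a where a: "poly b a = 0" using Fundamental_Theorem_Algebra.fundamental_theorem_of_algebra by blast
    hence a1: "cmod a \<ge> 1" using Suc.prems(2) by (metis not_le)
    obtain b' where b': "b = [:-a, 1:] * b'" "degree b' \<le> N"
      using poly_div_root[OF a Suc.prems(1)] by blast
    have "(cmod a)\<^sup>2 - 1 \<ge> 0" using a1 by simp
    hence "of_real (sqrt ((cmod a)\<^sup>2 - 1)) * cnj (of_real (sqrt ((cmod a)\<^sup>2 - 1))) = a * cnj a - 1"
      by (simp add: complex_norm_square[symmetric] del: of_real_power flip: of_real_mult) 
    hence k: "of_real k * cnj (of_real k) = a * cnj a - 1" if "k = sqrt ((cmod a)\<^sup>2 - 1)" for k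
      using that by simp
    have pr: "poly (crefl 1 [:-a, 1:]) z = 1 - cnj a * z" for z by (subst crefl_linear) simp
    show ?thesis
    proof (intro exI conjI allI)
      show "b = [:-a, 1:] * b'" "degree b' \<le> N" by fact+
      show "degree [:-a, 1:] \<le> 1" by simp
      show "poly [:-a, 1:] z * cnj (poly [:-a, 1:] w) - poly (crefl 1 [:-a, 1:]) z * cnj (poly (crefl 1 [:-a, 1:]) w)
        = (1 - z * cnj w) * (of_real (sqrt ((cmod a)\<^sup>2 - 1)) * cnj (of_real (sqrt ((cmod a)\<^sup>2 - 1))))" for z w
        unfolding k[OF refl] pr by (simp add: algebra_simps)
    qed
  qed
  then obtain f b' a0 where f: "b = f * b'" "degree b' \<le> N" "degree f \<le> 1"
    "\<And>z w. poly f z * cnj (poly f w) - poly (crefl 1 f) z * cnj (poly (crefl 1 f) w)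
        = (1 - z * cnj w) * (of_real a0 * cnj (of_real a0))" by blast
  have "poly b' z \<noteq> 0" if "cmod z < 1" for z using Suc.prems(2)[OF that] f(1) by auto
  from Suc.IH[OF f(2) this] obtain e where e: "\<And>i. i < N \<Longrightarrow> degree (e i) \<le> N - 1"
    "\<And>z w. poly b' z * cnj (poly b' w) - poly (crefl N b') z * cnj (poly (crefl N b') w) =
        (1 - z * cnj w) * (\<Sum>i<N. poly (e i) z * cnj (poly (e i) w))" by blast
  define e' where "e' i = (if i < N then f * e i else smult (of_real a0) (crefl N b'))" for i
  have rb: "crefl (Suc N) b = crefl 1 f * crefl N b'" using crefl_mult[OF f(3,2)] f(1) by simp
  show ?case
  proof (intro exI[of _ e'] conjI allI impI)
    fix i assume "i < Suc N"
    show "degree (e' i) \<le> Suc N - 1"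
    proof (cases "i < N")
      case True
      thus ?thesis using degree_mult_le[of f "e i"] f(3) e(1)[OF True] by (simp add: e'_def)
    next
      case False
      have "degree (smult (of_real a0) (crefl N b')) \<le> N" using degree_smult_le degree_crefl le_trans by blast
      thus ?thesis using False by (simp add: e'_def)
    qed
  next
    fix z w
    have eq: "(\<Sum>i<Suc N. poly (e' i) z * cnj (poly (e' i) w)) =
       poly f z * cnj (poly f w) * (\<Sum>i<N. poly (e i) z * cnj (poly (e i) w)) +
       of_real a0 * cnj (of_real a0) * (poly (crefl N b') z * cnj (poly (crefl N b') w))"
      by (simp add: e'_def sum_distrib_left mult_ac)
    have "poly b z * cnj (poly b w) - poly (crefl (Suc N) b) z * cnj (poly (crefl (Suc N) b) w) =
      poly f z * cnj (poly f w) * (poly b' z * cnj (poly b' w) - poly (crefl N b') z * cnj (poly (crefl N b') w))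
      + (poly f z * cnj (poly f w) - poly (crefl 1 f) z * cnj (poly (crefl 1 f) w)) * (poly (crefl N b') z * cnj (poly (crefl N b') w))"
      unfolding rb unfolding f(1) poly_mult complex_cnj_mult by (simp add: algebra_simps)
    also have "\<dots> = (1 - z * cnj w) * (\<Sum>i<Suc N. poly (e' i) z * cnj (poly (e' i) w))"
      unfolding e(2) f(4) eq by (simp add: algebra_simps)
    finally show "poly b z * cnj (poly b w) - poly (crefl (Suc N) b) z * cnj (poly (crefl (Suc N) b) w) =
       (1 - z * cnj w) * (\<Sum>i<Suc N. poly (e' i) z * cnj (poly (e' i) w))" .
  qed
qed

subsection \<open>Bezout with degree bounds\<close>

lemma poly_gcd_bezout:
  fixes a b :: "'a::field poly"
  shows "\<exists>d x y. d dvd a \<and> d dvd b \<and> d = x * a + y * b"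
proof (induction "if b = 0 then 0 else Suc (degree b)" arbitrary: a b rule: less_induct)
  case less
  show ?case
  proof (cases "b = 0")
    case True
    thus ?thesis by (intro exI[of _ a] exI[of _ 1] exI[of _ 0]) auto
  next
    case False
    have "a mod b = 0 \<or> degree (a mod b) < degree b" using degree_mod_less[OF False] .
    hence "\<exists>d x y. d dvd b \<and> d dvd a mod b \<and> d = x * b + y * (a mod b)"
      by (intro less) (use False in auto)
    then obtain d x y where d: "d dvd b" "d dvd a mod b" "d = x * b + y * (a mod b)" by blast
    have "d dvd a" using d(1,2) by (simp add: dvd_mod_iff)
    moreover have "d = y * a + (x - y * (a div b)) * b"
      unfolding d(3) by (simp add: algebra_simps minus_mult_div_eq_mod[symmetric])
    ultimately show ?thesis using d(1) by blast
  qed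
qed

lemma poly_coprime_bezout:
  fixes a b :: "'a::field poly"
  assumes "coprime a b"
  obtains x y where "x * a + y * b = 1"
proof -
  obtain d x y where d: "d dvd a" "d dvd b" "d = x * a + y * b" using poly_gcd_bezout by blast
  hence "d dvd 1" using assms by (auto simp: coprime_def)
  then obtain e where "1 = d * e" by (auto elim: dvdE)
  hence "(e * x) * a + (e * y) * b = 1" using d(3) by (simp add: algebra_simps)
  thus ?thesis using that by blast
qed

lemma poly_coprime_dvd_cancel:
  fixes a b u v :: "'a::field poly"
  assumes "coprime a b" "a * u = b * v" "b \<noteq> 0"
  obtains g where "u = b * g" "v = a * g"
proof -
  obtain x y where "x * a + y * b = 1" using poly_coprime_bezout[OF assms(1)] by blast
  hence "u = (x * a + y * b) * u" by simp
  also have "\<dots> = x * (a * u) + b * (y * u)" by (simp add: algebra_simps)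
  also have "\<dots> = b * (x * v + y * u)" unfolding assms(2) by (simp add: algebra_simps)
  finally have u: "u = b * (x * v + y * u)" .
  hence "b * v = b * (a * (x * v + y * u))" using assms(2) by (metis mult.left_commute)
  hence "v = a * (x * v + y * u)" using assms(3) by simp
  thus ?thesis using that u by blast
qed

lemma coprime_no_common_root:
  fixes a b :: "'a::field poly"
  assumes "coprime a b" shows "poly a x \<noteq> 0 \<or> poly b x \<noteq> 0"
proof -
  obtain u v where "u * a + v * b = 1" using poly_coprime_bezout[OF assms] by blast
  hence "poly u x * poly a x + poly v x * poly b x = 1" by (metis poly_1 poly_add poly_mult)
  thus ?thesis by auto
qed

text \<open>Reducing the multiplier of \<open>a\<close> modulo \<open>b\<close> bounds
  \<open>r\<close>; the degree of \<open>s\<close> is then forced by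
  \<open>b * s = f - a * r\<close>, because \<open>b\<close> has degree exactly
  \<open>N\<close>.\<close>

lemma bezout_degree_aux:
  fixes a b f :: "complex poly"
  assumes "coprime a b" "degree a \<le> N" "degree b = N" "degree f < 2 * N"
  shows "\<exists>r s. degree r \<le> N - 1 \<and> degree s \<le> N - 1 \<and> a * r + b * s = f"
proof -
  have N: "N > 0" using assms(4) by simp
  obtain x y where one: "x * a + y * b = 1"
    using poly_coprime_bezout[OF assms(1)] by blast
  have "a * (x * f) + b * (y * f) = (x * a + y * b) * f" by (simp add: algebra_simps)
  hence xy: "a * (x * f) + b * (y * f) = f" unfolding one by simp
  define r where "r = (x * f) mod b"
  define s where "s = y * f + a * ((x * f) div b)"
  have b0: "b \<noteq> 0" using assms(3) N by auto
  have r: "degree r < N" using degree_mod_less[of b "x * f"] b0 assms(3) N by (auto simp: r_def)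
  have xf: "b * ((x * f) div b) + r = x * f" by (simp add: r_def)
  have "a * r + b * s = a * (b * ((x * f) div b) + r) + b * (y * f)"
    unfolding s_def by (simp add: algebra_simps)
  also note xf
  finally have "a * r + b * s = a * (x * f) + b * (y * f)" .
  hence eq: "a * r + b * s = f" using xy by simp
  have "degree s \<le> N - 1"
  proof (cases "s = 0")
    case False
    have "degree (b * s) = N + degree s" using False b0 assms(3) by (simp add: degree_mult_eq)
    moreover have "b * s = f - a * r" using eq by (simp add: algebra_simps)
    moreover have "degree (a * r) \<le> N + (N - 1)" using degree_mult_le[of a r] assms(2) r by linarith
    hence "degree (f - a * r) \<le> 2 * N - 1" using assms(4) by (intro degree_diff_le) auto
    ultimately have "N + degree s \<le> 2 * N - 1" by metis
    thus ?thesis using N by linarith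
  qed auto
  thus ?thesis using eq r by (intro exI[of _ r] exI[of _ s]) auto
qed

lemma bezout_degree:
  fixes a b f :: "complex poly"
  assumes "coprime a b" "max (degree a) (degree b) = N" "degree f < 2 * N"
  shows "\<exists>r s. degree r \<le> N - 1 \<and> degree s \<le> N - 1 \<and> a * r + b * s = f"
proof (cases "degree b = N")
  case True
  thus ?thesis using bezout_degree_aux[of a b N f] assms by auto
next
  case False
  hence "degree a = N" "degree b \<le> N" using assms(2) by auto
  thus ?thesis using bezout_degree_aux[of b a N f] assms by (metis add.commute coprime_commute)
qed

section \<open>The pair of polynomials and its reflection\<close>

lemma poly_prod_roots_dvd:
  fixes q :: "'a::field poly"
  assumes "finite K" "inj_on \<tau> K" "\<And>k. k \<in> K \<Longrightarrow> poly q (\<tau> k) = 0"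
  shows "(\<Prod>k\<in>K. [:- \<tau> k, 1:]) dvd q"
  using assms
proof (induction K arbitrary: q)
  case (insert j K)
  then obtain g where g: "q = (\<Prod>k\<in>K. [:- \<tau> k, 1:]) * g" by (metis dvdE inj_on_insert insertCI)
  have "\<tau> j \<noteq> \<tau> k" if "k \<in> K" for k using that insert.prems(1) insert.hyps by (auto simp: inj_on_def)
  hence "poly (\<Prod>k\<in>K. [:- \<tau> k, 1:]) (\<tau> j) \<noteq> 0" using insert.hyps by (simp add: poly_prod)
  hence "poly g (\<tau> j) = 0" using insert.prems(2)[of j] g by simp
  hence "[:- \<tau> j, 1:] dvd g" by (simp add: poly_eq_0_iff_dvd)
  hence "[:- \<tau> j, 1:] * (\<Prod>k\<in>K. [:- \<tau> k, 1:]) dvd g * (\<Prod>k\<in>K. [:- \<tau> k, 1:])"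
    by (rule mult_dvd_mono) simp
  also have "g * (\<Prod>k\<in>K. [:- \<tau> k, 1:]) = q" unfolding g by (rule mult.commute)
  finally show ?case unfolding prod.insert[OF insert.hyps] .
qed auto

lemma degree_prod_linear:
  "finite K \<Longrightarrow> degree (\<Prod>k\<in>K. [:- \<tau> k, 1:]) = card K" for \<tau> :: "'b \<Rightarrow> 'a::field"
  by (subst degree_prod_eq_sum_degree) auto

text \<open>A root on the circle is its own reflection:
  \<open>1 - cnj t * z = - cnj t * (z - t)\<close> when \<open>cmod t = 1\<close>.\<close>

lemma crefl_prod_linear:
  assumes "finite K" "\<And>k. k \<in> K \<Longrightarrow> cmod (\<tau> k) = 1"
  shows "crefl (card K) (\<Prod>k\<in>K. [:- \<tau> k, 1:]) = smult (\<Prod>k\<in>K. - cnj (\<tau> k)) (\<Prod>k\<in>K. [:- \<tau> k, 1:])"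
  using assms
proof (induction K)
  case empty
  show ?case by (simp add: crefl_def one_pCons monom_0)
next
  case (insert j K)
  have "[:1, - cnj (\<tau> j):] = smult (- cnj (\<tau> j)) [:- \<tau> j, 1:]"
    using cnj_mult_circle[of "\<tau> j"] insert.prems by (simp add: mult.commute)
  moreover have "crefl (1 + card K) ([:- \<tau> j, 1:] * (\<Prod>k\<in>K. [:- \<tau> k, 1:])) =
      crefl 1 [:- \<tau> j, 1:] * crefl (card K) (\<Prod>k\<in>K. [:- \<tau> k, 1:])"
    using insert.hyps by (intro crefl_mult) (auto simp: degree_prod_linear)
  ultimately show ?case
    using insert by (simp only: prod.insert card_insert_disjoint crefl_linear plus_1_eq_Suc
      mult_smult_left mult_smult_right smult_smult insert_iff simp_thms
      mult.commute[of "- cnj (\<tau> j)"])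
qed

text \<open>The lists in \<open>cop\<close> are \<open>p\<close> and its reflection as polynomials
  in z2; reflecting in z2 interchanges the two coefficients.\<close>

locale inner_pair =
  fixes n :: nat and p1 p2 :: "complex poly"
  assumes deg_p1: "degree p1 \<le> n" and deg_p2: "degree p2 \<le> n"
    and nozero: "\<And>z w. cmod z < 1 \<Longrightarrow> cmod w < 1 \<Longrightarrow> poly p1 z + w * poly p2 z \<noteq> 0"
    and cop: "coprime [:p1, p2:] [:crefl n p2, crefl n p1:]"
begin

abbreviation "pt1 \<equiv> crefl n p1"
abbreviation "pt2 \<equiv> crefl n p2"

text \<open>If \<open>p2\<close> were larger at a point of the open disc, the zero
  \<open>- p1 / p2\<close> of \<open>p\<close> in z2 would lie in the open disc; the circle follows
  by continuity.\<close>

lemma p2_le: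
  assumes "cmod z \<le> 1" shows "cmod (poly p2 z) \<le> cmod (poly p1 z)"
proof -
  have *: "cmod (poly p2 z) - cmod (poly p1 z) \<le> 0" if "z \<in> ball 0 1" for z
  proof (rule ccontr)
    assume "\<not> ?thesis"
    hence "cmod (- poly p1 z / poly p2 z) < 1" "poly p2 z \<noteq> 0" by (auto simp: norm_divide divide_simps)
    thus False using nozero[of z "- poly p1 z / poly p2 z"] that by auto
  qed
  have "z \<in> closure (ball 0 1)" using assms by simp
  hence "cmod (poly p2 z) - cmod (poly p1 z) \<le> 0"
    by (rule continuous_le_on_closure[rotated]) (use * in \<open>auto intro!: continuous_intros\<close>)
  thus ?thesis by simp
qed

text \<open>At a zero of \<open>p1\<close> on the circle \<open>p2\<close> vanishes too, hence so do
  both reflections, and a linear polynomial in z1 would divide both \<open>p\<close> and its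
  reflection.\<close>

lemma p1_nz:
  assumes "cmod z \<le> 1" shows "poly p1 z \<noteq> 0"
proof (cases "cmod z < 1")
  case True
  thus ?thesis using nozero[of z 0] by auto
next
  case False
  hence z: "cmod z = 1" using assms by simp
  show ?thesis
  proof
    assume r1: "poly p1 z = 0"
    hence r2: "poly p2 z = 0" using p2_le[of z] z by simp
    have "poly pt1 z = 0" "poly pt2 z = 0"
      using r1 r2 z by (auto simp: poly_crefl_circle deg_p1 deg_p2)
    with r1 r2 have "[:[:-z, 1:]:] dvd [:p1, p2:]" "[:[:-z, 1:]:] dvd [:pt2, pt1:]"
      by (auto simp: const_poly_dvd_iff coeff_pCons poly_eq_0_iff_dvd split: nat.split)
    hence "[:[:-z, 1:]:] dvd 1" using cop coprime_common_divisor by blast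
    hence "[:-z, 1:] dvd 1" by (simp only: is_unit_const_poly_iff)
    hence "poly 1 z = 0" by (simp only: poly_eq_0_iff_dvd)
    thus "False" by simp
  qed
qed

lemma p1_ne_0: "p1 \<noteq> 0"
  using p1_nz[of 0] by auto

text \<open>On the circle this is \<open>z ^ n\<close> times |p1|^2 - |p2|^2. Its zeros there are
  the only z1 on the circle over which \<open>p\<close> can vanish with cmod z2 \<le> 1.\<close>

definition defect :: "complex poly" where
  "defect = p1 * pt1 - p2 * pt2"

lemma defect_circle:
  assumes "cmod z = 1"
  shows "poly defect z = of_real ((cmod (poly p1 z))\<^sup>2 - (cmod (poly p2 z))\<^sup>2) * z ^ n"
  using assms unfolding defect_def
  by (simp add: poly_crefl_circle deg_p1 deg_p2 complex_norm_square algebra_simps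
      del: of_real_power)

lemma defect_nonneg: "circle_nonneg n defect"
  unfolding circle_nonneg_def
proof (intro exI[of _ "{}"] conjI allI impI)
  fix z :: complex assume z: "cmod z = 1"
  show "\<exists>x\<ge>0. poly defect z = of_real x * z ^ n"
    by (rule exI[of _ "(cmod (poly p1 z))\<^sup>2 - (cmod (poly p2 z))\<^sup>2"])
       (use z p2_le[of z] in \<open>simp add: defect_circle del: of_real_diff\<close>)
qed auto

lemma degree_defect: "degree defect \<le> 2 * n"
proof -
  have "degree (p1 * pt1) \<le> n + n" "degree (p2 * pt2) \<le> n + n"
    using degree_mult_le[of p1 pt1] degree_mult_le[of p2 pt2] deg_p1 deg_p2
      degree_crefl[of n p1] degree_crefl[of n p2] by linarith+
  thus ?thesis unfolding defect_def mult_2 by (intro degree_diff_le) auto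
qed

text \<open>If \<open>p1 pt1 = p2 pt2\<close>, then with \<open>d = gcd p1 p2\<close> the polynomial \<open>p / d\<close> is a common
  factor of \<open>p\<close> and its reflection.\<close>
lemma defect_ne_0: "defect \<noteq> 0"
proof
  assume "defect = 0"
  hence eq: "p1 * pt1 = p2 * pt2" by (simp add: defect_def)
  obtain d x y where d: "d dvd p1" "d dvd p2" "d = x * p1 + y * p2" using poly_gcd_bezout by blast
  obtain a where "p1 = d * a" using d(1) by (rule dvdE)
  moreover obtain b where "p2 = d * b" using d(2) by (rule dvdE)
  ultimately have ab: "p1 = d * a" "p2 = d * b" by blast+
  have d0: "d \<noteq> 0" and a0: "a \<noteq> 0" using p1_ne_0 ab by auto
  have "d * 1 = d * (x * a + y * b)" using d(3) unfolding ab by (simp add: algebra_simps)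
  hence one: "1 = x * a + y * b" using d0 mult_left_cancel by blast
  have "d * (a * pt1) = d * (b * pt2)" using eq unfolding ab[symmetric] mult.assoc[symmetric] .
  hence ab': "a * pt1 = b * pt2" using d0 by simp
  have "pt2 = (x * a + y * b) * pt2" using one by simp
  also have "\<dots> = x * a * pt2 + y * (b * pt2)" by (simp add: algebra_simps)
  also have "\<dots> = a * (x * pt2 + y * pt1)" unfolding ab'[symmetric] by (simp add: algebra_simps)
  finally have k2: "pt2 = a * (x * pt2 + y * pt1)" .
  hence "a * pt1 = a * (b * (x * pt2 + y * pt1))" using ab' by (metis mult.left_commute)
  hence k1: "pt1 = b * (x * pt2 + y * pt1)" using a0 by simp
  have "[:a, b:] dvd [:p1, p2:]"
    by (rule dvdI[of _ _ "[:d:]"]) (simp add: ab mult.commute)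
  moreover have "[:a, b:] dvd [:pt2, pt1:]"
    by (rule dvdI[of _ _ "[:x * pt2 + y * pt1:]"]) (use k1 k2 in \<open>simp add: mult.commute\<close>)
  ultimately have "[:a, b:] dvd 1" using cop coprime_common_divisor by blast
  hence "degree [:a, b:] = 0" by (auto simp: is_unit_poly_iff)
  hence "b = 0" by (auto split: if_splits)
  hence "pt1 = 0" using k1 by simp
  thus False using crefl_eq_0_iff[OF deg_p1] p1_ne_0 by simp
qed

text \<open>phi is not the constant \<alpha>: otherwise coprimality would make \<open>p\<close> a
  unit, so \<open>p2\<close> and its reflection vanish, and then \<open>p1\<close> vanishes as
  well.\<close>

lemma pt_ne_smult: "smult \<alpha> p1 \<noteq> pt2 \<or> pt1 \<noteq> smult \<alpha> p2"
proof (rule ccontr)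
  assume eq: "\<not> ?thesis"
  hence "[:p1, p2:] dvd [:pt2, pt1:]" by (intro dvdI[of _ _ "[:[:\<alpha>:]:]"]) (simp add: mult.commute)
  hence "[:p1, p2:] dvd 1" by (rule coprime_common_divisor[OF cop dvd_refl])
  hence "degree [:p1, p2:] = 0" by (auto simp: is_unit_poly_iff)
  hence "p2 = 0" by (auto split: if_splits)
  moreover from this have "pt2 = 0" by (simp add: crefl_eq_0_iff)
  ultimately show False using eq p1_ne_0 crefl_eq_0_iff[OF deg_p1] by auto
qed

text \<open>The slice phi(z, 0). It has a double role: it carries the angular derivatives at the
  \<tau> j, and by the mean value property it is the average of phi(z, .) over circles in
  z2.\<close>

definition psi :: "complex \<Rightarrow> complex" where
  "psi z = poly pt2 z / poly p1 z"

lemma psi_holomorphic: "psi holomorphic_on ball 0 1"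
  unfolding psi_def using p1_nz by (intro holomorphic_intros) auto

lemma norm_psi_circle: "cmod z = 1 \<Longrightarrow> cmod (psi z) = cmod (poly p2 z) / cmod (poly p1 z)"
  by (simp add: psi_def norm_divide poly_crefl_circle deg_p2 norm_mult norm_power)

lemma norm_psi_le:
  assumes "cmod z \<le> 1" shows "cmod (psi z) \<le> 1"
proof -
  have circ: "cmod (psi z) \<le> 1" if "cmod z = 1" for z
    using that p2_le[of z] p1_nz[of z] by (simp add: norm_psi_circle divide_le_eq_1)
  show ?thesis
  proof (cases "cmod z = 1")
    case False
    have "norm (psi z) \<le> 1"
    proof (rule maximum_modulus_frontier[of psi "ball 0 1"])
      show "psi holomorphic_on interior (ball 0 1)" using psi_holomorphic by simp
      show "continuous_on (closure (ball 0 1)) psi"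
        unfolding psi_def using p1_nz by (auto intro!: continuous_intros)
      show "z \<in> ball 0 1" using False assms by simp
      show "norm (psi w) \<le> 1" if "w \<in> frontier (ball 0 1)" for w using that circ by simp
    qed auto
    thus ?thesis .
  qed (use circ in auto)
qed

end

section \<open>The exceptional value\<close>

text \<open>\<open>u1\<close> and \<open>u2\<close> together say that \<open>\<alpha> p - pt\<close>
  is c PI (b2 - z2 b1), where PI is the product of the z1 - \<tau> k. By \<open>b_lam\<close> the
  curve z2 b1 = b2 still passes through every (\<tau> j, lam j) after the cancellation; this is
  first-order information about the boundary zeros.\<close>

locale exceptional = inner_pair +
  fixes l :: nat and \<alpha> c :: complex and \<tau> lam :: "nat \<Rightarrow> complex" and b1 b2 :: "complex poly"
  assumes norm_alpha: "cmod \<alpha> = 1" and l_le: "1 \<le> l" "l \<le> n"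
    and norm_tau: "\<And>j. j \<in> {1..l} \<Longrightarrow> cmod (\<tau> j) = 1" and inj_tau: "inj_on \<tau> {1..l}"
    and norm_lam: "\<And>j. j \<in> {1..l} \<Longrightarrow> cmod (lam j) = 1"
    and bcop: "coprime b1 b2" and bdeg: "max (degree b1) (degree b2) = n - l"
    and c_nz: "c \<noteq> 0" and b2_ne_0: "b2 \<noteq> 0"
    and u2: "smult \<alpha> p1 - pt2 = b2 * smult c (\<Prod>k\<in>{1..l}. [:- \<tau> k, 1:])"
    and u1: "pt1 - smult \<alpha> p2 = b1 * smult c (\<Prod>k\<in>{1..l}. [:- \<tau> k, 1:])"
    and p_lam: "\<And>j. j \<in> {1..l} \<Longrightarrow> poly p1 (\<tau> j) + lam j * poly p2 (\<tau> j) = 0"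
    and b_lam: "\<And>j. j \<in> {1..l} \<Longrightarrow> poly b2 (\<tau> j) = lam j * poly b1 (\<tau> j)"
begin

definition PI :: "complex poly" where "PI = (\<Prod>k\<in>{1..l}. [:- \<tau> k, 1:])"
definition PIo :: "nat \<Rightarrow> complex poly" where "PIo j = (\<Prod>k\<in>{1..l} - {j}. [:- \<tau> k, 1:])"

lemma PI_split: "j \<in> {1..l} \<Longrightarrow> PI = [:- \<tau> j, 1:] * PIo j"
  unfolding PI_def PIo_def by (subst prod.remove[of _ j]) auto

lemma poly_PI: "j \<in> {1..l} \<Longrightarrow> poly PI z = (z - \<tau> j) * poly (PIo j) z"
  by (simp add: PI_split left_diff_distrib)

lemma poly_PI_eq_0_iff: "poly PI z = 0 \<longleftrightarrow> z \<in> \<tau> ` {1..l}"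
  by (auto simp: PI_def poly_prod)

lemma PIo_split: "j \<in> {1..l} \<Longrightarrow> k \<in> {1..l} \<Longrightarrow> j \<noteq> k \<Longrightarrow>
    PIo j = [:- \<tau> k, 1:] * (\<Prod>i\<in>{1..l} - {j} - {k}. [:- \<tau> i, 1:])"
  unfolding PIo_def by (subst prod.remove[of _ k]) auto

lemma PIo_tau_nz:
  assumes "j \<in> {1..l}" shows "poly (PIo j) (\<tau> j) \<noteq> 0"
proof -
  have "\<tau> j \<noteq> \<tau> k" if "k \<in> {1..l} - {j}" for k
    using that inj_onD[OF inj_tau _ assms, of k] by fastforce
  thus ?thesis by (simp add: PIo_def poly_prod)
qed

lemma PIo_tau_other: "j \<in> {1..l} \<Longrightarrow> k \<in> {1..l} \<Longrightarrow> j \<noteq> k \<Longrightarrow> poly (PIo j) (\<tau> k) = 0"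
  by (simp add: PIo_split)

lemma degree_PI: "degree PI = l"
  by (simp add: PI_def degree_prod_linear)

lemma degree_PIo: "j \<in> {1..l} \<Longrightarrow> degree (PIo j) = l - 1"
  by (simp add: PIo_def degree_prod_linear)

lemma PI_ne_0: "PI \<noteq> 0"
  by (auto simp: PI_def)

lemmas u1' = u1[folded PI_def] and u2' = u2[folded PI_def]

lemma poly_u2: "\<alpha> * poly p1 z - poly pt2 z = c * poly b2 z * poly PI z"
  using arg_cong[OF u2', of "\<lambda>p. poly p z"] by (simp add: mult_ac)

lemma poly_u1: "poly pt1 z - \<alpha> * poly p2 z = c * poly b1 z * poly PI z"
  using arg_cong[OF u1', of "\<lambda>p. poly p z"] by (simp add: mult_ac)

lemma alpha_cnj: "\<alpha> * cnj \<alpha> = 1" "cnj \<alpha> * \<alpha> = 1"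
  using cnj_mult_circle[OF norm_alpha] by (auto simp: mult.commute)

lemma b_tau_nz:
  assumes "j \<in> {1..l}" shows "poly b1 (\<tau> j) \<noteq> 0" "poly b2 (\<tau> j) \<noteq> 0"
proof -
  have "lam j \<noteq> 0" using norm_lam[OF assms] by auto
  thus "poly b1 (\<tau> j) \<noteq> 0" "poly b2 (\<tau> j) \<noteq> 0"
    using coprime_no_common_root[OF bcop, of "\<tau> j"] b_lam[OF assms] by auto
qed

text \<open>A zero would let \<open>psi\<close> take the unimodular value \<alpha> inside the disc.
  By the maximum principle \<open>psi\<close> would be constant, which makes \<open>b2\<close>
  vanish identically.\<close>

lemma b2_nz: "cmod z < 1 \<Longrightarrow> poly b2 z \<noteq> 0"
proof
  assume z: "cmod z < 1" and "poly b2 z = 0"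
  hence "psi z = \<alpha>" using poly_u2[of z] p1_nz[of z] by (simp add: psi_def divide_eq_eq)
  moreover have "psi constant_on (ball 0 1)"
  proof (rule maximum_modulus_principle[OF psi_holomorphic])
    show "norm (psi w) \<le> norm (psi z)" if "w \<in> ball 0 1" for w
      using that norm_psi_le[of w] \<open>psi z = \<alpha>\<close> norm_alpha by simp
  qed (use z in auto)
  ultimately have const: "psi w = \<alpha>" if "cmod w < 1" for w
    using that z unfolding constant_on_def by (metis dist_0_norm mem_ball)
  have "infinite (ball (0::complex) 1)"
    using uncountable_infinite uncountable_ball zero_less_one by blast
  hence "b2 * smult c PI = 0"
    unfolding u2'[symmetric]
  proof (rule poly_eqI_infinite)
    fix w :: complex assume "w \<in> ball 0 1"
    thus "poly (smult \<alpha> p1 - pt2) w = poly 0 w"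
      using const[of w] p1_nz[of w] by (simp add: psi_def field_simps)
  qed
  thus False using b2_ne_0 c_nz PI_ne_0 by simp
qed

text \<open>Reflection carries \<open>\<alpha> p1 - pt2\<close> to a unimodular multiple of
  \<open>pt1 - \<alpha> p2\<close>, and \<open>PI\<close> to a multiple of itself. Hence
  \<open>b1 / b2\<close> is unimodular on the circle wherever defined, as a Blaschke product should
  be.\<close>

lemma b1_crefl: "\<exists>\<omega>. cmod \<omega> = 1 \<and> b1 = smult \<omega> (crefl (n - l) b2)"
proof -
  define \<gamma> where "\<gamma> = (\<Prod>k\<in>{1..l}. - cnj (\<tau> k))"
  have n\<gamma>: "cmod \<gamma> = 1" using norm_tau by (simp add: \<gamma>_def prod_norm[symmetric])
  have cPI: "crefl l PI = smult \<gamma> PI"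
    using crefl_prod_linear[of "{1..l}" \<tau>] norm_tau by (simp add: PI_def \<gamma>_def)
  have "degree b2 \<le> n - l" using bdeg by simp
  moreover have "degree (smult c PI) \<le> l" using degree_PI degree_smult_le by metis
  ultimately have "crefl (n - l + l) (b2 * smult c PI) = crefl (n - l) b2 * crefl l (smult c PI)"
    by (rule crefl_mult)
  hence "crefl n (smult \<alpha> p1 - pt2) = crefl (n - l) b2 * smult (cnj c * \<gamma>) PI"
    using l_le by (simp add: u2' crefl_smult cPI mult.commute)
  moreover have "crefl n (smult \<alpha> p1 - pt2) = smult (cnj \<alpha>) (b1 * smult c PI)"
    unfolding u1'[symmetric] using alpha_cnj
    by (simp add: crefl_diff crefl_smult crefl_crefl deg_p2 smult_diff_right)
  ultimately have "smult (cnj \<alpha> * c) b1 * PI = smult (cnj c * \<gamma>) (crefl (n - l) b2) * PI"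
    by (simp add: mult.commute)
  hence "smult (cnj \<alpha> * c) b1 = smult (cnj c * \<gamma>) (crefl (n - l) b2)"
    using PI_ne_0 mult_right_cancel by blast
  hence "smult (\<alpha> / c) (smult (cnj \<alpha> * c) b1) = smult (\<alpha> / c * (cnj c * \<gamma>)) (crefl (n - l) b2)"
    by simp
  hence "b1 = smult (\<alpha> / c * (cnj c * \<gamma>)) (crefl (n - l) b2)"
    using alpha_cnj c_nz by (simp add: mult_ac)
  moreover have "cmod (\<alpha> / c * (cnj c * \<gamma>)) = 1"
    using norm_alpha n\<gamma> c_nz by (simp add: norm_mult norm_divide)
  ultimately show ?thesis by blast
qed

lemma b1_ne_0: "b1 \<noteq> 0"
  using b_tau_nz(1)[of 1] l_le by auto

text \<open>The angular derivative of \<open>cnj \<alpha> * psi\<close> at the boundary point \<open>\<tau> j\<close>.\<close>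
definition h1 :: "nat \<Rightarrow> complex \<Rightarrow> complex" where
  "h1 j z = cnj \<alpha> * c * poly b2 z * poly (PIo j) z / poly p1 z"
definition ang :: "nat \<Rightarrow> complex" where
  "ang j = - \<tau> j * h1 j (\<tau> j)"

lemma one_minus_psi:
  assumes "j \<in> {1..l}" "cmod z \<le> 1"
  shows "1 - cnj \<alpha> * psi z = h1 j z * (z - \<tau> j)"
proof -
  have "1 - cnj \<alpha> * psi z = cnj \<alpha> * (\<alpha> * poly p1 z - poly pt2 z) / poly p1 z"
    using p1_nz[OF assms(2)] alpha_cnj by (simp add: psi_def field_simps)
  thus ?thesis unfolding poly_u2 poly_PI[OF assms(1)] h1_def by simp
qed

text \<open>Entering the disc at \<tau> j in the direction \<open>- \<tau> j * v\<close> with Re v >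
  0, the inequality \<open>Re (1 - cnj \<alpha> * psi z) \<ge> 0\<close> yields
  \<open>Re (v * ang j) \<ge> 0\<close> in the limit. Holding for all such \<open>v\<close>, it puts
  \<open>ang j\<close> on the nonnegative real axis; it is nonzero because each factor in its
  definition is.\<close>

lemma ang_pos:
  assumes j: "j \<in> {1..l}" shows "ang j = of_real (Re (ang j))" "Re (ang j) > 0"
proof -
  have ge: "Re (v * ang j) \<ge> 0" if v: "Re v > 0" for v
  proof -
    define g where "g \<epsilon> = \<tau> j * (1 - of_real \<epsilon> * v)" for \<epsilon> :: real
    have "((\<lambda>\<epsilon>. Re (- \<tau> j * v * h1 j (g \<epsilon>))) \<longlongrightarrow> Re (- \<tau> j * v * h1 j (\<tau> j))) (at_right 0)"
      unfolding h1_def g_def using p1_nz[of "\<tau> j"] norm_tau[OF j]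
      by (auto intro!: tendsto_eq_intros)
    moreover have "eventually (\<lambda>\<epsilon>::real. Re (- \<tau> j * v * h1 j (g \<epsilon>)) \<ge> 0) (at_right 0)"
    proof -
      have "v \<noteq> 0" using v by auto
      \<comment> \<open>Exactly for positive step sizes below this bound does
        \<open>g \<epsilon>\<close> lie in the open disc.\<close>
      hence pos: "2 * Re v / (cmod v)\<^sup>2 > 0" using v by simp
      have "eventually (\<lambda>\<epsilon>::real. \<epsilon> \<in> {0<..<2 * Re v / (cmod v)\<^sup>2}) (at_right 0)"
        by (rule eventually_at_right_real[OF pos])
      thus ?thesis
      proof eventually_elim
        case (elim \<epsilon>)
        have "(cmod (1 - of_real \<epsilon> * v))\<^sup>2 = 1 - \<epsilon> * (2 * Re v - \<epsilon> * (cmod v)\<^sup>2)"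
          unfolding cmod_power2 by (simp add: power2_eq_square algebra_simps)
        also have "\<dots> < 1" using elim \<open>v \<noteq> 0\<close> by (auto simp: field_simps)
        finally have "cmod (1 - of_real \<epsilon> * v) < 1" by (simp only: abs_square_less_1 abs_norm_cancel)
        hence gn: "cmod (g \<epsilon>) < 1" using norm_tau[OF j] by (simp add: g_def norm_mult)
        have "cmod (cnj \<alpha> * psi (g \<epsilon>)) \<le> 1" using norm_psi_le[of "g \<epsilon>"] gn norm_alpha by (simp add: norm_mult)
        hence "Re (1 - cnj \<alpha> * psi (g \<epsilon>)) \<ge> 0" using complex_Re_le_cmod[of "cnj \<alpha> * psi (g \<epsilon>)"] by simp
        also have "1 - cnj \<alpha> * psi (g \<epsilon>) = of_real \<epsilon> * (- \<tau> j * v * h1 j (g \<epsilon>))"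
          using one_minus_psi[OF j, of "g \<epsilon>"] gn by (simp add: g_def algebra_simps)
        finally have "0 \<le> \<epsilon> * Re (- \<tau> j * v * h1 j (g \<epsilon>))" by (simp only: times_complex.sel Re_complex_of_real Im_complex_of_real mult_zero_left diff_zero)
        thus ?case using elim by (simp add: zero_le_mult_iff)
      qed
    qed
    ultimately have "Re (- \<tau> j * v * h1 j (\<tau> j)) \<ge> 0"
      by (intro tendsto_lowerbound) auto
    thus ?thesis by (simp only: ang_def mult_ac mult_minus_left mult_minus_right)
  qed
  have ge': "Re (ang j) - y * Im (ang j) \<ge> 0" for y using ge[of "Complex 1 y"] by simp
  have "Im (ang j) = 0"
  proof (rule ccontr)
    assume "Im (ang j) \<noteq> 0"
    thus False using ge'[of "(Re (ang j) + 1) / Im (ang j)"] by simp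
  qed
  thus "ang j = of_real (Re (ang j))" by (simp add: complex_eq_iff)
  moreover have "ang j \<noteq> 0"
    using p1_nz[of "\<tau> j"] norm_tau[OF j] b_tau_nz[OF j] PIo_tau_nz[OF j] c_nz norm_alpha
    by (auto simp: ang_def h1_def)
  ultimately show "Re (ang j) > 0" using ge'[of 0] by (metis diff_zero mult_zero_left of_real_0 order_le_less)
qed

end

section \<open>The sums of squares identity\<close>

context exceptional
begin

definition pf :: "complex \<Rightarrow> complex \<Rightarrow> complex" where "pf z w = poly p1 z + w * poly p2 z"
definition ptf :: "complex \<Rightarrow> complex \<Rightarrow> complex" where "ptf z w = poly pt2 z + w * poly pt1 z"
text \<open>Its zero set is the curve z2 = b2 / b1, the graph of 1 / B_\<alpha>, along which the
  reflection of \<open>p\<close> equals \<alpha> times \<open>p\<close>.\<close>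

definition beta :: "complex \<Rightarrow> complex \<Rightarrow> complex" where "beta z w = poly b2 z - w * poly b1 z"

lemma ptf_eq: "ptf z w = \<alpha> * pf z w - c * poly PI z * beta z w"
proof -
  have "poly pt2 z = \<alpha> * poly p1 z - c * poly b2 z * poly PI z"
    "poly pt1 z = \<alpha> * poly p2 z + c * poly b1 z * poly PI z"
    using poly_u1[of z] poly_u2[of z] by (simp_all add: algebra_simps)
  thus ?thesis by (simp add: ptf_def pf_def beta_def algebra_simps)
qed

lemma defect_tau:
  assumes "j \<in> {1..l}" shows "poly defect (\<tau> j) = 0"
proof -
  have "cmod (poly p1 (\<tau> j)) = cmod (lam j * poly p2 (\<tau> j))"
    using p_lam[OF assms] by (metis add_eq_0_iff2 norm_minus_cancel)
  thus ?thesis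
    using norm_lam[OF assms] defect_circle[OF norm_tau[OF assms]] by (simp add: norm_mult)
qed

lemma pf_tau:
  assumes "j \<in> {1..l}" shows "pf (\<tau> j) w = poly p1 (\<tau> j) * (1 - cnj (lam j) * w)"
proof -
  have "poly p2 (\<tau> j) = cnj (lam j) * (lam j * poly p2 (\<tau> j))"
    using cnj_mult_circle[OF norm_lam[OF assms]] by (simp add: mult.commute mult.left_commute)
  also have "lam j * poly p2 (\<tau> j) = - poly p1 (\<tau> j)"
    using p_lam[OF assms] by (simp add: add_eq_0_iff add.commute)
  finally show ?thesis by (simp add: pf_def algebra_simps)
qed

text \<open>The factor in \<open>w\<close> is the one in \<open>pf_tau\<close>, so
  \<open>beta / pf\<close> is constant on the line z1 = \<tau> j away from the zero.\<close>

lemma beta_tau: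
  assumes "j \<in> {1..l}" shows "beta (\<tau> j) w = poly b2 (\<tau> j) * (1 - cnj (lam j) * w)"
proof -
  have "poly b1 (\<tau> j) = cnj (lam j) * (lam j * poly b1 (\<tau> j))"
    using cnj_mult_circle[OF norm_lam[OF assms]] by (simp add: mult.commute mult.left_commute)
  thus ?thesis unfolding b_lam[OF assms, symmetric] by (simp add: beta_def algebra_simps)
qed

text \<open>The space of polynomials of bidegree \<open>(n, 1)\<close> vanishing on the curve \<open>beta = 0\<close> and on
  the lines \<open>z1 = \<tau> j\<close> is spanned by \<open>PI * beta\<close>; one more zero kills it.\<close>
lemma vanish:
  assumes deg: "degree r \<le> n" "degree s \<le> n" and curve: "b1 * r + b2 * s = 0"
    and lines: "\<And>j. j \<in> {1..l} \<Longrightarrow> poly r (\<tau> j) = 0"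
    and x: "poly r x = 0" "poly s x = 0" "x \<notin> \<tau> ` {1..l}"
  shows "r = 0" "s = 0"
proof -
  have "b1 * r = b2 * (- s)" using curve by (simp add: eq_neg_iff_add_eq_0)
  from poly_coprime_dvd_cancel[OF bcop this b2_ne_0] obtain g where g: "r = b2 * g" "- s = b1 * g"
    by blast
  have "PI dvd g"
    unfolding PI_def
  proof (rule poly_prod_roots_dvd[OF _ inj_tau])
    show "poly g (\<tau> k) = 0" if "k \<in> {1..l}" for k using lines[OF that] b_tau_nz[OF that] g(1) by simp
  qed simp
  then obtain k where k: "g = PI * k" by (rule dvdE)
  have "k = 0"
  proof (rule ccontr)
    assume k0: "k \<noteq> 0"
    have "degree r = degree b2 + l + degree k" "degree (- s) = degree b1 + l + degree k"
      unfolding g k using b1_ne_0 b2_ne_0 PI_ne_0 k0 degree_PI by (simp_all add: degree_mult_eq)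
    hence "degree k = 0" using deg bdeg l_le by (simp add: max_def split: if_splits)
    then obtain k' where k': "k = [:k':]" by (auto elim: degree_eq_zeroE)
    have "poly PI x \<noteq> 0" using x(3) poly_PI_eq_0_iff by blast
    moreover have "poly (- s) x = 0" using x(2) by simp
    ultimately have "poly b2 x * k' = 0" "poly b1 x * k' = 0"
      using x(1) unfolding g k k' by auto
    hence "k' = 0" using coprime_no_common_root[OF bcop, of x] by auto
    thus False using k0 k' by simp
  qed
  thus "r = 0" "s = 0" using g k by auto
qed

end

text \<open>\<open>d_norm\<close> is the normalization of \<open>R j\<close> in algebraic form:
  weight 1 / A times squared norm (d A / |c|)^2 equals 1, with A = Re (ang j).\<close>

locale normalized = exceptional +
  fixes d :: "nat \<Rightarrow> real"
  assumes d_pos: "\<And>j. j \<in> {1..l} \<Longrightarrow> d j > 0"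
    and d_norm: "\<And>j. j \<in> {1..l} \<Longrightarrow> (d j)\<^sup>2 * Re (ang j) = (cmod c)\<^sup>2"
begin

definition Rf :: "nat \<Rightarrow> complex \<Rightarrow> complex \<Rightarrow> complex" where
  "Rf j z w = of_real (d j) * poly (PIo j) z * beta z w"

lemma Rf_tau_other: "j \<in> {1..l} \<Longrightarrow> k \<in> {1..l} \<Longrightarrow> j \<noteq> k \<Longrightarrow> Rf j (\<tau> k) w = 0"
  by (simp add: Rf_def PIo_tau_other)

text \<open>For w1 = \<tau> j the identity of squares collapses to this proportionality: among the
  squares only the j-th survives, \<open>Q\<close> vanishes, and the reflection of \<open>p\<close>
  is \<alpha> times \<open>p\<close>. The value of the constant is the content of
  \<open>d_norm\<close>.\<close>

lemma line_eq:
  assumes j: "j \<in> {1..l}"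
  shows "cnj c * (\<alpha> * pf (\<tau> j) w) = - \<tau> j * of_real (d j) * Rf j (\<tau> j) w"
proof -
  have p1: "poly p1 (\<tau> j) \<noteq> 0" using p1_nz[of "\<tau> j"] norm_tau[OF j] by simp
  have "c * cnj c = of_real ((d j)\<^sup>2 * Re (ang j))"
    unfolding d_norm[OF j] by (rule complex_norm_square[symmetric])
  also have "\<dots> = of_real ((d j)\<^sup>2) * ang j"
    using ang_pos(1)[OF j] by (metis of_real_mult)
  finally have "c * cnj c * poly p1 (\<tau> j) = of_real ((d j)\<^sup>2) * (ang j * poly p1 (\<tau> j))"
    by (simp add: mult.assoc)
  also have "ang j * poly p1 (\<tau> j) = c * (- \<tau> j * cnj \<alpha> * poly b2 (\<tau> j) * poly (PIo j) (\<tau> j))"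
    using p1 by (simp add: ang_def h1_def)
  finally have "c * (cnj c * poly p1 (\<tau> j)) =
      c * (of_real ((d j)\<^sup>2) * (- \<tau> j * cnj \<alpha> * poly b2 (\<tau> j) * poly (PIo j) (\<tau> j)))"
    by (simp only: mult_ac)
  hence eq: "cnj c * poly p1 (\<tau> j) = of_real ((d j)\<^sup>2) * (- \<tau> j * cnj \<alpha> * poly b2 (\<tau> j) * poly (PIo j) (\<tau> j))"
    using c_nz mult_left_cancel by blast
  have "cnj c * (\<alpha> * pf (\<tau> j) w) = \<alpha> * (cnj c * poly p1 (\<tau> j)) * (1 - cnj (lam j) * w)"
    unfolding pf_tau[OF j] by (simp only: mult_ac)
  hence "cnj c * (\<alpha> * pf (\<tau> j) w) = \<alpha> * (of_real ((d j)\<^sup>2) * (- \<tau> j * cnj \<alpha> * poly b2 (\<tau> j) * poly (PIo j) (\<tau> j))) * (1 - cnj (lam j) * w)"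
    unfolding eq .
  also have "\<dots> = (\<alpha> * cnj \<alpha>) * (- \<tau> j * of_real (d j) * Rf j (\<tau> j) w)"
    unfolding Rf_def beta_tau[OF j] by (simp only: of_real_power of_real_mult power2_eq_square mult_ac mult_minus_left mult_minus_right)
  finally show ?thesis using alpha_cnj by simp
qed

lemma sums_of_squares:
  obtains q r s where "degree q \<le> n" "\<And>i. i < n - l \<Longrightarrow> degree (r i) \<le> n - 1"
    "\<And>i. i < n - l \<Longrightarrow> degree (s i) \<le> n - 1"
    "\<And>z1 z2 w1 w2. pf z1 z2 * cnj (pf w1 w2) - ptf z1 z2 * cnj (ptf w1 w2) =
       (1 - z1 * cnj w1) * ((\<Sum>j\<in>{1..l}. Rf j z1 z2 * cnj (Rf j w1 w2)) +
         (\<Sum>i<n - l. (poly (r i) z1 + z2 * poly (s i) z1) * cnj (poly (r i) w1 + w2 * poly (s i) w1)))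
       + (1 - z2 * cnj w2) * (poly q z1 * cnj (poly q w1))"
proof -
  define N where "N = n - l"
  obtain q where q: "degree q \<le> n" "defect = q * crefl n q"
    using fejer_riesz[OF defect_nonneg degree_defect] by blast
  have q_tau: "poly q (\<tau> j) = 0" if j: "j \<in> {1..l}" for j
  proof -
    have "poly (q * crefl n q) (\<tau> j) = 0" unfolding q(2)[symmetric] by (rule defect_tau[OF j])
    moreover have "\<tau> j \<noteq> 0" using norm_tau[OF j] by auto
    ultimately show ?thesis using poly_crefl_circle[OF q(1) norm_tau[OF j]] by auto
  qed
  have "PI dvd q" unfolding PI_def by (rule poly_prod_roots_dvd[OF _ inj_tau q_tau]) auto
  then obtain q' where q': "q = PI * q'" by (rule dvdE)
  have deg_q': "degree q' \<le> N"
  proof (cases "q' = 0")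
    case False
    hence "degree q = l + degree q'" using PI_ne_0 degree_PI by (simp add: q' degree_mult_eq)
    thus ?thesis using q(1) by (simp add: N_def)
  qed auto
  have deg_b: "degree b1 \<le> N" "degree b2 \<le> N" using bdeg by (auto simp: N_def)
  obtain e where e: "\<And>i. i < N \<Longrightarrow> degree (e i) \<le> N - 1"
    "\<And>z w. poly b2 z * cnj (poly b2 w) - poly (crefl N b2) z * cnj (poly (crefl N b2) w) =
        (1 - z * cnj w) * (\<Sum>i<N. poly (e i) z * cnj (poly (e i) w))"
    using schur_cohn_squares[OF deg_b(2) b2_nz] by blast
  obtain \<omega> where \<omega>: "cmod \<omega> = 1" "b1 = smult \<omega> (crefl N b2)" using b1_crefl unfolding N_def by blast
  have e_b: "poly b2 z * cnj (poly b2 w) - poly b1 z * cnj (poly b1 w) =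
        (1 - z * cnj w) * (\<Sum>i<N. poly (e i) z * cnj (poly (e i) w))" for z w
  proof -
    have "poly b1 z * cnj (poly b1 w) = (\<omega> * cnj \<omega>) * (poly (crefl N b2) z * cnj (poly (crefl N b2) w))"
      by (simp add: \<omega>(2))
    thus ?thesis using e(2) cnj_mult_circle[OF \<omega>(1)] by simp
  qed
  \<comment> \<open>\<open>e i * q'\<close> has degree at most 2 N - 1, so the solutions have degree
    at most N - 1. Multiplying them by \<open>PI\<close> gives degree at most n - 1 and makes the
    new squares vanish on the lines z1 = \<tau> j.\<close>
  have "\<forall>i. \<exists>r s. i < N \<longrightarrow> degree r \<le> N - 1 \<and> degree s \<le> N - 1 \<and> b1 * r + b2 * s = e i * q'"
  proof
    fix i
    show "\<exists>r s. i < N \<longrightarrow> degree r \<le> N - 1 \<and> degree s \<le> N - 1 \<and> b1 * r + b2 * s = e i * q'"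
    proof (cases "i < N")
      case True
      have "degree (e i * q') < 2 * N"
        using degree_mult_le[of "e i" q'] e(1)[OF True] deg_q' True by linarith
      thus ?thesis using bezout_degree[OF bcop bdeg[folded N_def]] by blast
    qed auto
  qed
  then obtain r0 s0 where rs0: "\<And>i. i < N \<Longrightarrow> degree (r0 i) \<le> N - 1 \<and> degree (s0 i) \<le> N - 1 \<and>
      b1 * r0 i + b2 * s0 i = e i * q'" by metis
  define r where "r i = PI * r0 i" for i
  define s where "s i = PI * s0 i" for i
  have deg_rs: "degree (r i) \<le> n - 1" "degree (s i) \<le> n - 1" if i: "i < N" for i
    using degree_mult_le[of PI "r0 i"] degree_mult_le[of PI "s0 i"] rs0[OF i] i l_le
    unfolding r_def s_def degree_PI N_def by linarith+
  define Sf where "Sf i z w = poly (r i) z + w * poly (s i) z" for i z w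
  define D where "D z1 z2 w1 w2 = pf z1 z2 * cnj (pf w1 w2) - ptf z1 z2 * cnj (ptf w1 w2)
     - (1 - z1 * cnj w1) * ((\<Sum>j\<in>{1..l}. Rf j z1 z2 * cnj (Rf j w1 w2)) + (\<Sum>i<N. Sf i z1 z2 * cnj (Sf i w1 w2)))
     - (1 - z2 * cnj w2) * (poly q z1 * cnj (poly q w1))" for z1 z2 w1 w2
  have D_herm: "D w1 w2 z1 z2 = cnj (D z1 z2 w1 w2)" for z1 z2 w1 w2
    by (simp add: D_def mult.commute)
  \<comment> \<open>On the curve z2 b1 = b2, so multiplying by \<open>b1\<close> turns the new
    polynomials into the left-hand side of the Bezout equation.\<close>
  have S_b: "poly b1 z * Sf i z w = poly (e i) z * poly q z" if "i < N" "beta z w = 0" for i z w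
  proof -
    have "poly b1 z * Sf i z w = poly PI z * poly (b1 * r0 i + b2 * s0 i) z"
      using that(2) by (simp add: Sf_def r_def s_def beta_def algebra_simps)
    thus ?thesis using rs0[OF that(1)] by (simp add: q')
  qed

  have D_line: "D z1 z2 (\<tau> j) w2 = 0" if j: "j \<in> {1..l}" for z1 z2 w2 j
  proof -
    have PI0: "poly PI (\<tau> j) = 0" using j poly_PI_eq_0_iff by blast
    have sumR: "(\<Sum>k\<in>{1..l}. Rf k z1 z2 * cnj (Rf k (\<tau> j) w2)) = Rf j z1 z2 * cnj (Rf j (\<tau> j) w2)"
      using j Rf_tau_other[OF _ j] by (subst sum.remove[of _ j]) (auto intro!: sum.neutral)
    have sumS: "(\<Sum>i<N. Sf i z1 z2 * cnj (Sf i (\<tau> j) w2)) = 0"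
      by (simp add: Sf_def r_def s_def PI0)
    have pt: "ptf (\<tau> j) w2 = \<alpha> * pf (\<tau> j) w2" by (simp add: ptf_eq PI0)
    have tt: "\<tau> j * cnj (\<tau> j) = 1" by (rule cnj_mult_circle[OF norm_tau[OF j]])
    have "c * cnj (\<alpha> * pf (\<tau> j) w2) = cnj (cnj c * (\<alpha> * pf (\<tau> j) w2))" by simp
    also have "\<dots> = - cnj (\<tau> j) * of_real (d j) * cnj (Rf j (\<tau> j) w2)"
      unfolding line_eq[OF j] by simp
    finally have le: "c * cnj (\<alpha> * pf (\<tau> j) w2) = - cnj (\<tau> j) * of_real (d j) * cnj (Rf j (\<tau> j) w2)" .
    have "D z1 z2 (\<tau> j) w2 = pf z1 z2 * cnj (pf (\<tau> j) w2) - ptf z1 z2 * cnj (ptf (\<tau> j) w2)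
       - (1 - z1 * cnj (\<tau> j)) * (Rf j z1 z2 * cnj (Rf j (\<tau> j) w2))"
      unfolding D_def sumR sumS by (simp add: q_tau[OF j])
    also have "pf z1 z2 * cnj (pf (\<tau> j) w2) = pf z1 z2 * (\<alpha> * cnj \<alpha>) * cnj (pf (\<tau> j) w2)"
      using alpha_cnj by simp
    also have "\<dots> - ptf z1 z2 * cnj (ptf (\<tau> j) w2) = (c * cnj (\<alpha> * pf (\<tau> j) w2)) * poly PI z1 * beta z1 z2"
      unfolding pt ptf_eq[of z1] by (simp add: algebra_simps)
    also have "\<dots> = - cnj (\<tau> j) * (z1 - \<tau> j) * (Rf j z1 z2 * cnj (Rf j (\<tau> j) w2))"
      unfolding le poly_PI[OF j] Rf_def by (simp only: mult_ac mult_minus_left mult_minus_right)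
    also have "- cnj (\<tau> j) * (z1 - \<tau> j) = 1 - z1 * cnj (\<tau> j)" using tt by (simp add: algebra_simps)
    finally show ?thesis by simp
  qed

  \<comment> \<open>After multiplication by the values of \<open>b1\<close>, both
    \<open>(1 - z1 * cnj w1)\<close> times the new squares and \<open>(1 - z2 * cnj w2)\<close>
    times the square of \<open>q\<close> become the Schur--Cohn kernel of \<open>b2\<close>,
    \<open>b1\<close> times the square of \<open>q\<close>, with opposite signs.\<close>
  have D_curve: "D z1 z2 w1 w2 = 0"
    if z: "poly b1 z1 \<noteq> 0" "beta z1 z2 = 0" and w: "poly b1 w1 \<noteq> 0" "beta w1 w2 = 0" for z1 z2 w1 w2
  proof -
    have p: "pf z1 z2 * cnj (pf w1 w2) - ptf z1 z2 * cnj (ptf w1 w2) = 0"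
      using alpha_cnj by (simp add: ptf_eq z w algebra_simps)
    have R: "(\<Sum>j\<in>{1..l}. Rf j z1 z2 * cnj (Rf j w1 w2)) = 0" by (simp add: Rf_def z)
    have "poly b1 z1 * cnj (poly b1 w1) * (\<Sum>i<N. Sf i z1 z2 * cnj (Sf i w1 w2)) =
        (\<Sum>i<N. (poly b1 z1 * Sf i z1 z2) * cnj (poly b1 w1 * Sf i w1 w2))"
      by (simp add: sum_distrib_left mult_ac)
    also have "\<dots> = (\<Sum>i<N. (poly (e i) z1 * poly q z1) * cnj (poly (e i) w1 * poly q w1))"
      using S_b z w by (intro sum.cong) auto
    also have "\<dots> = (poly q z1 * cnj (poly q w1)) * (\<Sum>i<N. poly (e i) z1 * cnj (poly (e i) w1))"
      by (simp add: sum_distrib_left mult_ac)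
    finally have S: "poly b1 z1 * cnj (poly b1 w1) * (\<Sum>i<N. Sf i z1 z2 * cnj (Sf i w1 w2)) = \<dots>" .
    have "poly b1 z1 * cnj (poly b1 w1) * D z1 z2 w1 w2 =
      - ((1 - z1 * cnj w1) * (poly b1 z1 * cnj (poly b1 w1) * (\<Sum>i<N. Sf i z1 z2 * cnj (Sf i w1 w2))))
      - (poly b1 z1 * cnj (poly b1 w1) - (z2 * poly b1 z1) * cnj (w2 * poly b1 w1)) * (poly q z1 * cnj (poly q w1))"
      unfolding D_def p R by (simp add: algebra_simps)
    also have "(1 - z1 * cnj w1) * (poly b1 z1 * cnj (poly b1 w1) * (\<Sum>i<N. Sf i z1 z2 * cnj (Sf i w1 w2))) =
      (poly q z1 * cnj (poly q w1)) * (poly b2 z1 * cnj (poly b2 w1) - poly b1 z1 * cnj (poly b1 w1))"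
      unfolding S e_b by (simp only: mult_ac)
    also have "z2 * poly b1 z1 = poly b2 z1" using z by (simp add: beta_def)
    also have "w2 * poly b1 w1 = poly b2 w1" using w by (simp add: beta_def)
    finally have "poly b1 z1 * cnj (poly b1 w1) * D z1 z2 w1 w2 = 0" by (simp add: algebra_simps)
    thus ?thesis using z w by simp
  qed

  \<comment> \<open>For fixed w, \<open>rw\<close> and \<open>sw\<close> are the two coefficients of
    \<open>D\<close> in z2, as polynomials in z1 of degree at most n; this is the form to which
    \<open>vanish\<close> applies.\<close>
  define rw where "rw w1 w2 = smult (cnj (pf w1 w2)) p1 - smult (cnj (ptf w1 w2)) pt2 - smult (cnj (poly q w1)) q
     - [:1, - cnj w1:] * ((\<Sum>j\<in>{1..l}. smult (of_real (d j) * cnj (Rf j w1 w2)) (PIo j * b2)) + (\<Sum>i<N. smult (cnj (Sf i w1 w2)) (r i)))"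
    for w1 w2
  define sw where "sw w1 w2 = smult (cnj (pf w1 w2)) p2 - smult (cnj (ptf w1 w2)) pt1 + smult (cnj w2 * cnj (poly q w1)) q
     - [:1, - cnj w1:] * ((\<Sum>i<N. smult (cnj (Sf i w1 w2)) (s i)) - (\<Sum>j\<in>{1..l}. smult (of_real (d j) * cnj (Rf j w1 w2)) (PIo j * b1)))"
    for w1 w2
  have D_poly: "D z1 z2 w1 w2 = poly (rw w1 w2) z1 + z2 * poly (sw w1 w2) z1" for z1 z2 w1 w2
  proof -
    have R: "(\<Sum>j\<in>{1..l}. Rf j z1 z2 * cnj (Rf j w1 w2)) =
       (\<Sum>j\<in>{1..l}. of_real (d j) * cnj (Rf j w1 w2) * (poly (PIo j) z1 * poly b2 z1)) -
       z2 * (\<Sum>j\<in>{1..l}. of_real (d j) * cnj (Rf j w1 w2) * (poly (PIo j) z1 * poly b1 z1))"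
      unfolding sum_distrib_left sum_subtractf[symmetric]
      by (rule sum.cong) (auto simp: Rf_def beta_def algebra_simps)
    have S: "(\<Sum>i<N. Sf i z1 z2 * cnj (Sf i w1 w2)) =
       (\<Sum>i<N. cnj (Sf i w1 w2) * poly (r i) z1) + z2 * (\<Sum>i<N. cnj (Sf i w1 w2) * poly (s i) z1)"
      unfolding sum_distrib_left sum.distrib[symmetric]
      by (rule sum.cong) (auto simp: Sf_def[of _ z1] algebra_simps)
    show ?thesis
      unfolding D_def R S rw_def sw_def pf_def[of z1] ptf_def[of z1]
      by (simp add: poly_sum algebra_simps)
  qed
  have deg_lin: "degree ([:1, - cnj w1:] * p) \<le> n" if "degree p \<le> n - 1" for w1 and p :: "complex poly"
    using degree_mult_le[of "[:1, - cnj w1:]" p] that l_le by (auto split: if_splits)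
  have deg_R: "degree (PIo j * b2) \<le> n - 1" "degree (PIo j * b1) \<le> n - 1" if "j \<in> {1..l}" for j
    using degree_mult_le[of "PIo j" b2] degree_mult_le[of "PIo j" b1] degree_PIo[OF that] deg_b l_le
    unfolding N_def by linarith+
  have deg_rw: "degree (rw w1 w2) \<le> n" for w1 w2
    unfolding rw_def using deg_p1 degree_crefl[of n p2] q(1) deg_R deg_rs
    by (intro degree_diff_le degree_add_le deg_lin degree_sum_le order.trans[OF degree_smult_le]) auto
  have deg_sw: "degree (sw w1 w2) \<le> n" for w1 w2
    unfolding sw_def using deg_p2 degree_crefl[of n p1] q(1) deg_R deg_rs
    by (intro degree_diff_le degree_add_le deg_lin degree_sum_le order.trans[OF degree_smult_le]) auto

  \<comment> \<open>At this point \<open>1 - z1 * cnj w1\<close> vanishes, and the remaining terms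
    cancel by the polarized form of \<open>defect = q * crefl n q\<close>.\<close>
  have refl0: "poly (rw w1 w2) (1 / cnj w1) = 0" "poly (sw w1 w2) (1 / cnj w1) = 0" if w1: "w1 \<noteq> 0" for w1 w2
  proof -
    define x where "x = 1 / cnj w1"
    have x0: "x \<noteq> 0" and wx: "1 / cnj x = w1" using w1 by (auto simp: x_def)
    have XW: "x ^ n * cnj w1 ^ n = 1" using w1 by (simp add: x_def power_divide)
    have px: "poly pt1 x = x ^ n * cnj (poly p1 w1)" "poly pt2 x = x ^ n * cnj (poly p2 w1)"
      "poly (crefl n q) x = x ^ n * cnj (poly q w1)"
      using poly_crefl[OF _ x0] deg_p1 deg_p2 q(1) unfolding wx by auto
    have pw: "cnj (poly pt1 w1) = cnj w1 ^ n * poly p1 x" "cnj (poly pt2 w1) = cnj w1 ^ n * poly p2 x"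
      using poly_crefl[OF _ w1] deg_p1 deg_p2 unfolding x_def by auto
    have "x ^ n * (poly p1 x * cnj (poly p1 w1) - poly p2 x * cnj (poly p2 w1)) = x ^ n * (poly q x * cnj (poly q w1))"
      using arg_cong[OF q(2), of "\<lambda>p. poly p x"] by (simp add: defect_def px algebra_simps)
    hence qq: "poly q x * cnj (poly q w1) = poly p1 x * cnj (poly p1 w1) - poly p2 x * cnj (poly p2 w1)"
      using x0 by simp
    have lin0: "poly [:1, - cnj w1:] x = 0" using w1 by (simp add: x_def)
    have ptx: "cnj (ptf w1 w2) * poly pt2 x = (poly p2 x + cnj w2 * poly p1 x) * cnj (poly p2 w1) * (x ^ n * cnj w1 ^ n)"
      "cnj (ptf w1 w2) * poly pt1 x = (poly p2 x + cnj w2 * poly p1 x) * cnj (poly p1 w1) * (x ^ n * cnj w1 ^ n)"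
      unfolding ptf_def px complex_cnj_add complex_cnj_mult pw by (simp_all add: algebra_simps)
    have "poly (rw w1 w2) x = cnj (pf w1 w2) * poly p1 x - cnj (ptf w1 w2) * poly pt2 x - poly q x * cnj (poly q w1)"
      unfolding rw_def poly_diff poly_mult[of "[:1, - cnj w1:]"] lin0 by simp
    thus "poly (rw w1 w2) (1 / cnj w1) = 0"
      unfolding ptx XW qq x_def[symmetric] pf_def by (simp add: algebra_simps)
    have "poly (sw w1 w2) x = cnj (pf w1 w2) * poly p2 x - cnj (ptf w1 w2) * poly pt1 x + cnj w2 * (poly q x * cnj (poly q w1))"
      unfolding sw_def poly_diff poly_add poly_mult[of "[:1, - cnj w1:]"] lin0 by simp
    thus "poly (sw w1 w2) (1 / cnj w1) = 0"
      unfolding ptx XW qq x_def[symmetric] pf_def by (simp add: algebra_simps)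
  qed

  \<comment> \<open>Over \<open>X\<close> the curve is a graph, and for w1 in \<open>X\<close> the
    point 1 / cnj w1 exists and lies off the circle, so it differs from every \<tau> j.\<close>
  define X where "X = ball (0::complex) 1 - insert 0 {z. poly b1 z = 0}"
  have "infinite (ball (0::complex) 1)" using uncountable_infinite uncountable_ball zero_less_one by blast
  hence X_inf: "infinite X" unfolding X_def using poly_roots_finite[OF b1_ne_0]
    by (metis Diff_infinite_finite finite_insert)
  have X: "w \<noteq> 0" "cmod w \<noteq> 1" "poly b1 w \<noteq> 0" if "w \<in> X" for w using that by (auto simp: X_def)
  have D0: "D z1 z2 w1 w2 = 0"
    if w1: "w1 \<noteq> 0" "cmod w1 \<noteq> 1" and D: "\<And>z1 z2. z1 \<in> X \<Longrightarrow> beta z1 z2 = 0 \<Longrightarrow> D z1 z2 w1 w2 = 0"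
    for z1 z2 w1 w2
  proof -
    have curve: "b1 * rw w1 w2 + b2 * sw w1 w2 = 0"
    proof (rule poly_eqI_infinite[OF X_inf])
      fix z assume z: "z \<in> X"
      have "D z (poly b2 z / poly b1 z) w1 w2 = 0" by (rule D[OF z]) (use X[OF z] in \<open>simp add: beta_def\<close>)
      thus "poly (b1 * rw w1 w2 + b2 * sw w1 w2) z = poly 0 z"
        using X(3)[OF z] by (simp add: D_poly field_simps)
    qed
    have lines: "poly (rw w1 w2) (\<tau> j) = 0" if "j \<in> {1..l}" for j
      using D_line[OF that, of w1 w2 0] D_herm[of w1 w2 "\<tau> j" 0] by (simp add: D_poly)
    have "cmod (1 / cnj w1) \<noteq> 1" using w1 by (simp add: norm_divide)
    hence "1 / cnj w1 \<notin> \<tau> ` {1..l}" using norm_tau by auto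
    thus ?thesis
      using vanish[OF deg_rw deg_sw curve lines refl0[OF w1(1)]] by (simp add: D_poly)
  qed
  \<comment> \<open>Second pass: \<open>D0\<close> with one point on the curve gives vanishing for
    every other point; by Hermitian symmetry this supplies the hypothesis of \<open>D0\<close> for
    arbitrary w2 and for w1 not 0 and off the circle.\<close>
  have D1: "D z1 z2 w1 w2 = 0" if w1: "w1 \<noteq> 0" "cmod w1 \<noteq> 1" for z1 z2 w1 w2
  proof (rule D0[OF w1])
    fix x1 x2 assume x: "x1 \<in> X" "beta x1 x2 = 0"
    have "D w1 w2 x1 x2 = 0"
      by (rule D0) (use X[OF x(1)] x(2) X(3) in \<open>auto intro!: D_curve\<close>)
    thus "D x1 x2 w1 w2 = 0" using D_herm[of x1 x2 w1 w2] by simp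
  qed
  \<comment> \<open>The excluded values of w1 are recovered because \<open>D\<close> is polynomial
    in one of its points and \<open>X\<close> is infinite.\<close>
  have D2: "D w1 w2 z1 z2 = 0" for z1 z2 w1 w2
  proof -
    have on_X: "poly (rw z1 z2) w + v * poly (sw z1 z2) w = 0" if "w \<in> X" for w v
      using D1[of w z1 z2 v] X[OF that] D_herm[of w v z1 z2] by (simp add: D_poly)
    have "rw z1 z2 = 0" by (rule poly_eqI_infinite[OF X_inf]) (use on_X[of _ 0] in auto)
    moreover from this have "sw z1 z2 = 0" by (intro poly_eqI_infinite[OF X_inf]) (use on_X[of _ 1] in auto)
    ultimately show ?thesis by (simp add: D_poly)
  qed
  show ?thesis
  proof (rule that[OF q(1) deg_rs[unfolded N_def]])
    fix z1 z2 w1 w2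
    show "pf z1 z2 * cnj (pf w1 w2) - ptf z1 z2 * cnj (ptf w1 w2) =
       (1 - z1 * cnj w1) * ((\<Sum>j\<in>{1..l}. Rf j z1 z2 * cnj (Rf j w1 w2)) +
         (\<Sum>i<n - l. (poly (r i) z1 + z2 * poly (s i) z1) * cnj (poly (r i) w1 + w2 * poly (s i) w1)))
       + (1 - z2 * cnj w2) * (poly q z1 * cnj (poly q w1))"
      using D2[of z1 z2 w1 w2] unfolding D_def Sf_def N_def by (simp add: algebra_simps)
  qed
qed

end

section \<open>Integrals over circles and tori\<close>

lemma circle_mean:
  assumes "0 < r" "continuous_on (cball 0 r) F" "F holomorphic_on ball 0 r"
  shows "((\<lambda>t. F (of_real r * cis t)) has_integral (of_real (2 * pi) * F 0)) {0..2*pi}"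
proof -
  have "((\<lambda>u. F u / (u - 0)) has_contour_integral (2 * of_real pi * \<i> * F 0)) (circlepath 0 r)"
    using Cauchy_integral_circlepath[OF assms(2,3), of 0] assms(1) by simp
  hence "((\<lambda>t. F (0 + of_real r * cis t) / (0 + of_real r * cis t - 0) * of_real r * \<i> * cis t)
      has_integral (2 * of_real pi * \<i> * F 0)) {0..2*pi}"
    unfolding circlepath_def by (subst (asm) has_contour_integral_part_circlepath_iff) auto
  moreover have "(\<lambda>t. F (0 + of_real r * cis t) / (0 + of_real r * cis t - 0) * of_real r * \<i> * cis t) =
      (\<lambda>t. \<i> * F (of_real r * cis t))"
    using assms(1) by (auto simp: fun_eq_iff)
  ultimately have "((\<lambda>t. \<i> * F (of_real r * cis t)) has_integral (2 * of_real pi * \<i> * F 0)) {0..2*pi}"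
    by simp
  from has_integral_mult_right[OF this, of "-\<i>"] show ?thesis
    by (simp add: algebra_simps)
qed

lemma finite_poly_zero_angles:
  assumes "p \<noteq> 0" shows "finite {s \<in> {0..2*pi}. poly p (cis s) = 0}"
proof (rule finite_subset)
  \<comment> \<open>The angle \<open>2*pi\<close> is listed apart because \<open>Arg2pi\<close>
    takes values strictly below it.\<close>
  show "{s \<in> {0..2*pi}. poly p (cis s) = 0} \<subseteq> insert (2*pi) (Arg2pi ` {z. poly p z = 0})"
  proof
    fix s assume s: "s \<in> {s \<in> {0..2*pi}. poly p (cis s) = 0}"
    show "s \<in> insert (2*pi) (Arg2pi ` {z. poly p z = 0})"
    proof (cases "s = 2 * pi")
      case False
      hence "Arg2pi (cis s) = s" using s by (intro Arg2pi_unique[of 1]) (auto simp: cis_conv_exp)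
      thus ?thesis using s by force
    qed simp
  qed
  show "finite (insert (2*pi) (Arg2pi ` {z. poly p z = 0}))" using poly_roots_finite[OF assms] by simp
qed

lemma continuous_on_circle_compose:
  assumes "continuous_on (ball 0 1 \<times> ball 0 1) (\<lambda>z. F (fst z) (snd z))" "0 \<le> r" "r < 1"
  shows "continuous_on S (\<lambda>(s, t). F (of_real r * cis s) (of_real r * cis t))"
proof -
  have "continuous_on S (\<lambda>x. (\<lambda>z. F (fst z) (snd z)) (of_real r * cis (fst x), of_real r * cis (snd x)))"
    by (rule continuous_on_compose2[OF assms(1)])
       (use assms(2,3) in \<open>auto intro!: continuous_intros simp: norm_mult\<close>)
  thus ?thesis by (simp add: case_prod_unfold)
qed

text \<open>Bounded convergence after integrating out the second angle: only the inner integrals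
  have to be bounded, not the integrand.\<close>
lemma torus_integral_limit:
  fixes F :: "complex \<Rightarrow> complex \<Rightarrow> 'b::euclidean_space"
  assumes cont: "\<And>r. 0 < r \<Longrightarrow> r < 1 \<Longrightarrow>
      continuous_on (cbox (0,0) (2*pi, 2*pi)) (\<lambda>(s, t). F (of_real r * cis s) (of_real r * cis t))"
    and E: "finite E"
    and cont_bd: "\<And>s. s \<in> {0..2*pi} - E \<Longrightarrow>
      continuous_on ({1/2..1} \<times> {0..2*pi}) (\<lambda>(r, t). F (of_real r * cis s) (of_real r * cis t))"
    and bound: "\<And>r s. 0 < r \<Longrightarrow> r < 1 \<Longrightarrow>
      norm (integral {0..2*pi} (\<lambda>t. F (of_real r * cis s) (of_real r * cis t))) \<le> B"
    and lim: "\<And>s. s \<in> {0..2*pi} - E \<Longrightarrow> integral {0..2*pi} (\<lambda>t. F (cis s) (cis t)) = g s"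
  shows "((\<lambda>r. integral (cbox (0,0) (2*pi, 2*pi)) (\<lambda>(s, t). F (of_real r * cis s) (of_real r * cis t)))
      \<longlongrightarrow> integral {0..2*pi} g) (at_left 1)"
proof (rule tendsto_at_left_sequentially[of "1/2"])
  fix S :: "nat \<Rightarrow> real" assume S: "\<And>n. S n < 1" "\<And>n. 1/2 < S n" "S \<longlonglongrightarrow> 1"
  have S0: "0 < S n" for n using S(2)[of n] by simp
  define G where "G r s = integral {0..2*pi} (\<lambda>t. F (of_real r * cis s) (of_real r * cis t))" for r s
  have fub: "integral (cbox (0,0) (2*pi, 2*pi)) (\<lambda>(s, t). F (of_real (S n) * cis s) (of_real (S n) * cis t)) =
      integral {0..2*pi} (G (S n))" for n
    using integral_prod_continuous[OF cont[OF S0 S(1)], of n] by (simp add: G_def[abs_def])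
  have neg: "negligible E" using E by (rule negligible_finite)
  have int_E: "integral ({0..2*pi} - E) h = integral {0..2*pi} h" for h :: "real \<Rightarrow> 'b"
    by (rule integral_subset_negligible) (auto intro: negligible_subset[OF neg])
  have "(\<lambda>n. integral ({0..2*pi} - E) (G (S n))) \<longlonglongrightarrow> integral ({0..2*pi} - E) g"
  proof (rule dominated_convergence(2)[where h = "\<lambda>_. B"])
    fix n
    have "continuous_on (cbox 0 (2*pi)) (G (S n))"
      unfolding G_def[abs_def] using integral_continuous_on_param[of "cbox 0 (2*pi)" 0 "2*pi"
        "\<lambda>s t. F (of_real (S n) * cis s) (of_real (S n) * cis t)"] cont[OF S0 S(1)]
      by (simp add: cbox_Pair_eq)
    hence "G (S n) integrable_on {0..2*pi}" using integrable_continuous by (metis box_real(2))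
    thus "G (S n) integrable_on ({0..2*pi} - E)"
      by (rule integrable_spike_set) (auto intro: negligible_subset[OF neg])
  next
    have "(\<lambda>_::real. B) integrable_on {0..2*pi}" by (simp add: integrable_const_ivl)
    thus "(\<lambda>_::real. B) integrable_on ({0..2*pi} - E)"
      by (rule integrable_spike_set) (auto intro: negligible_subset[OF neg])
  next
    fix n s show "norm (G (S n) s) \<le> B" unfolding G_def by (rule bound[OF S0 S(1)])
  next
    fix s assume s: "s \<in> {0..2*pi} - E"
    have "continuous_on {1/2..1} (\<lambda>r. G r s)"
      unfolding G_def using integral_continuous_on_param[of "{1/2..1}" 0 "2*pi"
        "\<lambda>r t. F (of_real r * cis s) (of_real r * cis t)"] cont_bd[OF s] by simp
    hence "(\<lambda>n. G (S n) s) \<longlonglongrightarrow> G 1 s"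
      by (rule continuous_on_tendsto_compose[OF _ S(3)]) (use S in \<open>auto intro!: eventuallyI less_imp_le\<close>)
    thus "(\<lambda>n. G (S n) s) \<longlonglongrightarrow> g s" using lim[OF s] by (simp add: G_def)
  qed
  thus "(\<lambda>n. integral (cbox (0,0) (2*pi, 2*pi)) (\<lambda>(s, t). F (of_real (S n) * cis s) (of_real (S n) * cis t)))
      \<longlonglongrightarrow> integral {0..2*pi} g"
    unfolding fub int_E .
qed auto

section \<open>The model space functions\<close>

text \<open>Applied both to \<open>z - \<tau> j\<close> and to \<open>phi - \<alpha>\<close>: it
  trades a squared distance for the real part of a holomorphic function, which can be averaged, and
  a defect from modulus 1.\<close>

lemma norm_minus_circle_sq:
  assumes "cmod t = 1"
  shows "(cmod (z - t))\<^sup>2 = 2 * Re (1 - cnj t * z) - (1 - (cmod z)\<^sup>2)"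
proof -
  have "(Re t)\<^sup>2 + (Im t)\<^sup>2 = 1" using assms by (simp flip: cmod_power2)
  thus ?thesis unfolding cmod_power2 by (simp add: power2_eq_square algebra_simps)
qed

lemma cnj_minus_circle:
  assumes "cmod z = 1" "cmod t = 1"
  shows "cnj (z - t) = - (cnj z * cnj t * (z - t))"
proof -
  have "cnj z * cnj t * (z - t) = (z * cnj z) * cnj t - (t * cnj t) * cnj z"
    by (simp add: algebra_simps)
  thus ?thesis using cnj_mult_circle[OF assms(1)] cnj_mult_circle[OF assms(2)] by simp
qed

section \<open>Pointwise estimates on the bidisc and uniform square means over circles in z2\<close>

context normalized
begin

definition f :: "nat \<Rightarrow> complex \<Rightarrow> complex \<Rightarrow> complex" where "f j z w = Rf j z w / pf z w"
definition phi :: "complex \<Rightarrow> complex \<Rightarrow> complex" where "phi z w = ptf z w / pf z w"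

lemma pf_nz: "cmod z < 1 \<Longrightarrow> cmod w < 1 \<Longrightarrow> pf z w \<noteq> 0"
  unfolding pf_def by (rule nozero)

lemma pf_nz_circle:
  assumes "cmod z = 1" "poly defect z \<noteq> 0" "cmod w \<le> 1" shows "pf z w \<noteq> 0"
proof
  assume "pf z w = 0"
  hence "cmod (poly p1 z) = cmod (w * poly p2 z)"
    unfolding pf_def by (metis add_eq_0_iff2 norm_minus_cancel)
  also have "\<dots> \<le> 1 * cmod (poly p2 z)" unfolding norm_mult by (rule mult_right_mono) (use assms in auto)
  finally have "cmod (poly p1 z) = cmod (poly p2 z)" using p2_le[of z] assms by simp
  thus False using assms(2) defect_circle[OF assms(1)] by simp
qed

lemma phi_0: "phi z 0 = psi z"
  by (simp add: phi_def psi_def pf_def ptf_def)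

lemma regular_ne_tau: "poly defect z \<noteq> 0 \<Longrightarrow> j \<in> {1..l} \<Longrightarrow> z \<noteq> \<tau> j"
  using defect_tau by auto

text \<open>The identity on the diagonal z = w; \<open>X\<close> collects the squares beyond the
  first \<open>l\<close>, and \<open>Y\<close> is the squared modulus of \<open>Q\<close>.\<close>

lemma diag_sos:
  obtains X Y where "X \<ge> 0" "Y \<ge> 0"
    "(cmod (pf z w))\<^sup>2 - (cmod (ptf z w))\<^sup>2 =
      (1 - (cmod z)\<^sup>2) * ((\<Sum>j\<in>{1..l}. (cmod (Rf j z w))\<^sup>2) + X) + (1 - (cmod w)\<^sup>2) * Y"
proof (rule sums_of_squares)
  fix q r s
  assume sos: "\<And>z1 z2 w1 w2. pf z1 z2 * cnj (pf w1 w2) - ptf z1 z2 * cnj (ptf w1 w2) =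
       (1 - z1 * cnj w1) * ((\<Sum>j\<in>{1..l}. Rf j z1 z2 * cnj (Rf j w1 w2)) +
         (\<Sum>i<n - l. (poly (r i) z1 + z2 * poly (s i) z1) * cnj (poly (r i) w1 + w2 * poly (s i) w1)))
       + (1 - z2 * cnj w2) * (poly q z1 * cnj (poly q w1))"
  define X where "X = (\<Sum>i<n - l. (cmod (poly (r i) z + w * poly (s i) z))\<^sup>2)"
  have "complex_of_real ((cmod (pf z w))\<^sup>2 - (cmod (ptf z w))\<^sup>2) = of_real (
      (1 - (cmod z)\<^sup>2) * ((\<Sum>j\<in>{1..l}. (cmod (Rf j z w))\<^sup>2) + X) + (1 - (cmod w)\<^sup>2) * (cmod (poly q z))\<^sup>2)"
    unfolding X_def of_real_diff of_real_add of_real_mult of_real_sum of_real_1 complex_norm_square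
    by (rule sos)
  hence "(cmod (pf z w))\<^sup>2 - (cmod (ptf z w))\<^sup>2 =
      (1 - (cmod z)\<^sup>2) * ((\<Sum>j\<in>{1..l}. (cmod (Rf j z w))\<^sup>2) + X) + (1 - (cmod w)\<^sup>2) * (cmod (poly q z))\<^sup>2"
    by (simp only: of_real_eq_iff)
  thus ?thesis by (rule that[rotated 2]) (simp_all add: X_def sum_nonneg)
qed

lemma norm_ptf_le:
  assumes "j \<in> {1..l}" "cmod z \<le> 1" "cmod w \<le> 1"
  shows "(cmod (ptf z w))\<^sup>2 + (1 - (cmod z)\<^sup>2) * (cmod (Rf j z w))\<^sup>2 \<le> (cmod (pf z w))\<^sup>2"
proof -
  obtain X Y where XY: "X \<ge> 0" "Y \<ge> 0"
    "(cmod (pf z w))\<^sup>2 - (cmod (ptf z w))\<^sup>2 =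
      (1 - (cmod z)\<^sup>2) * ((\<Sum>j\<in>{1..l}. (cmod (Rf j z w))\<^sup>2) + X) + (1 - (cmod w)\<^sup>2) * Y"
    using diag_sos by blast
  have "(cmod (Rf j z w))\<^sup>2 \<le> (\<Sum>j\<in>{1..l}. (cmod (Rf j z w))\<^sup>2)"
    using assms(1) by (intro member_le_sum) auto
  moreover have z: "0 \<le> 1 - (cmod z)\<^sup>2" "0 \<le> 1 - (cmod w)\<^sup>2" using assms by (auto simp: power_le_one)
  ultimately have "(1 - (cmod z)\<^sup>2) * (cmod (Rf j z w))\<^sup>2 \<le>
      (1 - (cmod z)\<^sup>2) * ((\<Sum>j\<in>{1..l}. (cmod (Rf j z w))\<^sup>2) + X)"
    using XY(1) by (intro mult_left_mono) auto
  moreover have "0 \<le> (1 - (cmod w)\<^sup>2) * Y" using z XY(2) by simp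
  ultimately show ?thesis using XY(3) by linarith
qed

lemma norm_ptf_circle:
  assumes "cmod z = 1" "cmod w = 1" shows "cmod (ptf z w) = cmod (pf z w)"
proof (rule diag_sos)
  fix X Y
  assume "(cmod (pf z w))\<^sup>2 - (cmod (ptf z w))\<^sup>2 =
      (1 - (cmod z)\<^sup>2) * ((\<Sum>j\<in>{1..l}. (cmod (Rf j z w))\<^sup>2) + X) + (1 - (cmod w)\<^sup>2) * Y"
  hence "(cmod (ptf z w))\<^sup>2 = (cmod (pf z w))\<^sup>2" using assms by simp
  thus ?thesis by (rule power2_eq_imp_eq) auto
qed

lemma norm_phi_circle:
  "cmod z = 1 \<Longrightarrow> cmod w = 1 \<Longrightarrow> pf z w \<noteq> 0 \<Longrightarrow> cmod (phi z w) = 1"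
  by (simp add: phi_def norm_divide norm_ptf_circle)

lemma norm_phi_f_le:
  assumes "j \<in> {1..l}" "cmod z < 1" "cmod w < 1"
  shows "(cmod (phi z w))\<^sup>2 + (1 - (cmod z)\<^sup>2) * (cmod (f j z w))\<^sup>2 \<le> 1"
proof -
  have "(cmod (pf z w))\<^sup>2 > 0" using pf_nz[OF assms(2,3)] by simp
  thus ?thesis using norm_ptf_le[OF assms(1), of z w] assms(2,3)
    by (simp add: phi_def f_def norm_divide power_divide field_simps)
qed

lemma norm_phi_le: "cmod z < 1 \<Longrightarrow> cmod w < 1 \<Longrightarrow> cmod (phi z w) \<le> 1"
proof -
  assume zw: "cmod z < 1" "cmod w < 1"
  have "1 \<in> {1..l}" using l_le by simp
  from norm_phi_f_le[OF this zw] have "(cmod (phi z w))\<^sup>2 + (1 - (cmod z)\<^sup>2) * (cmod (f 1 z w))\<^sup>2 \<le> 1" .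
  moreover have "0 \<le> (1 - (cmod z)\<^sup>2) * (cmod (f 1 z w))\<^sup>2" using zw by (auto simp: power_le_one)
  ultimately have "(cmod (phi z w))\<^sup>2 \<le> 1" by linarith
  thus ?thesis by (simp add: power_le_one_iff abs_square_le_1)
qed

lemma f_times:
  assumes "j \<in> {1..l}" "pf z w \<noteq> 0"
  shows "f j z w * (z - \<tau> j) = of_real (d j) / c * (\<alpha> - phi z w)"
proof -
  have "\<alpha> - phi z w = c * poly PI z * beta z w / pf z w"
    using assms(2) by (simp add: phi_def ptf_eq field_simps)
  thus ?thesis using c_nz by (simp add: f_def Rf_def poly_PI[OF assms(1)])
qed

lemma f_eq:
  assumes "j \<in> {1..l}" "pf z w \<noteq> 0" "z \<noteq> \<tau> j"
  shows "f j z w = of_real (d j) / c * (\<alpha> - phi z w) / (z - \<tau> j)"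
  unfolding f_times[OF assms(1,2), symmetric] using assms(3) by simp

text \<open>Dividing out \<open>z - \<tau> j\<close> in the numerator of
  \<open>h1 j z - h1 j (\<tau> j)\<close> gives an exact second-order remainder with denominator
  \<open>p1\<close>, hence bounded on the closed disc. The linear term is written with
  \<open>1 - cnj (\<tau> j) * z\<close> so that \<open>norm_minus_circle_sq\<close> applies to its
  real part.\<close>

lemma psi_expansion:
  assumes j: "j \<in> {1..l}"
  obtains k where "\<And>z. cmod z \<le> 1 \<Longrightarrow>
    1 - cnj \<alpha> * psi z = ang j * (1 - cnj (\<tau> j) * z) + (z - \<tau> j)\<^sup>2 * (poly k z / poly p1 z)"
proof -
  define g where "g = smult (cnj \<alpha> * c) (b2 * PIo j) - smult (h1 j (\<tau> j)) p1"
  have "poly g (\<tau> j) = 0" using p1_nz[of "\<tau> j"] norm_tau[OF j] by (simp add: g_def h1_def)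
  then obtain k where k: "g = [:- \<tau> j, 1:] * k" by (auto simp: poly_eq_0_iff_dvd elim: dvdE)
  show ?thesis
  proof (rule that)
    fix z assume z: "cmod z \<le> 1"
    have "h1 j z * poly p1 z = cnj \<alpha> * c * poly b2 z * poly (PIo j) z"
      using p1_nz[OF z] by (simp add: h1_def)
    moreover have "poly g z = (z - \<tau> j) * poly k z" unfolding k by (simp add: left_diff_distrib)
    ultimately have "h1 j z * poly p1 z = h1 j (\<tau> j) * poly p1 z + (z - \<tau> j) * poly k z"
      by (simp add: g_def algebra_simps)
    hence heq: "h1 j z = h1 j (\<tau> j) + (z - \<tau> j) * (poly k z / poly p1 z)"
      using p1_nz[OF z] by (simp add: field_simps)
    have "1 - cnj \<alpha> * psi z = h1 j (\<tau> j) * (z - \<tau> j) + (z - \<tau> j)\<^sup>2 * (poly k z / poly p1 z)"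
      unfolding one_minus_psi[OF j z] heq by (simp only: power2_eq_square distrib_right distrib_left mult_ac)
    also have "h1 j (\<tau> j) * (z - \<tau> j) = ang j * (1 - cnj (\<tau> j) * z)"
    proof -
      have "ang j * (1 - cnj (\<tau> j) * z) = h1 j (\<tau> j) * ((\<tau> j * cnj (\<tau> j)) * z - \<tau> j)"
        unfolding ang_def by (simp add: algebra_simps)
      thus ?thesis using cnj_mult_circle[OF norm_tau[OF j]] by simp
    qed
    finally show "1 - cnj \<alpha> * psi z = ang j * (1 - cnj (\<tau> j) * z) + (z - \<tau> j)\<^sup>2 * (poly k z / poly p1 z)" .
  qed
qed

lemma rational_bounded:
  obtains M where "M \<ge> 0" "\<And>z. cmod z \<le> 1 \<Longrightarrow> cmod (poly k z / poly p1 z) \<le> M"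
proof -
  have "continuous_on (cball 0 1) (\<lambda>z. poly k z / poly p1 z)"
    using p1_nz by (auto intro!: continuous_intros)
  hence "bounded ((\<lambda>z. poly k z / poly p1 z) ` cball 0 1)"
    by (intro compact_imp_bounded compact_continuous_image) auto
  then obtain M where M: "\<forall>x\<in>(\<lambda>z. poly k z / poly p1 z) ` cball 0 1. norm x \<le> M"
    unfolding bounded_iff by blast
  show ?thesis
  proof (rule that[of "max M 0"])
    fix z :: complex assume "cmod z \<le> 1"
    hence "cmod (poly k z / poly p1 z) \<le> M" using M by simp
    thus "cmod (poly k z / poly p1 z) \<le> max M 0" by linarith
  qed simp
qed

lemma f_cont: "continuous_on (ball 0 1 \<times> ball 0 1) (\<lambda>z. f j (fst z) (snd z))"
  unfolding f_def Rf_def beta_def pf_def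
  using nozero by (intro continuous_intros) auto

lemma phi_cont: "continuous_on (ball 0 1 \<times> ball 0 1) (\<lambda>z. phi (fst z) (snd z))"
  unfolding phi_def ptf_def pf_def
  using nozero by (intro continuous_intros) auto

lemma phi_holo: "cmod z < 1 \<Longrightarrow> phi z holomorphic_on ball 0 1"
  unfolding phi_def ptf_def pf_def
  using nozero by (intro holomorphic_intros) auto

lemma f_holo1: "cmod w < 1 \<Longrightarrow> (\<lambda>z. f j z w) holomorphic_on ball 0 1"
  unfolding f_def Rf_def beta_def pf_def
  using nozero by (intro holomorphic_intros) auto

lemma f_holo2: "cmod z < 1 \<Longrightarrow> (\<lambda>w. f j z w) holomorphic_on ball 0 1"
  unfolding f_def Rf_def beta_def pf_def
  using nozero by (intro holomorphic_intros) auto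

text \<open>Over a z1-angle where the defect is nonzero, \<open>p\<close> has no zeros up to and
  including radius 1, so \<open>f j\<close> and \<open>phi\<close> extend continuously to the torus
  there.\<close>

lemma pf_nz_radial:
  assumes "poly defect (cis s) \<noteq> 0" "1/2 \<le> r" "r \<le> 1"
  shows "pf (of_real r * cis s) (of_real r * cis t) \<noteq> 0"
  using assms pf_nz[of "of_real r * cis s" "of_real r * cis t"] pf_nz_circle[of "cis s" "cis t"]
  by (cases "r = 1") (auto simp: norm_mult)

lemma f_cont_radial:
  assumes "poly defect (cis s) \<noteq> 0"
  shows "continuous_on ({1/2..1} \<times> {0..2*pi}) (\<lambda>x. f j (of_real (fst x) * cis s) (of_real (fst x) * cis (snd x)))"
  unfolding f_def Rf_def beta_def
  using pf_nz_radial[OF assms] unfolding pf_def by (intro continuous_intros) auto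

lemma phi_cont_radial:
  assumes "poly defect (cis s) \<noteq> 0"
  shows "continuous_on ({1/2..1} \<times> {0..2*pi}) (\<lambda>x. phi (of_real (fst x) * cis s) (of_real (fst x) * cis (snd x)))"
  unfolding phi_def ptf_def
  using pf_nz_radial[OF assms] unfolding pf_def by (intro continuous_intros) auto

text \<open>With A = Re (ang j), the normalization gives A |f|^2 |z - \<tau> j|^2 = |\<alpha> -
  phi|^2, while |f|^2 (1 - |z|^2) \<le> 1 - |phi|^2. Added up, |f|^2 K is at most
  \<open>2 * Re (1 - cnj \<alpha> * phi z w)\<close> with K = A |z - \<tau> j|^2 + 1 - |z|^2. The
  right side is harmonic in \<open>w\<close>, so its mean only sees \<open>psi z\<close>, and
  \<open>psi_expansion\<close> bounds that mean by a multiple of the same K. Thus K cancels, however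
  close z is to \<tau> j.\<close>

lemma f_integral_bound:
  assumes j: "j \<in> {1..l}"
  obtains C where "C \<ge> 0" "\<And>r s. 0 < r \<Longrightarrow> r < 1 \<Longrightarrow>
    integral {0..2*pi} (\<lambda>t. (cmod (f j (of_real r * cis s) (of_real r * cis t)))\<^sup>2) \<le> C"
proof -
  define A where "A = Re (ang j)"
  have A: "A > 0" "ang j = of_real A" using ang_pos[OF j] by (auto simp: A_def)
  have dA: "(d j)\<^sup>2 * A = (cmod c)\<^sup>2" using d_norm[OF j] by (simp add: A_def)
  have tau: "cmod (\<tau> j) = 1" by (rule norm_tau[OF j])
  obtain k where k: "\<And>z. cmod z \<le> 1 \<Longrightarrow>
    1 - cnj \<alpha> * psi z = ang j * (1 - cnj (\<tau> j) * z) + (z - \<tau> j)\<^sup>2 * (poly k z / poly p1 z)"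
    using psi_expansion[OF j] by blast
  obtain M where M: "M \<ge> 0" "\<And>z. cmod z \<le> 1 \<Longrightarrow> cmod (poly k z / poly p1 z) \<le> M"
    using rational_bounded by blast
  \<comment> \<open>Chosen so that C A \<ge> A + 2 M and C \<ge> A, which compares the coefficients
    of |z - \<tau> j|^2 and of 1 - |z|^2 separately.\<close>
  define C where "C = (A + 2 * M) / A + A"
  have C0: "C \<ge> 0" using A M by (simp add: C_def)
  have numer: "2 * Re (1 - cnj \<alpha> * psi z) \<le> C * (A * (cmod (z - \<tau> j))\<^sup>2 + (1 - (cmod z)\<^sup>2))"
    if z: "cmod z < 1" for z
  proof -
    have "2 * Re (ang j * (1 - cnj (\<tau> j) * z)) = A * (2 * Re (1 - cnj (\<tau> j) * z))"
      unfolding A(2) by simp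
    also have "\<dots> = A * ((cmod (z - \<tau> j))\<^sup>2 + (1 - (cmod z)\<^sup>2))"
      using norm_minus_circle_sq[OF tau, of z] by simp
    finally have 1: "2 * Re (ang j * (1 - cnj (\<tau> j) * z)) = \<dots>" .
    have "Re ((z - \<tau> j)\<^sup>2 * (poly k z / poly p1 z)) \<le> cmod ((z - \<tau> j)\<^sup>2 * (poly k z / poly p1 z))"
      by (rule complex_Re_le_cmod)
    also have "\<dots> \<le> (cmod (z - \<tau> j))\<^sup>2 * M"
      unfolding norm_mult norm_power by (intro mult_left_mono M(2)) (use z in auto)
    finally have "2 * Re (1 - cnj \<alpha> * psi z) \<le>
        A * ((cmod (z - \<tau> j))\<^sup>2 + (1 - (cmod z)\<^sup>2)) + 2 * ((cmod (z - \<tau> j))\<^sup>2 * M)"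
      using 1 k[of z] z by simp
    also have "\<dots> = (A + 2 * M) * (cmod (z - \<tau> j))\<^sup>2 + A * (1 - (cmod z)\<^sup>2)"
      by (simp add: algebra_simps)
    also have "\<dots> \<le> (C * A) * (cmod (z - \<tau> j))\<^sup>2 + C * (1 - (cmod z)\<^sup>2)"
    proof (rule add_mono; rule mult_right_mono)
      show "A + 2 * M \<le> C * A" using A by (simp add: C_def field_simps)
      show "A \<le> C" using A M by (simp add: C_def)
      show "0 \<le> 1 - (cmod z)\<^sup>2" using z by (simp add: power_le_one)
    qed auto
    finally show ?thesis by (simp add: algebra_simps)
  qed
  have pointwise: "(cmod (f j z w))\<^sup>2 * (A * (cmod (z - \<tau> j))\<^sup>2 + (1 - (cmod z)\<^sup>2)) \<le> 2 * Re (1 - cnj \<alpha> * phi z w)"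
    if zw: "cmod z < 1" "cmod w < 1" for z w
  proof -
    have "cmod (f j z w) * cmod (z - \<tau> j) = d j / cmod c * cmod (\<alpha> - phi z w)"
      using arg_cong[OF f_times[OF j pf_nz[OF zw]], of cmod] d_pos[OF j] by (simp add: norm_mult norm_divide)
    hence "(cmod (f j z w) * cmod (z - \<tau> j))\<^sup>2 = (d j)\<^sup>2 / (cmod c)\<^sup>2 * (cmod (\<alpha> - phi z w))\<^sup>2"
      by (simp add: power_mult_distrib power_divide)
    hence "A * (cmod (f j z w) * cmod (z - \<tau> j))\<^sup>2 = ((d j)\<^sup>2 * A) / (cmod c)\<^sup>2 * (cmod (\<alpha> - phi z w))\<^sup>2"
      by simp
    also have "((d j)\<^sup>2 * A) / (cmod c)\<^sup>2 = 1" unfolding dA using c_nz by simp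
    also have "cmod (\<alpha> - phi z w) = cmod (phi z w - \<alpha>)" by (rule norm_minus_commute)
    finally have "A * (cmod (f j z w) * cmod (z - \<tau> j))\<^sup>2 = 2 * Re (1 - cnj \<alpha> * phi z w) - (1 - (cmod (phi z w))\<^sup>2)"
      using norm_minus_circle_sq[OF norm_alpha, of "phi z w"] by simp
    thus ?thesis using norm_phi_f_le[OF j zw] by (simp add: power_mult_distrib algebra_simps)
  qed
  show ?thesis
  proof (rule that[of "2 * pi * C"])
    show "2 * pi * C \<ge> 0" using C0 by simp
    fix r s :: real assume r: "0 < r" "r < 1"
    define z where "z = of_real r * cis s"
    have z: "cmod z < 1" using r by (simp add: z_def norm_mult)
    define K where "K = A * (cmod (z - \<tau> j))\<^sup>2 + (1 - (cmod z)\<^sup>2)"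
    have "(cmod z)\<^sup>2 < 1" using z by (simp add: abs_square_less_1)
    hence K: "K > 0" unfolding K_def using A by (intro add_nonneg_pos) auto
    have w: "cmod (of_real r * cis t) < 1" for t using r by (simp add: norm_mult)
    have sub: "cball 0 r \<subseteq> ball (0::complex) 1" "ball 0 r \<subseteq> ball (0::complex) 1" using r by auto
    have "((\<lambda>t. 2 * (1 - cnj \<alpha> * phi z (of_real r * cis t))) has_integral
        (of_real (2 * pi) * (2 * (1 - cnj \<alpha> * phi z 0)))) {0..2*pi}"
      by (rule circle_mean[OF r(1)])
         (use sub phi_holo[OF z] in \<open>auto intro!: continuous_intros holomorphic_intros
            intro: holomorphic_on_subset continuous_on_subset holomorphic_on_imp_continuous_on\<close>)
    from has_integral_linear[OF this bounded_linear_Re]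
    have int: "((\<lambda>t. 2 * Re (1 - cnj \<alpha> * phi z (of_real r * cis t))) has_integral
        (2 * pi * (2 * Re (1 - cnj \<alpha> * psi z)))) {0..2*pi}"
      by (simp add: o_def phi_0)
    have "continuous_on {0..2*pi} (\<lambda>t. (cmod (f j z (of_real r * cis t)))\<^sup>2)"
    proof (intro continuous_intros)
      show "continuous_on {0..2*pi} (\<lambda>t. f j z (of_real r * cis t))"
        by (rule continuous_on_compose2[OF holomorphic_on_imp_continuous_on[OF f_holo2[OF z]]])
           (use w in \<open>auto intro!: continuous_intros\<close>)
    qed
    hence fi: "(\<lambda>t. (cmod (f j z (of_real r * cis t)))\<^sup>2) integrable_on {0..2*pi}"
      by (rule integrable_continuous_interval)
    have "integral {0..2*pi} (\<lambda>t. (cmod (f j z (of_real r * cis t)))\<^sup>2) * K =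
        integral {0..2*pi} (\<lambda>t. (cmod (f j z (of_real r * cis t)))\<^sup>2 * K)" by simp
    also have "\<dots> \<le> integral {0..2*pi} (\<lambda>t. 2 * Re (1 - cnj \<alpha> * phi z (of_real r * cis t)))"
    proof (rule integral_le)
      show "(\<lambda>t. (cmod (f j z (of_real r * cis t)))\<^sup>2 * K) integrable_on {0..2*pi}"
        using fi by (rule integrable_on_mult_left)
      show "(\<lambda>t. 2 * Re (1 - cnj \<alpha> * phi z (of_real r * cis t))) integrable_on {0..2*pi}"
        using int by blast
      show "(cmod (f j z (of_real r * cis t)))\<^sup>2 * K \<le> 2 * Re (1 - cnj \<alpha> * phi z (of_real r * cis t))" for t
        unfolding K_def by (rule pointwise[OF z w])
    qed
    also have "\<dots> = 2 * pi * (2 * Re (1 - cnj \<alpha> * psi z))" by (rule integral_unique[OF int])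
    also have "\<dots> \<le> 2 * pi * (C * K)" unfolding K_def by (rule mult_left_mono[OF numer[OF z]]) simp
    finally have "integral {0..2*pi} (\<lambda>t. (cmod (f j z (of_real r * cis t)))\<^sup>2) * K \<le> (2 * pi * C) * K"
      by (simp add: mult_ac)
    thus "integral {0..2*pi} (\<lambda>t. (cmod (f j (of_real r * cis s) (of_real r * cis t)))\<^sup>2) \<le> 2 * pi * C"
      using K by (simp add: z_def)
  qed
qed

end

section \<open>Membership in H2 and inner products from boundary values\<close>

context normalized
begin

lemma finite_singular_angles: "finite {s \<in> {0..2*pi}. poly defect (cis s) = 0}"
  by (rule finite_poly_zero_angles[OF defect_ne_0])

lemma f_circ_cont:
  assumes "0 < r" "r < 1"
  shows "continuous_on S (\<lambda>x. f j (of_real r * cis (fst x)) (of_real r * cis (snd x)))"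
  using continuous_on_circle_compose[OF f_cont, of r S j] assms by (simp add: case_prod_unfold)

lemma phi_circ_cont:
  assumes "0 < r" "r < 1"
  shows "continuous_on S (\<lambda>x. phi (of_real r * cis (fst x)) (of_real r * cis (snd x)))"
  using continuous_on_circle_compose[OF phi_cont, of r S] assms by (simp add: case_prod_unfold)

lemma continuous_on_slice:
  assumes "continuous_on UNIV (\<lambda>x::real \<times> real. G (fst x) (snd x))"
  shows "continuous_on T (G s)"
proof -
  have "continuous_on T (\<lambda>t. (\<lambda>x. G (fst x) (snd x)) (s, t))"
    by (rule continuous_on_compose2[OF assms]) (auto intro!: continuous_intros)
  thus ?thesis by simp
qed

lemma f_sq_integrable:
  assumes "0 < r" "r < 1"
  shows "(\<lambda>t. (cmod (f j (of_real r * cis s) (of_real r * cis t)))\<^sup>2) integrable_on {0..2*pi}"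
proof (rule integrable_continuous_interval)
  show "continuous_on {0..2*pi} (\<lambda>t. (cmod (f j (of_real r * cis s) (of_real r * cis t)))\<^sup>2)"
    by (rule continuous_on_slice[of "\<lambda>s t. (cmod (f j (of_real r * cis s) (of_real r * cis t)))\<^sup>2"])
       (intro continuous_intros f_circ_cont assms)
qed

lemma f_in_H2:
  assumes j: "j \<in> {1..l}" shows "in_H2 (f j)"
  unfolding in_H2_def
proof
  show "holo_bidisc (f j)"
    unfolding holo_bidisc_def using f_cont f_holo1 f_holo2 by simp
  obtain C where C: "C \<ge> 0" "\<And>r s. 0 < r \<Longrightarrow> r < 1 \<Longrightarrow>
    integral {0..2*pi} (\<lambda>t. (cmod (f j (of_real r * cis s) (of_real r * cis t)))\<^sup>2) \<le> C"
    using f_integral_bound[OF j] by blast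
  show "bdd_above (torus_sqmean (f j) ` {0<..<1})"
  proof (rule bdd_aboveI2)
    fix r :: real assume "r \<in> {0<..<1}"
    hence r: "0 < r" "r < 1" by auto
    define G where "G = (\<lambda>s t. (cmod (f j (of_real r * cis s) (of_real r * cis t)))\<^sup>2)"
    have cont: "continuous_on S (\<lambda>x. G (fst x) (snd x))" for S
      unfolding G_def by (intro continuous_intros f_circ_cont r)
    hence cont2: "continuous_on S (\<lambda>(s, t). G s t)" for S by (simp add: case_prod_unfold)
    have "integral (cbox (0,0) (2*pi, 2*pi)) (\<lambda>(s, t). G s t) =
        integral {0..2*pi} (\<lambda>s. integral {0..2*pi} (G s))"
      using integral_prod_continuous[OF cont2, of 0 0 "2*pi" "2*pi"] by simp
    also have "\<dots> \<le> integral {0..2*pi} (\<lambda>s. C)"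
    proof (rule integral_le)
      have "continuous_on (cbox 0 (2*pi)) (\<lambda>s. integral (cbox 0 (2*pi)) (G s))"
        by (rule integral_continuous_on_param[OF cont2])
      thus "(\<lambda>s. integral {0..2*pi} (G s)) integrable_on {0..2*pi}"
        using integrable_continuous_interval by (metis box_real(2))
      show "integral {0..2*pi} (G s) \<le> C" for s using C(2)[OF r] by (simp add: G_def)
    qed (simp add: integrable_const_ivl)
    also have "\<dots> = 2 * pi * C" by simp
    finally show "torus_sqmean (f j) r \<le> 2 * pi * C / (4 * pi\<^sup>2)"
      unfolding torus_sqmean_def G_def by (intro divide_right_mono) auto
  qed
qed

text \<open>The boundary values of \<open>f j * cnj (f k)\<close>, after averaging in the second variable.\<close>
lemma boundary_density:
  assumes j: "j \<in> {1..l}" and k: "k \<in> {1..l}"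
  obtains p where "\<And>z. cmod z = 1 \<Longrightarrow> poly defect z \<noteq> 0 \<Longrightarrow>
    (2 - cnj \<alpha> * psi z - cnj (cnj \<alpha> * psi z)) / ((z - \<tau> j) * cnj (z - \<tau> k)) =
    (if j = k then ang j else 0) - \<tau> k * (z * (poly p z / poly p1 z)) - cnj (\<tau> j * (z * (poly p z / poly p1 z)))"
proof -
  \<comment> \<open>One shape serves both cases: for j = k it is the second-order expansion; for
    distinct indices both linear factors divide \<open>1 - cnj \<alpha> * psi z\<close> outright and
    no linear term is left.\<close>
  have "\<exists>p. \<forall>z. cmod z = 1 \<longrightarrow> 1 - cnj \<alpha> * psi z =
      (if j = k then ang j * (1 - cnj (\<tau> j) * z) else 0) + (z - \<tau> j) * (z - \<tau> k) * (poly p z / poly p1 z)"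
  proof (cases "j = k")
    case True
    show ?thesis
      by (rule psi_expansion[OF j]) (use True in \<open>auto simp: power2_eq_square intro!: exI\<close>)
  next
    case False
    define p where "p = smult (cnj \<alpha> * c) (b2 * (\<Prod>i\<in>{1..l} - {j} - {k}. [:- \<tau> i, 1:]))"
    have "1 - cnj \<alpha> * psi z = (z - \<tau> j) * (z - \<tau> k) * (poly p z / poly p1 z)" if "cmod z = 1" for z
    proof -
      have "poly (PIo j) z = (z - \<tau> k) * poly (\<Prod>i\<in>{1..l} - {j} - {k}. [:- \<tau> i, 1:]) z"
        unfolding PIo_split[OF j k False] by (simp add: left_diff_distrib)
      thus ?thesis using one_minus_psi[OF j, of z] that by (simp add: h1_def p_def)
    qed
    thus ?thesis using False by auto
  qed
  then obtain p where p: "\<And>z. cmod z = 1 \<Longrightarrow> 1 - cnj \<alpha> * psi z =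
      (if j = k then ang j * (1 - cnj (\<tau> j) * z) else 0) + (z - \<tau> j) * (z - \<tau> k) * (poly p z / poly p1 z)"
    by blast
  show ?thesis
  proof (rule that)
    fix z assume z: "cmod z = 1" "poly defect z \<noteq> 0"
    define H where "H = poly p z / poly p1 z"
    define U where "U = (z - \<tau> j) * cnj (z - \<tau> k)"
    have nz: "z - \<tau> j \<noteq> 0" "z - \<tau> k \<noteq> 0" using regular_ne_tau[OF z(2)] j k by auto
    hence U0: "U \<noteq> 0" by (simp add: U_def)
    have zz: "z * cnj z = 1" and tj: "\<tau> j * cnj (\<tau> j) = 1" and tk: "\<tau> k * cnj (\<tau> k) = 1"
      using cnj_mult_circle z(1) norm_tau j k by auto
    have ck: "cnj (z - \<tau> k) = - (cnj z * cnj (\<tau> k) * (z - \<tau> k))"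
      by (rule cnj_minus_circle[OF z(1) norm_tau[OF k]])
    have cj: "cnj (z - \<tau> j) = - (cnj z * cnj (\<tau> j) * (z - \<tau> j))"
      by (rule cnj_minus_circle[OF z(1) norm_tau[OF j]])
    \<comment> \<open>On the circle \<open>cnj (z - \<tau> k)\<close> is a multiple of
      \<open>z - \<tau> k\<close>, so the remainder is divisible by \<open>U\<close>. The factor
      \<open>z\<close> that appears makes the quotient vanish at 0, hence have mean zero over the
      circle.\<close>
    have 1: "(z - \<tau> j) * (z - \<tau> k) * H = - (\<tau> k * (z * H)) * U"
    proof -
      have "- (\<tau> k * (z * H)) * U = (z * cnj z) * (\<tau> k * cnj (\<tau> k)) * ((z - \<tau> j) * (z - \<tau> k) * H)"
        unfolding U_def ck by (simp only: mult_ac mult_minus_left mult_minus_right minus_minus)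
      thus ?thesis unfolding zz tk by simp
    qed
    have 2: "cnj ((z - \<tau> j) * (z - \<tau> k) * H) = - cnj (\<tau> j * (z * H)) * U"
      unfolding U_def complex_cnj_mult cj by (simp only: mult_ac mult_minus_left mult_minus_right)
    \<comment> \<open>On the circle |z - \<tau> j|^2 is twice the real part of
      \<open>1 - cnj (\<tau> j) * z\<close>, and \<open>ang j\<close> is real: the linear term
      leaves exactly the constant \<open>ang j\<close>.\<close>
    have 3: "(if j = k then ang j * (1 - cnj (\<tau> j) * z) else 0) +
        cnj (if j = k then ang j * (1 - cnj (\<tau> j) * z) else 0) = (if j = k then ang j else 0) * U"
    proof (cases "j = k")
      case True
      have "U = z * cnj z - z * cnj (\<tau> j) - \<tau> j * cnj z + \<tau> j * cnj (\<tau> j)"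
        using True by (simp add: U_def algebra_simps)
      hence U: "(1 - cnj (\<tau> j) * z) + cnj (1 - cnj (\<tau> j) * z) = U"
        unfolding zz tj by (simp add: algebra_simps)
      have "cnj (ang j) = ang j" using ang_pos(1)[OF j] by (metis complex_cnj_complex_of_real)
      hence "ang j * (1 - cnj (\<tau> j) * z) + cnj (ang j * (1 - cnj (\<tau> j) * z)) =
          ang j * ((1 - cnj (\<tau> j) * z) + cnj (1 - cnj (\<tau> j) * z))"
        by (simp only: complex_cnj_mult distrib_left)
      also note U
      finally show ?thesis unfolding if_P[OF True] .
    qed simp
    have "2 - cnj \<alpha> * psi z - cnj (cnj \<alpha> * psi z) = (1 - cnj \<alpha> * psi z) + cnj (1 - cnj \<alpha> * psi z)"
      by simp
    also have "\<dots> = ((if j = k then ang j * (1 - cnj (\<tau> j) * z) else 0) +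
        cnj (if j = k then ang j * (1 - cnj (\<tau> j) * z) else 0)) + (z - \<tau> j) * (z - \<tau> k) * H + cnj ((z - \<tau> j) * (z - \<tau> k) * H)"
      unfolding p[OF z(1)] H_def[symmetric] complex_cnj_add by (simp only: add_ac)
    also have "\<dots> = ((if j = k then ang j else 0) - \<tau> k * (z * H) - cnj (\<tau> j * (z * H))) * U"
      unfolding 2 unfolding 1 3 by (simp only: distrib_right mult_minus_left diff_conv_add_uminus)
    finally show "(2 - cnj \<alpha> * psi z - cnj (cnj \<alpha> * psi z)) / ((z - \<tau> j) * cnj (z - \<tau> k)) =
      (if j = k then ang j else 0) - \<tau> k * (z * (poly p z / poly p1 z)) - cnj (\<tau> j * (z * (poly p z / poly p1 z)))"
      using U0 unfolding U_def[symmetric] H_def[symmetric] by simp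
  qed
qed

text \<open>At regular boundary points phi is unimodular, so the product of
  \<open>\<alpha> - phi\<close> with its conjugate is affine in phi and its conjugate. Averaging
  over z2 therefore replaces phi by \<open>psi\<close>.\<close>

lemma boundary_inner:
  assumes j: "j \<in> {1..l}" and k: "k \<in> {1..l}" and z: "cmod z = 1" "poly defect z \<noteq> 0"
  shows "integral {0..2*pi} (\<lambda>t. f j z (cis t) * cnj (f k z (cis t))) =
     of_real (2 * pi * d j * d k / (cmod c)\<^sup>2) *
     ((2 - cnj \<alpha> * psi z - cnj (cnj \<alpha> * psi z)) / ((z - \<tau> j) * cnj (z - \<tau> k)))"
proof -
  define K where "K = of_real (d j * d k / (cmod c)\<^sup>2) / ((z - \<tau> j) * cnj (z - \<tau> k))"
  have p0: "pf z w \<noteq> 0" if "cmod w \<le> 1" for w by (rule pf_nz_circle[OF z that])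
  have nz: "z \<noteq> \<tau> j" "z \<noteq> \<tau> k" using regular_ne_tau[OF z(2)] j k by auto
  have eq: "f j z (cis t) * cnj (f k z (cis t)) =
      K * (2 - cnj \<alpha> * phi z (cis t) - cnj (cnj \<alpha> * phi z (cis t)))" for t
  proof -
    define v where "v = phi z (cis t)"
    have vv: "v * cnj v = 1" using norm_phi_circle[OF z(1) _ p0] cnj_mult_circle by (simp add: v_def)
    have "(\<alpha> - v) * cnj (\<alpha> - v) = \<alpha> * cnj \<alpha> + v * cnj v - cnj \<alpha> * v - cnj (cnj \<alpha> * v)"
      by (simp add: algebra_simps)
    hence *: "(\<alpha> - v) * cnj (\<alpha> - v) = 2 - cnj \<alpha> * v - cnj (cnj \<alpha> * v)"
      unfolding vv using alpha_cnj by simp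
    have "f j z (cis t) * cnj (f k z (cis t)) = of_real (d j) * of_real (d k) / (c * cnj c) *
        ((\<alpha> - v) * cnj (\<alpha> - v)) / ((z - \<tau> j) * cnj (z - \<tau> k))"
      using f_eq[OF j p0 nz(1)] f_eq[OF k p0 nz(2)] by (simp add: v_def mult_ac)
    thus ?thesis unfolding * K_def v_def[symmetric] by (simp add: complex_norm_square[symmetric])
  qed
  have "((\<lambda>t. phi z (of_real 1 * cis t)) has_integral (of_real (2 * pi) * phi z 0)) {0..2*pi}"
  proof (rule circle_mean)
    show "continuous_on (cball 0 1) (phi z)"
      unfolding phi_def ptf_def using p0 unfolding pf_def by (intro continuous_intros) auto
    show "phi z holomorphic_on ball 0 1"
      unfolding phi_def ptf_def using p0 unfolding pf_def by (intro holomorphic_intros) auto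
  qed simp
  hence i1: "((\<lambda>t. cnj \<alpha> * phi z (cis t)) has_integral (cnj \<alpha> * (of_real (2 * pi) * psi z))) {0..2*pi}"
    unfolding phi_0 by (intro has_integral_mult_right) simp
  have i2: "((\<lambda>t. cnj (cnj \<alpha> * phi z (cis t))) has_integral cnj (cnj \<alpha> * (of_real (2 * pi) * psi z))) {0..2*pi}"
    using has_integral_linear[OF i1 bounded_linear_cnj] by (simp add: o_def)
  have i0: "((\<lambda>t::real. 2::complex) has_integral (2 * of_real (2 * pi))) {0..2*pi}"
    using has_integral_const_real[of "2::complex" 0 "2*pi"] by (simp add: scaleR_conv_of_real mult_ac)
  have "((\<lambda>t. K * (2 - cnj \<alpha> * phi z (cis t) - cnj (cnj \<alpha> * phi z (cis t)))) has_integral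
     K * (2 * of_real (2 * pi) - cnj \<alpha> * (of_real (2 * pi) * psi z) - cnj (cnj \<alpha> * (of_real (2 * pi) * psi z)))) {0..2*pi}"
    by (intro has_integral_mult_right has_integral_diff i0 i1 i2)
  from integral_unique[OF this] show ?thesis
    unfolding eq by (simp add: K_def algebra_simps diff_divide_distrib)
qed

text \<open>Averaged over z1, the two terms of the boundary density that contain \<open>z\<close>
  times a holomorphic function drop out. The constant \<open>ang j\<close> remains on the diagonal,
  and \<open>d_norm\<close> turns its contribution into 4 pi^2, the normalization of the torus
  mean.\<close>

lemma inner_limit:
  assumes j: "j \<in> {1..l}" and k: "k \<in> {1..l}"
  shows "(torus_mean (f j) (f k) \<longlongrightarrow> (if j = k then 1 else 0)) (at_left 1)"
proof -
  obtain p where p: "\<And>z. cmod z = 1 \<Longrightarrow> poly defect z \<noteq> 0 \<Longrightarrow>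
    (2 - cnj \<alpha> * psi z - cnj (cnj \<alpha> * psi z)) / ((z - \<tau> j) * cnj (z - \<tau> k)) =
    (if j = k then ang j else 0) - \<tau> k * (z * (poly p z / poly p1 z)) - cnj (\<tau> j * (z * (poly p z / poly p1 z)))"
    using boundary_density[OF j k] by blast
  obtain Cj where Cj: "Cj \<ge> 0" "\<And>r s. 0 < r \<Longrightarrow> r < 1 \<Longrightarrow>
    integral {0..2*pi} (\<lambda>t. (cmod (f j (of_real r * cis s) (of_real r * cis t)))\<^sup>2) \<le> Cj"
    using f_integral_bound[OF j] by blast
  obtain Ck where Ck: "Ck \<ge> 0" "\<And>r s. 0 < r \<Longrightarrow> r < 1 \<Longrightarrow>
    integral {0..2*pi} (\<lambda>t. (cmod (f k (of_real r * cis s) (of_real r * cis t)))\<^sup>2) \<le> Ck"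
    using f_integral_bound[OF k] by blast
  define E where "E = {s \<in> {0..2*pi}. poly defect (cis s) = 0}"
  define H where "H z = z * (poly p z / poly p1 z)" for z
  define g where "g s = of_real (2 * pi * d j * d k / (cmod c)\<^sup>2) *
     ((if j = k then ang j else 0) - \<tau> k * H (cis s) - cnj (\<tau> j * H (cis s)))" for s
  have lim: "((\<lambda>r. integral (cbox (0,0) (2*pi, 2*pi))
      (\<lambda>(s, t). f j (of_real r * cis s) (of_real r * cis t) * cnj (f k (of_real r * cis s) (of_real r * cis t))))
      \<longlongrightarrow> integral {0..2*pi} g) (at_left 1)"
  proof (rule torus_integral_limit[where F = "\<lambda>z w. f j z w * cnj (f k z w)" and B = "Cj + Ck"])
    show "continuous_on (cbox (0, 0) (2 * pi, 2 * pi))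
        (\<lambda>(s, t). f j (of_real r * cis s) (of_real r * cis t) * cnj (f k (of_real r * cis s) (of_real r * cis t)))"
      if "0 < r" "r < 1" for r
      unfolding case_prod_unfold by (intro continuous_intros f_circ_cont that)
    show "finite E" unfolding E_def by (rule finite_singular_angles)
    show "continuous_on ({1/2..1} \<times> {0..2 * pi})
        (\<lambda>(r, t). f j (of_real r * cis s) (of_real r * cis t) * cnj (f k (of_real r * cis s) (of_real r * cis t)))"
      if "s \<in> {0..2*pi} - E" for s
      unfolding case_prod_unfold using that
      by (intro continuous_intros f_cont_radial) (auto simp: E_def)
    show "integral {0..2*pi} (\<lambda>t. f j (cis s) (cis t) * cnj (f k (cis s) (cis t))) = g s"
      if s: "s \<in> {0..2*pi} - E" for s
    proof -
      have reg: "cmod (cis s) = 1" "poly defect (cis s) \<noteq> 0" using s by (auto simp: E_def)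
      show ?thesis unfolding boundary_inner[OF j k reg] p[OF reg] g_def H_def ..
    qed
    fix r s :: real assume r: "0 < r" "r < 1"
    define z where "z = of_real r * cis s"
    have "norm (integral {0..2*pi} (\<lambda>t. f j z (of_real r * cis t) * cnj (f k z (of_real r * cis t)))) \<le>
      integral {0..2*pi} (\<lambda>t. (cmod (f j z (of_real r * cis t)))\<^sup>2 + (cmod (f k z (of_real r * cis t)))\<^sup>2)"
    proof (rule integral_norm_bound_integral)
      show "(\<lambda>t. f j z (of_real r * cis t) * cnj (f k z (of_real r * cis t))) integrable_on {0..2*pi}"
        unfolding z_def
        by (intro integrable_continuous_interval continuous_on_slice[of
            "\<lambda>s t. f j (of_real r * cis s) (of_real r * cis t) * cnj (f k (of_real r * cis s) (of_real r * cis t))"]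
            continuous_intros f_circ_cont r)
      show "(\<lambda>t. (cmod (f j z (of_real r * cis t)))\<^sup>2 + (cmod (f k z (of_real r * cis t)))\<^sup>2) integrable_on {0..2*pi}"
        unfolding z_def by (intro integrable_add f_sq_integrable r)
      fix t
      have "x * y \<le> x\<^sup>2 + y\<^sup>2" if "0 \<le> x" "0 \<le> y" for x y :: real
        using sum_squares_bound[of x y] mult_nonneg_nonneg[OF that] by linarith
      thus "norm (f j z (of_real r * cis t) * cnj (f k z (of_real r * cis t))) \<le>
          (cmod (f j z (of_real r * cis t)))\<^sup>2 + (cmod (f k z (of_real r * cis t)))\<^sup>2"
        by (simp add: norm_mult)
    qed
    also have "\<dots> = integral {0..2*pi} (\<lambda>t. (cmod (f j z (of_real r * cis t)))\<^sup>2) +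
        integral {0..2*pi} (\<lambda>t. (cmod (f k z (of_real r * cis t)))\<^sup>2)"
      unfolding z_def by (intro integral_add f_sq_integrable r)
    also have "\<dots> \<le> Cj + Ck" unfolding z_def by (intro add_mono Cj(2) Ck(2) r)
    finally show "norm (integral {0..2*pi} (\<lambda>t. f j (of_real r * cis s) (of_real r * cis t) *
        cnj (f k (of_real r * cis s) (of_real r * cis t)))) \<le> Cj + Ck"
      unfolding z_def .
  qed
  have "((\<lambda>t. H (of_real 1 * cis t)) has_integral (of_real (2 * pi) * H 0)) {0..2*pi}"
  proof (rule circle_mean)
    show "continuous_on (cball 0 1) H" unfolding H_def using p1_nz by (intro continuous_intros) auto
    show "H holomorphic_on ball 0 1" unfolding H_def using p1_nz by (intro holomorphic_intros) auto
  qed simp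
  hence i0: "((\<lambda>t. H (cis t)) has_integral 0) {0..2*pi}" by (simp add: H_def)
  have i1: "((\<lambda>t. \<tau> i * H (cis t)) has_integral 0) {0..2*pi}" for i
    using has_integral_mult_right[OF i0, of "\<tau> i"] by simp
  have i2: "((\<lambda>t. cnj (\<tau> j * H (cis t))) has_integral 0) {0..2*pi}"
    using has_integral_linear[OF i1[of j] bounded_linear_cnj] by (simp add: o_def)
  have i3: "((\<lambda>t::real. e) has_integral (of_real (2 * pi) * e)) {0..2*pi}" for e :: complex
    using has_integral_const_real[of e 0 "2*pi"] by (simp add: scaleR_conv_of_real)
  have "(g has_integral (of_real (2 * pi * d j * d k / (cmod c)\<^sup>2) *
      (of_real (2 * pi) * (if j = k then ang j else 0) - 0 - 0))) {0..2*pi}"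
    unfolding g_def by (intro has_integral_mult_right has_integral_diff i1 i2 i3)
  hence "integral {0..2*pi} g = of_real (2 * pi * d j * d k / (cmod c)\<^sup>2) *
      (of_real (2 * pi) * (if j = k then ang j else 0))"
    by (simp add: integral_unique)
  also have "\<dots> = (if j = k then of_real (4 * pi\<^sup>2) else 0)"
  proof (cases "j = k")
    case True
    have "of_real (2 * pi * d j * d j / (cmod c)\<^sup>2) * (of_real (2 * pi) * ang j) =
        complex_of_real (2 * pi * d j * d j / (cmod c)\<^sup>2 * (2 * pi * Re (ang j)))"
      using ang_pos(1)[OF j] by (metis of_real_mult)
    also have "2 * pi * d j * d j / (cmod c)\<^sup>2 * (2 * pi * Re (ang j)) = 4 * pi\<^sup>2 * ((d j)\<^sup>2 * Re (ang j)) / (cmod c)\<^sup>2"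
      by (simp add: power2_eq_square)
    also have "\<dots> = 4 * pi\<^sup>2" unfolding d_norm[OF j] using c_nz by simp
    finally show ?thesis using True by simp
  qed simp
  finally have "((\<lambda>r. torus_mean (f j) (f k) r) \<longlongrightarrow> (if j = k then of_real (4 * pi\<^sup>2) else 0) / of_real (4 * pi\<^sup>2)) (at_left 1)"
    using tendsto_divide[OF lim tendsto_const[of "of_real (4 * pi\<^sup>2)"]] unfolding torus_mean_def by simp
  thus ?thesis by (cases "j = k") simp_all
qed

end

section \<open>Orthogonality to the multiples of phi\<close>

context normalized
begin

text \<open>On the torus \<open>f j * cnj phi\<close> is a unimodular multiple of \<open>cnj (z * f j)\<close>, and
  \<open>z * f j * g\<close> has mean zero; the error made on smaller tori tends to zero in square mean.\<close>
lemma orthogonal_limit: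
  assumes j: "j \<in> {1..l}" and g: "in_H2 g"
  shows "(torus_mean (f j) (\<lambda>z w. phi z w * g z w) \<longlongrightarrow> 0) (at_left 1)"
proof -
  define a where "a = of_real (d j) / c"
  have a0: "a \<noteq> 0" using d_pos[OF j] c_nz by (simp add: a_def)
  \<comment> \<open>This constant makes \<Delta> vanish at regular points of the torus:
    \<open>a / cnj a\<close> exchanges the scalar of \<open>f j\<close> with its conjugate, \<alpha>
    comes from \<open>(\<alpha> - v) * cnj v = - \<alpha> * (cnj \<alpha> - cnj v)\<close> for
    unimodular \<open>v\<close>, and \<open>cnj (\<tau> j)\<close> from conjugating
    \<open>z - \<tau> j\<close>.\<close>
  define \<kappa> where "\<kappa> = a * \<alpha> / cnj a * cnj (\<tau> j)"
  have norm_\<kappa>: "cmod \<kappa> = 1" using a0 norm_alpha norm_tau[OF j] by (simp add: \<kappa>_def norm_mult norm_divide)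
  define \<Delta> where "\<Delta> z w = f j z w * cnj (phi z w) - \<kappa> * cnj z * cnj (f j z w)" for z w
  define T where "T = cbox (0::real, 0::real) (2*pi, 2*pi)"
  have g_cont: "continuous_on S (\<lambda>x. g (of_real r * cis (fst x)) (of_real r * cis (snd x)))"
    if "0 < r" "r < 1" for r S
    using continuous_on_circle_compose[of g r S] g that
    by (simp add: in_H2_def holo_bidisc_def case_prod_unfold)
  have \<Delta>_cont: "continuous_on S (\<lambda>x. \<Delta> (of_real r * cis (fst x)) (of_real r * cis (snd x)))"
    if "0 < r" "r < 1" for r S
    unfolding \<Delta>_def by (intro continuous_intros f_circ_cont phi_circ_cont that)

  obtain C where C: "C \<ge> 0" "\<And>r s. 0 < r \<Longrightarrow> r < 1 \<Longrightarrow>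
    integral {0..2*pi} (\<lambda>t. (cmod (f j (of_real r * cis s) (of_real r * cis t)))\<^sup>2) \<le> C"
    using f_integral_bound[OF j] by blast
  have \<Delta>_le: "(cmod (\<Delta> z w))\<^sup>2 \<le> 4 * (cmod (f j z w))\<^sup>2" if zw: "cmod z < 1" "cmod w < 1" for z w
  proof -
    have "cmod (\<Delta> z w) \<le> cmod (f j z w * cnj (phi z w)) + cmod (\<kappa> * cnj z * cnj (f j z w))"
      unfolding \<Delta>_def by (rule norm_triangle_ineq4)
    also have "\<dots> \<le> cmod (f j z w) * 1 + 1 * cmod (f j z w)"
      unfolding norm_mult norm_\<kappa> complex_mod_cnj
      using norm_phi_le[OF zw] zw by (intro add_mono mult_left_mono mult_right_mono) auto
    finally have "cmod (\<Delta> z w) \<le> 2 * cmod (f j z w)" by simp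
    hence "(cmod (\<Delta> z w))\<^sup>2 \<le> (2 * cmod (f j z w))\<^sup>2" by (rule power_mono) simp
    thus ?thesis by (simp add: power_mult_distrib)
  qed
  have \<Delta>_circle: "\<Delta> z w = 0" if z: "cmod z = 1" "poly defect z \<noteq> 0" and w: "cmod w = 1" for z w
  proof -
    have p0: "pf z w \<noteq> 0" by (rule pf_nz_circle[OF z]) (simp add: w)
    have nz: "z - \<tau> j \<noteq> 0" using regular_ne_tau[OF z(2) j] by simp
    define v where "v = phi z w"
    have vv: "v * cnj v = 1" using norm_phi_circle[OF z(1) w p0] cnj_mult_circle by (simp add: v_def)
    have fe: "f j z w = a * (\<alpha> - v) / (z - \<tau> j)"
      using f_eq[OF j p0] nz by (simp add: a_def v_def)
    have "cnj z * cnj (\<tau> j) \<noteq> 0" using z(1) norm_tau[OF j] by auto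
    hence "cnj (f j z w) = - (cnj a * (cnj \<alpha> - cnj v) / (cnj z * cnj (\<tau> j) * (z - \<tau> j)))"
      unfolding fe complex_cnj_divide complex_cnj_mult cnj_minus_circle[OF z(1) norm_tau[OF j]]
      by (simp add: divide_simps)
    hence "\<kappa> * cnj z * cnj (f j z w) = - (a * (\<alpha> * (cnj \<alpha> - cnj v)) / (z - \<tau> j))"
      using a0 z(1) norm_tau[OF j] nz by (auto simp: \<kappa>_def)
    also have "\<dots> = a * ((\<alpha> - v) * cnj v) / (z - \<tau> j)"
      using vv alpha_cnj by (simp add: algebra_simps diff_divide_distrib)
    also have "\<dots> = f j z w * cnj (phi z w)" unfolding fe v_def by simp
    finally show ?thesis by (simp add: \<Delta>_def)
  qed

  define E where "E = {s \<in> {0..2*pi}. poly defect (cis s) = 0}"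
  define I where "I r = integral T (\<lambda>(s, t). (cmod (\<Delta> (of_real r * cis s) (of_real r * cis t)))\<^sup>2)" for r
  have "(I \<longlongrightarrow> integral {0..2*pi} (\<lambda>s. 0)) (at_left 1)"
    unfolding I_def T_def
  proof (rule torus_integral_limit[where F = "\<lambda>z w. (cmod (\<Delta> z w))\<^sup>2" and B = "4 * C"])
    show "continuous_on (cbox (0, 0) (2 * pi, 2 * pi))
        (\<lambda>(s, t). (cmod (\<Delta> (of_real r * cis s) (of_real r * cis t)))\<^sup>2)" if "0 < r" "r < 1" for r
      unfolding case_prod_unfold by (intro continuous_intros \<Delta>_cont that)
    show "finite E" unfolding E_def by (rule finite_singular_angles)
    show "continuous_on ({1/2..1} \<times> {0..2 * pi})
        (\<lambda>(r, t). (cmod (\<Delta> (of_real r * cis s) (of_real r * cis t)))\<^sup>2)"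
      if "s \<in> {0..2*pi} - E" for s
      unfolding case_prod_unfold \<Delta>_def using that
      by (intro continuous_intros f_cont_radial phi_cont_radial) (auto simp: E_def)
    show "integral {0..2*pi} (\<lambda>t. (cmod (\<Delta> (cis s) (cis t)))\<^sup>2) = 0"
      if "s \<in> {0..2*pi} - E" for s
      using that by (simp add: \<Delta>_circle E_def)
    fix r s :: real assume r: "0 < r" "r < 1"
    have n: "cmod (of_real r * cis s) < 1" for s using r by (simp add: norm_mult)
    have i\<Delta>: "(\<lambda>t. (cmod (\<Delta> (of_real r * cis s) (of_real r * cis t)))\<^sup>2) integrable_on {0..2*pi}"
      by (intro integrable_continuous_interval continuous_on_slice[of
            "\<lambda>s t. (cmod (\<Delta> (of_real r * cis s) (of_real r * cis t)))\<^sup>2"] continuous_intros \<Delta>_cont r)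
    have "integral {0..2*pi} (\<lambda>t. (cmod (\<Delta> (of_real r * cis s) (of_real r * cis t)))\<^sup>2) \<le>
        integral {0..2*pi} (\<lambda>t. 4 * (cmod (f j (of_real r * cis s) (of_real r * cis t)))\<^sup>2)"
      using i\<Delta> f_sq_integrable[OF r] \<Delta>_le[OF n n] by (intro integral_le) auto
    also have "\<dots> \<le> 4 * C" using C(2)[OF r] by simp
    finally show "norm (integral {0..2*pi} (\<lambda>t. (cmod (\<Delta> (of_real r * cis s) (of_real r * cis t)))\<^sup>2)) \<le> 4 * C"
      using integral_nonneg[OF i\<Delta>] by simp
  qed
  hence I_lim: "(I \<longlongrightarrow> 0) (at_left 1)" by simp

  \<comment> \<open>For fixed z2 the explicit factor z1 gives mean zero over every circle in z1, so
    the integral is taken over z1 before z2.\<close>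
  have zero: "integral T (\<lambda>(s, t). cnj (of_real r * cis s * f j (of_real r * cis s) (of_real r * cis t) *
      g (of_real r * cis s) (of_real r * cis t))) = 0" (is "integral T (\<lambda>(s, t). cnj (?h s t)) = 0")
    if r: "0 < r" "r < 1" for r
  proof -
    have cont: "continuous_on S (\<lambda>(s, t). cnj (?h s t))" for S
      unfolding case_prod_unfold by (intro continuous_intros f_circ_cont g_cont r)
    have sub: "cball 0 r \<subseteq> ball (0::complex) 1" "ball 0 r \<subseteq> ball (0::complex) 1" using r by auto
    have inner: "integral {0..2*pi} (\<lambda>s. cnj (?h s t)) = 0" for t
    proof -
      define w where "w = of_real r * cis t"
      have w: "cmod w < 1" using r by (simp add: w_def norm_mult)
      have hol: "(\<lambda>z. z * f j z w * g z w) holomorphic_on ball 0 1"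
        using g w f_holo1[OF w] by (intro holomorphic_intros) (auto simp: in_H2_def holo_bidisc_def)
      have "((\<lambda>s. of_real r * cis s * f j (of_real r * cis s) w * g (of_real r * cis s) w) has_integral
          (of_real (2 * pi) * (0 * f j 0 w * g 0 w))) {0..2*pi}"
        by (rule circle_mean[OF r(1)])
           (use hol sub in \<open>blast intro: holomorphic_on_subset continuous_on_subset holomorphic_on_imp_continuous_on\<close>)+
      from has_integral_linear[OF this bounded_linear_cnj] show ?thesis
        unfolding w_def by (auto simp: o_def dest: integral_unique)
    qed
    have "integral T (\<lambda>(s, t). cnj (?h s t)) = integral {0..2*pi} (\<lambda>s. integral {0..2*pi} (\<lambda>t. cnj (?h s t)))"
      unfolding T_def using integral_prod_continuous[OF cont, of 0 0 "2*pi" "2*pi"] by simp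
    also have "\<dots> = integral {0..2*pi} (\<lambda>t. integral {0..2*pi} (\<lambda>s. cnj (?h s t)))"
      using integral_swap_continuous[OF cont, of 0 "2*pi" 0 "2*pi"] by simp
    also have "\<dots> = 0" unfolding inner by simp
    finally show ?thesis .
  qed

  obtain M where M: "\<And>r. 0 < r \<Longrightarrow> r < 1 \<Longrightarrow> torus_sqmean g r \<le> M"
    using g unfolding in_H2_def bdd_above_def by (meson greaterThanLessThan_iff imageI)
  have M': "integral T (\<lambda>(s, t). (cmod (g (of_real r * cis s) (of_real r * cis t)))\<^sup>2) \<le> 4 * pi\<^sup>2 * M"
    if "0 < r" "r < 1" for r
    using M[OF that] by (simp add: torus_sqmean_def T_def divide_le_eq mult.commute)
  \<comment> \<open>In place of Cauchy--Schwarz, u v \<le> u^2 / \<epsilon> + \<epsilon> v^2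
    separates the error, small in square mean, from \<open>g\<close>, bounded in square
    mean.\<close>
  have bound: "4 * pi\<^sup>2 * cmod (torus_mean (f j) (\<lambda>z w. phi z w * g z w) r) \<le> I r / \<epsilon> + \<epsilon> * (4 * pi\<^sup>2 * M)"
    if r: "0 < r" "r < 1" and \<epsilon>: "\<epsilon> > 0" for r \<epsilon>
  proof -
    let ?x = "\<lambda>s. of_real r * cis s"
    have iT: "h integrable_on T" if "continuous_on T h" for h :: "real \<times> real \<Rightarrow> 'z::euclidean_space"
      using that unfolding T_def by (rule integrable_continuous)
    have split: "f j z w * cnj (phi z w * g z w) = \<Delta> z w * cnj (g z w) + \<kappa> * cnj (z * f j z w * g z w)" for z w
      by (simp add: \<Delta>_def algebra_simps)
    have c1: "continuous_on T (\<lambda>x. \<Delta> (?x (fst x)) (?x (snd x)) * cnj (g (?x (fst x)) (?x (snd x))))"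
      by (intro continuous_intros \<Delta>_cont g_cont r)
    have c2: "continuous_on T (\<lambda>x. \<kappa> * cnj (?x (fst x) * f j (?x (fst x)) (?x (snd x)) * g (?x (fst x)) (?x (snd x))))"
      by (intro continuous_intros f_circ_cont g_cont r)
    have c3: "continuous_on T (\<lambda>x. (cmod (\<Delta> (?x (fst x)) (?x (snd x))))\<^sup>2 / \<epsilon>)"
      using \<epsilon> by (intro continuous_intros \<Delta>_cont r) auto
    have c4: "continuous_on T (\<lambda>x. \<epsilon> * (cmod (g (?x (fst x)) (?x (snd x))))\<^sup>2)"
      by (intro continuous_intros g_cont r)
    have "integral T (\<lambda>x. f j (?x (fst x)) (?x (snd x)) * cnj (phi (?x (fst x)) (?x (snd x)) * g (?x (fst x)) (?x (snd x)))) =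
        integral T (\<lambda>x. \<Delta> (?x (fst x)) (?x (snd x)) * cnj (g (?x (fst x)) (?x (snd x)))) +
        integral T (\<lambda>x. \<kappa> * cnj (?x (fst x) * f j (?x (fst x)) (?x (snd x)) * g (?x (fst x)) (?x (snd x))))"
      unfolding split by (rule integral_add[OF iT[OF c1] iT[OF c2]])
    also have "integral T (\<lambda>x. \<kappa> * cnj (?x (fst x) * f j (?x (fst x)) (?x (snd x)) * g (?x (fst x)) (?x (snd x)))) = 0"
      using zero[OF r] by (simp add: case_prod_unfold)
    finally have "torus_mean (f j) (\<lambda>z w. phi z w * g z w) r = 
        integral T (\<lambda>x. \<Delta> (?x (fst x)) (?x (snd x)) * cnj (g (?x (fst x)) (?x (snd x)))) / of_real (4 * pi\<^sup>2)"
      by (simp add: torus_mean_def T_def case_prod_unfold)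
    hence "4 * pi\<^sup>2 * cmod (torus_mean (f j) (\<lambda>z w. phi z w * g z w) r) =
        cmod (integral T (\<lambda>x. \<Delta> (?x (fst x)) (?x (snd x)) * cnj (g (?x (fst x)) (?x (snd x)))))"
      by (simp add: norm_divide norm_mult norm_power)
    also have "\<dots> \<le> integral T (\<lambda>x. (cmod (\<Delta> (?x (fst x)) (?x (snd x))))\<^sup>2 / \<epsilon> + \<epsilon> * (cmod (g (?x (fst x)) (?x (snd x))))\<^sup>2)"
    proof (rule integral_norm_bound_integral[OF iT[OF c1] integrable_add[OF iT[OF c3] iT[OF c4]]])
      fix x :: "real \<times> real"
      define u v where "u = cmod (\<Delta> (?x (fst x)) (?x (snd x)))" and "v = cmod (g (?x (fst x)) (?x (snd x)))"
      have uv: "0 \<le> u * v" by (simp add: u_def v_def)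
      have "0 \<le> (u - \<epsilon> * v)\<^sup>2" by simp
      hence "2 * (u * v) * \<epsilon> \<le> u\<^sup>2 + \<epsilon> * v\<^sup>2 * \<epsilon>" by (simp add: power2_eq_square algebra_simps)
      moreover have "u * v * \<epsilon> \<le> 2 * (u * v) * \<epsilon>" using uv \<epsilon> by (intro mult_right_mono) auto
      ultimately have "u * v * \<epsilon> \<le> u\<^sup>2 + \<epsilon> * v\<^sup>2 * \<epsilon>" by (rule order.trans[rotated])
      also have "\<dots> = (u\<^sup>2 / \<epsilon> + \<epsilon> * v\<^sup>2) * \<epsilon>" using \<epsilon> by (simp add: distrib_right)
      finally have "u * v * \<epsilon> \<le> (u\<^sup>2 / \<epsilon> + \<epsilon> * v\<^sup>2) * \<epsilon>" .
      hence "u * v \<le> u\<^sup>2 / \<epsilon> + \<epsilon> * v\<^sup>2" using \<epsilon> by simp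
      thus "norm (\<Delta> (?x (fst x)) (?x (snd x)) * cnj (g (?x (fst x)) (?x (snd x)))) \<le>
          (cmod (\<Delta> (?x (fst x)) (?x (snd x))))\<^sup>2 / \<epsilon> + \<epsilon> * (cmod (g (?x (fst x)) (?x (snd x))))\<^sup>2"
        by (simp add: norm_mult u_def v_def)
    qed
    also have "\<dots> = I r / \<epsilon> + \<epsilon> * integral T (\<lambda>(s, t). (cmod (g (?x s) (?x t)))\<^sup>2)"
      unfolding integral_add[OF iT[OF c3] iT[OF c4]] by (simp add: I_def case_prod_unfold)
    also have "\<dots> \<le> I r / \<epsilon> + \<epsilon> * (4 * pi\<^sup>2 * M)"
      using M'[OF r] \<epsilon> by (intro add_left_mono mult_left_mono) auto
    finally show ?thesis .
  qed
  show ?thesis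
  proof (rule tendstoI)
    fix e :: real assume e: "e > 0"
    \<comment> \<open>The absolute value and the summand 1 make \<open>K\<close> positive whatever
      the sign of \<open>M\<close>; the choice of \<epsilon> below gives
      \<open>\<epsilon> * K\<close> half of the permitted error.\<close>
    define K where "K = 4 * pi\<^sup>2 * \<bar>M\<bar> + 1"
    have K: "K > 0" "4 * pi\<^sup>2 * M \<le> K"
      unfolding K_def by (auto intro!: add_nonneg_pos mult_nonneg_nonneg add_increasing2 mult_left_mono)
    define \<epsilon> where "\<epsilon> = 4 * pi\<^sup>2 * e / (2 * K)"
    have \<epsilon>: "\<epsilon> > 0" using e K by (simp add: \<epsilon>_def)
    have "\<epsilon> * (4 * pi\<^sup>2 * e / 2) > 0" using \<epsilon> e by simp
    hence "eventually (\<lambda>r. I r < \<epsilon> * (4 * pi\<^sup>2 * e / 2)) (at_left 1)"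
      by (rule order_tendstoD(2)[OF I_lim])
    moreover have "eventually (\<lambda>r::real. r \<in> {0<..<1}) (at_left 1)"
      by (rule eventually_at_left_real) simp
    ultimately show "eventually (\<lambda>r. dist (torus_mean (f j) (\<lambda>z w. phi z w * g z w) r) 0 < e) (at_left 1)"
    proof eventually_elim
      case (elim r)
      have "4 * pi\<^sup>2 * cmod (torus_mean (f j) (\<lambda>z w. phi z w * g z w) r) \<le> I r / \<epsilon> + \<epsilon> * (4 * pi\<^sup>2 * M)"
        using elim by (intro bound \<epsilon>) auto
      also have "\<dots> \<le> I r / \<epsilon> + \<epsilon> * K" using K(2) \<epsilon> by (intro add_left_mono mult_left_mono) auto
      also have "\<epsilon> * K = 4 * pi\<^sup>2 * e / 2" using K(1) by (simp add: \<epsilon>_def)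
      also have "I r / \<epsilon> < 4 * pi\<^sup>2 * e / 2" using elim(1) \<epsilon> by (simp add: divide_less_eq mult.commute)
      finally have "4 * pi\<^sup>2 * cmod (torus_mean (f j) (\<lambda>z w. phi z w * g z w) r) < 4 * pi\<^sup>2 * e" by simp
      thus ?case by simp
    qed
  qed
qed

lemma f_in_model_space: "j \<in> {1..l} \<Longrightarrow> f j \<in> model_space phi"
  unfolding model_space_def H2_inner_def
  using f_in_H2 orthogonal_limit by (auto intro!: tendsto_Lim)

lemma f_orthonormal:
  "j \<in> {1..l} \<Longrightarrow> k \<in> {1..l} \<Longrightarrow> H2_inner (f j) (f k) = (if j = k then 1 else 0)"
  unfolding H2_inner_def using inner_limit by (intro tendsto_Lim) auto

end

section \<open>Consequences of the nontangential limit\<close>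

text \<open>First-order term of A + z2 B along a path leaving (t, m) radially in both coordinates,
  with \<sigma> the ratio of the two speeds.\<close>

lemma poly_pair_deriv:
  fixes A B :: "complex poly"
  assumes "poly A t + m * poly B t = 0"
  shows "((\<lambda>\<epsilon>::real. (poly A (t * (1 - of_real \<epsilon>)) + m * (1 - \<sigma> * of_real \<epsilon>) * poly B (t * (1 - of_real \<epsilon>))) / of_real \<epsilon>)
    \<longlongrightarrow> - (t * poly (pderiv A) t + m * t * poly (pderiv B) t + \<sigma> * m * poly B t)) (at_right 0)"
proof -
  define G where "G x = poly A (t * (1 - x)) + m * (1 - \<sigma> * x) * poly B (t * (1 - x))" for x
  have "(G has_field_derivative - (t * poly (pderiv A) t + m * t * poly (pderiv B) t + \<sigma> * m * poly B t)) (at 0)"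
    unfolding G_def by (auto intro!: derivative_eq_intros simp: algebra_simps)
  hence "((\<lambda>x. G x / x) \<longlongrightarrow> - (t * poly (pderiv A) t + m * t * poly (pderiv B) t + \<sigma> * m * poly B t)) (at 0)"
    using assms by (simp add: has_field_derivative_iff G_def)
  moreover have "filterlim (\<lambda>\<epsilon>::real. complex_of_real \<epsilon>) (at 0) (at_right 0)"
    unfolding filterlim_at
  proof
    show "\<forall>\<^sub>F \<epsilon>::real in at_right 0. complex_of_real \<epsilon> \<in> UNIV \<and> complex_of_real \<epsilon> \<noteq> 0"
      using eventually_at_right_less[of "0::real"] by eventually_elim auto
    show "(complex_of_real \<longlongrightarrow> 0) (at_right 0)"
      by (auto intro!: tendsto_eq_intros)
  qed
  ultimately show ?thesis unfolding G_def by (rule filterlim_compose)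
qed

text \<open>A value taken as a nontangential limit at a boundary zero of \<open>p\<close> is attained to first order
  along every line; two directions suffice to separate the two conclusions.\<close>
lemma (in inner_pair) nt_limit_imp:
  assumes t: "cmod t = 1" and m: "cmod m = 1" and zero: "poly p1 t + m * poly p2 t = 0"
    and lim: "has_nt_limit (\<lambda>z w. (poly pt2 z + w * poly pt1 z) / (poly p1 z + w * poly p2 z)) (t, m) \<alpha>"
  shows "poly pt1 t = \<alpha> * poly p2 t" "poly pt2 t = \<alpha> * poly p1 t"
    "poly (pderiv (pt2 - smult \<alpha> p1)) t + m * poly (pderiv (pt1 - smult \<alpha> p2)) t = 0"
proof -
  have pt_zero: "poly pt2 t + m * poly pt1 t = 0"
  proof -
    have "m * cnj (poly p1 t + m * poly p2 t) = m * cnj (poly p1 t) + (m * cnj m) * cnj (poly p2 t)"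
      by (simp add: algebra_simps)
    hence "m * cnj (poly p1 t) + cnj (poly p2 t) = 0" unfolding zero cnj_mult_circle[OF m] by simp
    hence "t ^ n * (m * cnj (poly p1 t) + cnj (poly p2 t)) = 0" by simp
    thus ?thesis using t by (simp add: poly_crefl_circle deg_p1 deg_p2 algebra_simps)
  qed
  define U2 where "U2 = pt2 - smult \<alpha> p1"
  define U1 where "U1 = pt1 - smult \<alpha> p2"
  have "poly U2 t + m * poly U1 t = (poly pt2 t + m * poly pt1 t) - \<alpha> * (poly p1 t + m * poly p2 t)"
    by (simp add: U1_def U2_def algebra_simps)
  hence U_zero: "poly U2 t + m * poly U1 t = 0" unfolding zero pt_zero by simp
  have key: "t * poly (pderiv U2) t + m * t * poly (pderiv U1) t + of_real \<sigma> * m * poly U1 t = 0"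
    if \<sigma>: "1 \<le> \<sigma>" "\<sigma> \<le> 2" for \<sigma> :: real
  proof -
    define x where "x \<epsilon> = t * (1 - of_real \<epsilon>)" for \<epsilon> :: real
    define y where "y \<epsilon> = m * (1 - of_real \<sigma> * of_real \<epsilon>)" for \<epsilon> :: real
    define p where "p \<epsilon> = poly p1 (x \<epsilon>) + y \<epsilon> * poly p2 (x \<epsilon>)" for \<epsilon>
    define ph where "ph \<epsilon> = (poly pt2 (x \<epsilon>) + y \<epsilon> * poly pt1 (x \<epsilon>)) / p \<epsilon>" for \<epsilon>
    have ev: "\<forall>\<^sub>F \<epsilon>::real in at_right 0. \<epsilon> \<in> {0<..<1/2}" by (rule eventually_at_right_real) simp
    have norms: "cmod (x \<epsilon>) = 1 - \<epsilon>" "cmod (y \<epsilon>) = 1 - \<sigma> * \<epsilon>" "cmod (x \<epsilon> - t) = \<epsilon>" "cmod (y \<epsilon> - m) = \<sigma> * \<epsilon>"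
      if "\<epsilon> \<in> {0<..<1/2}" for \<epsilon>
    proof -
      have "\<sigma> * \<epsilon> \<le> 2 * \<epsilon>" by (rule mult_right_mono) (use that \<sigma> in auto)
      moreover have "0 < \<epsilon>" "\<epsilon> < 1/2" using that by auto
      moreover from this have "0 < \<sigma> * \<epsilon>" using \<sigma> by simp
      ultimately have se: "0 < \<sigma> * \<epsilon>" "\<sigma> * \<epsilon> < 1" by linarith+
      have "1 - complex_of_real \<epsilon> = of_real (1 - \<epsilon>)" "1 - complex_of_real \<sigma> * of_real \<epsilon> = of_real (1 - \<sigma> * \<epsilon>)"
        by simp_all
      thus "cmod (x \<epsilon>) = 1 - \<epsilon>" "cmod (y \<epsilon>) = 1 - \<sigma> * \<epsilon>"
        unfolding x_def y_def using that se t m by (simp_all only: norm_mult norm_of_real) auto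
      have "x \<epsilon> - t = - (t * of_real \<epsilon>)" "y \<epsilon> - m = - (m * of_real (\<sigma> * \<epsilon>))"
        by (simp_all add: x_def y_def algebra_simps)
      thus "cmod (x \<epsilon> - t) = \<epsilon>" "cmod (y \<epsilon> - m) = \<sigma> * \<epsilon>"
        using that se t m by (simp_all only: norm_minus_cancel norm_mult norm_of_real) auto
    qed
    \<comment> \<open>The distances to \<open>t\<close> and \<open>m\<close> add up to (1 +
      \<sigma>) \<epsilon> \<le> 3 \<epsilon>, and since \<sigma> \<ge> 1 the larger modulus is 1 -
      \<epsilon>; hence aperture 4.\<close>
    have "filterlim (\<lambda>\<epsilon>. (x \<epsilon>, y \<epsilon>)) (at (t, m) within nt_region (t, m) 4) (at_right 0)"
      unfolding filterlim_at
    proof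
      show "((\<lambda>\<epsilon>. (x \<epsilon>, y \<epsilon>)) \<longlongrightarrow> (t, m)) (at_right 0)"
        unfolding x_def y_def by (auto intro!: tendsto_eq_intros)
      show "\<forall>\<^sub>F \<epsilon> in at_right 0. (x \<epsilon>, y \<epsilon>) \<in> nt_region (t, m) 4 \<and> (x \<epsilon>, y \<epsilon>) \<noteq> (t, m)"
        using ev
      proof eventually_elim
        case (elim \<epsilon>)
        have "\<epsilon> \<le> \<sigma> * \<epsilon>" "\<sigma> * \<epsilon> \<le> 2 * \<epsilon>" using elim \<sigma> by auto
        moreover from this have "max (cmod (x \<epsilon>)) (cmod (y \<epsilon>)) = 1 - \<epsilon>"
          unfolding norms[OF elim] by simp
        moreover have "x \<epsilon> \<noteq> t" using norms(3)[OF elim] elim by auto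
        ultimately show ?case
          using elim unfolding nt_region_def by (simp add: norms[OF elim] del: max_less_iff_conj)
      qed
    qed
    moreover have "((\<lambda>z. (poly pt2 (fst z) + snd z * poly pt1 (fst z)) / (poly p1 (fst z) + snd z * poly p2 (fst z))) \<longlongrightarrow> \<alpha>)
        (at (t, m) within nt_region (t, m) 4)"
      using lim unfolding has_nt_limit_def by simp
    ultimately have "((\<lambda>\<epsilon>. (\<lambda>z. (poly pt2 (fst z) + snd z * poly pt1 (fst z)) / (poly p1 (fst z) + snd z * poly p2 (fst z))) (x \<epsilon>, y \<epsilon>)) \<longlongrightarrow> \<alpha>) (at_right 0)"
      by (rule filterlim_compose[rotated])
    hence ph: "(ph \<longlongrightarrow> \<alpha>) (at_right 0)" unfolding ph_def p_def by simp
    have p: "((\<lambda>\<epsilon>. p \<epsilon> / of_real \<epsilon>) \<longlongrightarrow> - (t * poly (pderiv p1) t + m * t * poly (pderiv p2) t + of_real \<sigma> * m * poly p2 t)) (at_right 0)"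
      using poly_pair_deriv[OF zero, of "of_real \<sigma>"] by (simp add: p_def x_def y_def)
    have U: "((\<lambda>\<epsilon>. (poly U2 (x \<epsilon>) + y \<epsilon> * poly U1 (x \<epsilon>)) / of_real \<epsilon>) \<longlongrightarrow>
        - (t * poly (pderiv U2) t + m * t * poly (pderiv U1) t + of_real \<sigma> * m * poly U1 t)) (at_right 0)"
      using poly_pair_deriv[OF U_zero, of "of_real \<sigma>"] by (simp add: x_def y_def)
    \<comment> \<open>\<open>p\<close> vanishes at (t, m), so \<open>p / \<epsilon>\<close> has a
      finite limit; together with \<open>ph\<close> tending to \<alpha> this removes the first-order
      term of U2 + z2 U1.\<close>
    have prod: "((\<lambda>\<epsilon>. (ph \<epsilon> - \<alpha>) * (p \<epsilon> / of_real \<epsilon>)) \<longlongrightarrow>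
       (\<alpha> - \<alpha>) * - (t * poly (pderiv p1) t + m * t * poly (pderiv p2) t + of_real \<sigma> * m * poly p2 t)) (at_right 0)"
      by (intro tendsto_mult tendsto_diff ph p tendsto_const)
    have eq: "\<forall>\<^sub>F \<epsilon> in at_right 0. (ph \<epsilon> - \<alpha>) * (p \<epsilon> / of_real \<epsilon>) = (poly U2 (x \<epsilon>) + y \<epsilon> * poly U1 (x \<epsilon>)) / of_real \<epsilon>"
      using ev
    proof eventually_elim
      case (elim \<epsilon>)
      have "\<sigma> * \<epsilon> > 0" using elim \<sigma> by simp
      hence "p \<epsilon> \<noteq> 0" unfolding p_def using elim norms[OF elim] by (intro nozero) auto
      hence "(ph \<epsilon> - \<alpha>) * p \<epsilon> = poly pt2 (x \<epsilon>) + y \<epsilon> * poly pt1 (x \<epsilon>) - \<alpha> * p \<epsilon>"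
        by (simp add: ph_def left_diff_distrib)
      also have "\<dots> = poly U2 (x \<epsilon>) + y \<epsilon> * poly U1 (x \<epsilon>)"
        by (simp add: U1_def U2_def p_def algebra_simps)
      finally have "(ph \<epsilon> - \<alpha>) * p \<epsilon> = poly U2 (x \<epsilon>) + y \<epsilon> * poly U1 (x \<epsilon>)" .
      thus ?case by (metis times_divide_eq_right)
    qed
    have "- (t * poly (pderiv U2) t + m * t * poly (pderiv U1) t + of_real \<sigma> * m * poly U1 t) = 0"
      using tendsto_unique[OF _ U Lim_transform_eventually[OF prod eq]] by simp
    thus ?thesis by (simp only: neg_equal_0_iff_equal)
  qed
  have "m * poly U1 t = (t * poly (pderiv U2) t + m * t * poly (pderiv U1) t + of_real 2 * m * poly U1 t) -
      (t * poly (pderiv U2) t + m * t * poly (pderiv U1) t + of_real 1 * m * poly U1 t)"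
    by (simp add: algebra_simps)
  also have "\<dots> = 0" using key[of 1] key[of 2] by simp
  finally have "m * poly U1 t = 0" .
  moreover have t0: "t \<noteq> 0" "m \<noteq> 0" using t m by auto
  ultimately have "poly U1 t = 0" by simp
  thus "poly pt1 t = \<alpha> * poly p2 t" by (simp add: U1_def)
  show "poly pt2 t = \<alpha> * poly p1 t" using U_zero \<open>poly U1 t = 0\<close> by (simp add: U2_def)
  have "t * (poly (pderiv U2) t + m * poly (pderiv U1) t) = 0"
    using key[of 1] \<open>poly U1 t = 0\<close> by (simp add: algebra_simps)
  thus "poly (pderiv (pt2 - smult \<alpha> p1)) t + m * poly (pderiv (pt1 - smult \<alpha> p2)) t = 0"
    using t0 unfolding U1_def U2_def by simp
qed

section \<open>The normalization\<close>

context exceptional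
begin

lemma norm_ang: "j \<in> {1..l} \<Longrightarrow> Re (ang j) = cmod (c * poly b2 (\<tau> j) * poly (PIo j) (\<tau> j) / poly p1 (\<tau> j))"
proof -
  assume j: "j \<in> {1..l}"
  have "cmod (ang j) = Re (ang j)" using ang_pos[OF j] by (metis abs_of_pos norm_of_real)
  thus ?thesis using norm_tau[OF j] norm_alpha by (simp add: ang_def h1_def norm_mult norm_divide)
qed

text \<open>Links the Clark weight to \<open>ang\<close>: the weight is defined by the derivative of
  phi(., 0), the rational function \<open>psi\<close>, taken at the boundary point itself.\<close>

lemma norm_deriv_psi:
  assumes j: "j \<in> {1..l}" shows "cmod (deriv psi (\<tau> j)) = Re (ang j)"
proof -
  define h where "h = smult c (b2 * PIo j)"
  have p1: "poly p1 (\<tau> j) \<noteq> 0" using p1_nz[of "\<tau> j"] norm_tau[OF j] by simp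
  have "pt2 = smult \<alpha> p1 - b2 * smult c PI" using u2' by (metis diff_diff_eq2 add_diff_cancel_left' diff_add_cancel)
  also have "b2 * smult c PI = [:- \<tau> j, 1:] * h"
    unfolding PI_split[OF j] h_def by (simp only: mult_smult_left mult_smult_right mult_ac)
  finally have pt2: "pt2 = smult \<alpha> p1 - [:- \<tau> j, 1:] * h" .
  have v: "poly pt2 (\<tau> j) = \<alpha> * poly p1 (\<tau> j)" unfolding pt2 by simp
  have v': "poly (pderiv pt2) (\<tau> j) = \<alpha> * poly (pderiv p1) (\<tau> j) - poly h (\<tau> j)"
    unfolding pt2 pderiv_diff pderiv_smult pderiv_mult by (simp add: pderiv_pCons)
  have "(psi has_field_derivative (poly (pderiv pt2) (\<tau> j) * poly p1 (\<tau> j) - poly pt2 (\<tau> j) * poly (pderiv p1) (\<tau> j)) /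
      (poly p1 (\<tau> j) * poly p1 (\<tau> j))) (at (\<tau> j))"
    unfolding psi_def[abs_def] by (intro DERIV_divide poly_DERIV p1)
  hence "deriv psi (\<tau> j) = (poly (pderiv pt2) (\<tau> j) * poly p1 (\<tau> j) - poly pt2 (\<tau> j) * poly (pderiv p1) (\<tau> j)) /
      (poly p1 (\<tau> j) * poly p1 (\<tau> j))" by (rule DERIV_imp_deriv)
  also have "\<dots> = - poly h (\<tau> j) / poly p1 (\<tau> j)"
    unfolding v v' using p1 by (simp add: field_simps)
  finally show ?thesis unfolding norm_ang[OF j] by (simp add: h_def norm_mult norm_divide mult_ac)
qed

text \<open>The common factor \<open>1 - cnj (lam j) * w\<close> cancels, so the function is
  constant on the disc and all its circle means agree.\<close>

lemma disc_normsq: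
  assumes j: "j \<in> {1..l}" and d: "d > 0"
  shows "H2_disc_normsq (\<lambda>w. of_real d * poly (PIo j) (\<tau> j) * beta (\<tau> j) w / pf (\<tau> j) w) = (d * Re (ang j) / cmod c)\<^sup>2"
proof -
  define K where "K = of_real d * poly (PIo j) (\<tau> j) * poly b2 (\<tau> j) / poly p1 (\<tau> j)"
  have K: "cmod K = d * Re (ang j) / cmod c"
    unfolding norm_ang[OF j] K_def using c_nz d by (simp add: norm_mult norm_divide)
  have val: "of_real d * poly (PIo j) (\<tau> j) * beta (\<tau> j) w / pf (\<tau> j) w = K" if "cmod w < 1" for w
  proof -
    have "cnj (lam j) * w \<noteq> 1" using that norm_lam[OF j]
      by (metis complex_mod_cnj mult_1 norm_mult norm_one order_less_irrefl)
    thus ?thesis unfolding K_def beta_tau[OF j] pf_tau[OF j] by simp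
  qed
  have "integral {0..2*pi} (\<lambda>t. (cmod (of_real d * poly (PIo j) (\<tau> j) * beta (\<tau> j) (of_real r * cis t) /
      pf (\<tau> j) (of_real r * cis t)))\<^sup>2) / (2 * pi) = (cmod K)\<^sup>2" if "r \<in> {0<..<1}" for r :: real
  proof -
    have "cmod (of_real r * cis t) < 1" for t using that by (simp add: norm_mult)
    from val[OF this] show ?thesis by simp
  qed
  hence "H2_disc_normsq (\<lambda>w. of_real d * poly (PIo j) (\<tau> j) * beta (\<tau> j) w / pf (\<tau> j) w) =
      (SUP r\<in>{0<..<1::real}. (cmod K)\<^sup>2)"
    unfolding H2_disc_normsq_def by (intro SUP_cong) auto
  thus ?thesis by (simp add: K)
qed

end

section \<open>Two-variable polynomials\<close>

text \<open>Substituting the constant polynomial for z2 before evaluating at z1 reduces evaluation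
  to nested \<open>poly\<close>.\<close>

lemma eval2_eq: "eval2 P z w = poly (poly P [:w:]) z"
  unfolding eval2_def by (induction P) (auto simp: map_poly_pCons)

lemma eval2_linear: "eval2 [:a, b:] z w = poly a z + w * poly b z"
  by (simp add: eval2_eq)

lemma refl2_linear: "refl2 n 1 [:a, b:] = [:crefl n b, crefl n a:]"
  unfolding refl2_def crefl_def by (simp add: monom_0 monom_Suc)

lemma prod_Z1: "(\<Prod>k\<in>K. Z1 - [:[:\<tau> k:]:]) = [:\<Prod>k\<in>K. [:- \<tau> k, 1:]:]"
proof (induction K rule: infinite_finite_induct)
  case (insert x F)
  have Z1: "Z1 - [:[:\<tau> x:]:] = [:[:- \<tau> x, 1:]:]" by (simp add: Z1_def)
  have mult: "[:a:] * [:b:] = [:a * b:]" for a b :: "complex poly" by simp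
  show ?case unfolding prod.insert[OF insert.hyps] insert.IH Z1 mult ..
qed (auto simp: one_pCons)

lemma R_linear: "smult [:d:] (([:b2:] - Z2 * [:b1:]) * [:q:]) = [:smult d (b2 * q), - smult d (b1 * q):]"
  by (simp add: Z2_def mult.commute)

theorem theorem4p1:
  fixes n :: nat and P :: "complex poly poly" and \<alpha> :: complex and l :: nat
    and \<tau> lam :: "nat \<Rightarrow> complex" and b1 b2 :: "complex poly" and R :: "nat \<Rightarrow> complex poly poly"
  assumes n_ge: "n \<ge> 1"
    and degP: "degree P \<le> 1" "deg_z1_le P n"
    and nozero: "\<And>z1 z2. cmod z1 < 1 \<Longrightarrow> cmod z2 < 1 \<Longrightarrow> eval2 P z1 z2 \<noteq> 0"
    and degPt: "degree (refl2 n 1 P) = 1"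
      "degree (coeff (refl2 n 1 P) 0) = n \<or> degree (coeff (refl2 n 1 P) 1) = n"
    and cop: "coprime P (refl2 n 1 P)"
    and alpha: "cmod \<alpha> = 1"
    and ell: "l \<ge> 1"
    and enum: "bij_betw (\<lambda>k. (\<tau> k, lam k)) {1..l}
       {(t, l). cmod t = 1 \<and> cmod l = 1 \<and> eval2 P t l = 0 \<and> has_nt_limit (rif P (refl2 n 1 P)) (t, l) \<alpha>}"
    and bcop: "coprime b1 b2" and b2nz: "b2 \<noteq> 0"
    and bdeg: "max (degree b1) (degree b2) = n - l"
    and Balpha: "b1 * (smult \<alpha> (coeff P 0) - coeff (refl2 n 1 P) 0)
               = b2 * (coeff (refl2 n 1 P) 1 - smult \<alpha> (coeff P 1))"
    and Rdef: "\<And>j. j \<in> {1..l} \<Longrightarrow> \<exists>d::real. d > 0 \<and>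
        R j = smult [:complex_of_real d:] (([:b2:] - Z2 * [:b1:]) * (\<Prod>k\<in>{1..l} - {j}. Z1 - [:[:\<tau> k:]:]))"
    and Rnorm: "\<And>j. j \<in> {1..l} \<Longrightarrow>
        clark_weight P (refl2 n 1 P) (\<tau> j) *
          H2_disc_normsq (\<lambda>z2. eval2 (R j) (\<tau> j) z2 / eval2 P (\<tau> j) z2) = 1"
  shows "\<exists>R' :: nat \<Rightarrow> complex poly poly. \<exists>Q :: complex poly poly.
     (\<forall>j\<in>{1..l}. R' j = R j) \<and>
     degree Q = 0 \<and> deg_z1_le Q n \<and>
     (\<forall>j\<in>{1..n}. degree (R' j) \<le> 1 \<and> deg_z1_le (R' j) (n - 1)) \<and>
     (\<forall>z1 z2 w1 w2.
        eval2 P z1 z2 * cnj (eval2 P w1 w2) - eval2 (refl2 n 1 P) z1 z2 * cnj (eval2 (refl2 n 1 P) w1 w2)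
        = (1 - z1 * cnj w1) * (\<Sum>j=1..n. eval2 (R' j) z1 z2 * cnj (eval2 (R' j) w1 w2))
          + (1 - z2 * cnj w2) * (eval2 Q z1 z2 * cnj (eval2 Q w1 w2))) \<and>
     (\<forall>j\<in>{1..l}. (\<lambda>z1 z2. eval2 (R j) z1 z2 / eval2 P z1 z2) \<in> model_space (rif P (refl2 n 1 P))) \<and>
     (\<forall>j\<in>{1..l}. \<forall>k\<in>{1..l}.
        H2_inner (\<lambda>z1 z2. eval2 (R j) z1 z2 / eval2 P z1 z2) (\<lambda>z1 z2. eval2 (R k) z1 z2 / eval2 P z1 z2)
        = (if j = k then 1 else 0))"
proof -
  define p1 p2 where "p1 = coeff P 0" and "p2 = coeff P 1"
  have P: "P = [:p1, p2:]"
  proof (rule poly_eqI)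
    fix i show "coeff P i = coeff [:p1, p2:] i"
      using degP(1) by (auto simp: p1_def p2_def coeff_pCons coeff_eq_0 split: nat.split)
  qed
  define pt1 pt2 where "pt1 = crefl n p1" and "pt2 = crefl n p2"
  have Pt: "refl2 n 1 P = [:pt2, pt1:]" unfolding P refl2_linear pt1_def pt2_def ..
  have evP: "eval2 P z w = poly p1 z + w * poly p2 z" for z w unfolding P eval2_linear ..
  have evPt: "eval2 (refl2 n 1 P) z w = poly pt2 z + w * poly pt1 z" for z w unfolding Pt eval2_linear ..
  have rif_eq: "rif P (refl2 n 1 P) = (\<lambda>z w. (poly pt2 z + w * poly pt1 z) / (poly p1 z + w * poly p2 z))"
    by (intro ext) (simp only: rif_def evP evPt)

  interpret inner_pair n p1 p2
  proof
    show "degree p1 \<le> n" "degree p2 \<le> n" using degP(2) by (auto simp: deg_z1_le_def p1_def p2_def)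
    show "poly p1 z + w * poly p2 z \<noteq> 0" if "cmod z < 1" "cmod w < 1" for z w
      using nozero[OF that] unfolding evP .
    show "coprime [:p1, p2:] [:crefl n p2, crefl n p1:]" using cop Pt P by (simp add: pt1_def pt2_def)
  qed
  note pt_defs = pt1_def[symmetric] pt2_def[symmetric]

  have pts: "cmod (\<tau> j) = 1" "cmod (lam j) = 1" "poly p1 (\<tau> j) + lam j * poly p2 (\<tau> j) = 0"
    "has_nt_limit (\<lambda>z w. (poly pt2 z + w * poly pt1 z) / (poly p1 z + w * poly p2 z)) (\<tau> j, lam j) \<alpha>"
    if "j \<in> {1..l}" for j
    using bij_betwE[OF enum] that unfolding rif_eq evP by auto
  have nt: "poly pt1 (\<tau> j) = \<alpha> * poly p2 (\<tau> j)" "poly pt2 (\<tau> j) = \<alpha> * poly p1 (\<tau> j)"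
    "poly (pderiv (pt2 - smult \<alpha> p1)) (\<tau> j) + lam j * poly (pderiv (pt1 - smult \<alpha> p2)) (\<tau> j) = 0"
    if j: "j \<in> {1..l}" for j
    using nt_limit_imp[unfolded pt_defs, OF pts[OF j]] by blast+

  obtain g where g: "smult \<alpha> p1 - pt2 = b2 * g" "pt1 - smult \<alpha> p2 = b1 * g"
  proof (rule poly_coprime_dvd_cancel[OF bcop _ b2nz])
    show "b1 * (smult \<alpha> p1 - pt2) = b2 * (pt1 - smult \<alpha> p2)"
      using Balpha unfolding Pt by (simp add: p1_def p2_def)
  qed
  have g0: "g \<noteq> 0" using pt_ne_smult[of \<alpha>] g unfolding pt_defs by auto
  have g_tau: "poly g (\<tau> j) = 0" if "j \<in> {1..l}" for j
  proof -
    have "poly (b2 * g) (\<tau> j) = 0" "poly (b1 * g) (\<tau> j) = 0"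
      unfolding g[symmetric] using nt(1,2)[OF that] by simp_all
    thus ?thesis using coprime_no_common_root[OF bcop, of "\<tau> j"] by auto
  qed
  \<comment> \<open>\<open>p\<close> is linear in z2 and \<open>p2\<close> cannot vanish at
    \<open>\<tau> j\<close>, since \<open>p1\<close> would vanish with it; so only one zero lies
    over each \<open>\<tau> j\<close>.\<close>
  have inj: "inj_on \<tau> {1..l}"
  proof (rule inj_onI)
    fix j k assume jk: "j \<in> {1..l}" "k \<in> {1..l}" "\<tau> j = \<tau> k"
    have "(lam j - lam k) * poly p2 (\<tau> j) = 0"
      using pts(3)[OF jk(1)] pts(3)[OF jk(2)] jk(3) by (auto simp: algebra_simps add_eq_0_iff2)
    moreover have "poly p2 (\<tau> j) \<noteq> 0"
      using pts(1,3)[OF jk(1)] p1_nz[of "\<tau> j"] by auto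
    ultimately have "(\<tau> j, lam j) = (\<tau> k, lam k)" using jk(3) by simp
    thus "j = k" using enum jk by (auto simp: bij_betw_def dest: inj_onD)
  qed
  define PI where "PI = (\<Prod>k\<in>{1..l}. [:- \<tau> k, 1:])"
  have PI0: "PI \<noteq> 0" and degPI: "degree PI = l" by (auto simp: PI_def degree_prod_linear)
  have "PI dvd g" unfolding PI_def by (rule poly_prod_roots_dvd[OF _ inj g_tau]) auto
  then obtain g' where g': "g = PI * g'" by (rule dvdE)
  have deg_g: "degree g = l + degree g'" using g0 PI0 degPI by (auto simp: g' degree_mult_eq)
  have deg_u: "degree (b2 * g) \<le> n" "degree (b1 * g) \<le> n"
    unfolding g[symmetric] pt1_def pt2_def using deg_p1 deg_p2
    by (auto intro!: degree_diff_le degree_crefl order.trans[OF degree_smult_le])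
  have deg_b2: "degree b2 + (l + degree g') \<le> n"
    using deg_u(1) b2nz g0 deg_g by (simp add: degree_mult_eq)
  have deg_b1: "degree b1 + (l + degree g') \<le> n"
    using deg_u(2) g0 deg_g deg_b2 by (cases "b1 = 0") (simp_all add: degree_mult_eq)
  have ln: "l \<le> n" using deg_b2 by simp
  \<comment> \<open>The larger of the degrees of \<open>b1\<close> and \<open>b2\<close> is exactly
    n - l and \<open>PI\<close> takes up l more, so nothing beyond \<open>PI\<close> and a scalar
    was cancelled. The bound l \<le> n is established beforehand because \<open>n - l\<close> is
    truncated subtraction.\<close>
  have "degree g' = 0" using deg_b1 deg_b2 bdeg ln by (simp add: max_def split: if_splits)
  then obtain c where c: "g' = [:c:]" by (auto elim: degree_eq_zeroE)
  have g_eq: "g = smult c PI" by (simp add: g' c)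
  have c0: "c \<noteq> 0" using g0 g_eq by auto

  interpret exceptional n p1 p2 l \<alpha> c \<tau> lam b1 b2
  proof
    show "poly b2 (\<tau> j) = lam j * poly b1 (\<tau> j)" if j: "j \<in> {1..l}" for j
    proof -
      define h where "h = smult c (\<Prod>k\<in>{1..l} - {j}. [:- \<tau> k, 1:])"
      have gh: "g = [:- \<tau> j, 1:] * h"
        unfolding g_eq PI_def h_def by (subst prod.remove[OF _ j]) auto
      have "\<tau> j \<noteq> \<tau> k" if "k \<in> {1..l} - {j}" for k
        using that inj_onD[OF inj _ j, of k] by fastforce
      hence h0: "poly h (\<tau> j) \<noteq> 0" using c0 by (simp add: h_def poly_prod)
      \<comment> \<open>\<open>g\<close> has a simple zero at \<open>\<tau> j\<close>, so only the
        derivative of its linear factor counts. This turns the derivative relation from the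
        nontangential limit into a relation between the values of \<open>b1\<close> and
        \<open>b2\<close>.\<close>
      have pd: "poly (pderiv (b * g)) (\<tau> j) = poly b (\<tau> j) * poly h (\<tau> j)" for b
        unfolding gh pderiv_mult poly_add poly_mult by (simp add: pderiv_pCons)
      have neg: "pt2 - smult \<alpha> p1 = - (b2 * g)" unfolding g(1)[symmetric] by simp
      have "poly h (\<tau> j) * (lam j * poly b1 (\<tau> j) - poly b2 (\<tau> j)) = 0"
        using nt(3)[OF j] unfolding neg g(2) pderiv_minus poly_minus pd by (simp add: algebra_simps)
      thus ?thesis using h0 by simp
    qed
  qed (use alpha ell ln pts inj bcop bdeg c0 b2nz g in \<open>auto simp: pt_defs g_eq PI_def\<close>)

  have PIo: "(\<Prod>k\<in>{1..l} - {j}. [:- \<tau> k, 1:]) = PIo j" for j by (simp add: PIo_def)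
  obtain d :: "nat \<Rightarrow> real" where d: "\<And>j. j \<in> {1..l} \<Longrightarrow> d j > 0 \<and>
      R j = smult [:complex_of_real (d j):] (([:b2:] - Z2 * [:b1:]) * (\<Prod>k\<in>{1..l} - {j}. Z1 - [:[:\<tau> k:]:]))"
    using Rdef by metis
  have R: "R j = [:smult (of_real (d j)) (b2 * PIo j), - smult (of_real (d j)) (b1 * PIo j):]"
    if "j \<in> {1..l}" for j
    using d[OF that] unfolding prod_Z1 R_linear PIo by blast
  have evR: "eval2 (R j) z w = of_real (d j) * poly (PIo j) z * beta z w" if "j \<in> {1..l}" for j z w
    unfolding R[OF that] eval2_linear by (simp add: beta_def algebra_simps)
  have evP': "eval2 P z w = pf z w" for z w by (simp add: evP pf_def)
  have evPt': "eval2 (refl2 n 1 P) z w = ptf z w" for z w unfolding evPt ptf_def pt_defs ..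
  have d_norm: "(d j)\<^sup>2 * Re (ang j) = (cmod c)\<^sup>2" if j: "j \<in> {1..l}" for j
  proof -
    have A: "Re (ang j) > 0" by (rule ang_pos(2)[OF j])
    have "(\<lambda>w. rif P (refl2 n 1 P) w 0) = psi"
      unfolding rif_eq psi_def[abs_def] pt_defs by simp
    hence "clark_weight P (refl2 n 1 P) (\<tau> j) = 1 / Re (ang j)"
      unfolding clark_weight_def by (simp add: norm_deriv_psi[OF j])
    hence "1 / Re (ang j) * (d j * Re (ang j) / cmod c)\<^sup>2 = 1"
      using Rnorm[OF j] d[OF j] disc_normsq[OF j, of "d j"] unfolding evR[OF j] evP' by simp
    thus ?thesis using A c0 by (simp add: power_divide power_mult_distrib power2_eq_square field_simps)
  qed

  interpret normalized n p1 p2 l \<alpha> c \<tau> lam b1 b2 d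
    by unfold_locales (use d d_norm in auto)

  have fR: "(\<lambda>z w. eval2 (R j) z w / eval2 P z w) = f j" if "j \<in> {1..l}" for j
    by (simp add: fun_eq_iff f_def Rf_def evR[OF that] evP')
  have phi_eq: "rif P (refl2 n 1 P) = phi"
    by (intro ext) (simp only: rif_def phi_def evP' evPt')

  show ?thesis
  proof (rule sums_of_squares)
    fix q :: "complex poly" and r s :: "nat \<Rightarrow> complex poly"
    assume deg: "degree q \<le> n" "\<And>i. i < n - l \<Longrightarrow> degree (r i) \<le> n - 1"
      "\<And>i. i < n - l \<Longrightarrow> degree (s i) \<le> n - 1"
    assume sos: "\<And>z1 z2 w1 w2. pf z1 z2 * cnj (pf w1 w2) - ptf z1 z2 * cnj (ptf w1 w2) =
       (1 - z1 * cnj w1) * ((\<Sum>j\<in>{1..l}. Rf j z1 z2 * cnj (Rf j w1 w2)) +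
         (\<Sum>i<n - l. (poly (r i) z1 + z2 * poly (s i) z1) * cnj (poly (r i) w1 + w2 * poly (s i) w1)))
       + (1 - z2 * cnj w2) * (poly q z1 * cnj (poly q w1))"
    \<comment> \<open>Indices above \<open>l\<close> are shifted by l + 1 because \<open>r\<close>
      and \<open>s\<close> are indexed from 0.\<close>
    define R' where "R' j = (if j \<le> l then R j else [:r (j - l - 1), s (j - l - 1):])" for j
    have degR: "degree (R' j) \<le> 1 \<and> deg_z1_le (R' j) (n - 1)" if j: "j \<in> {1..n}" for j
    proof -
      have two: "degree [:a, b:] \<le> 1 \<and> deg_z1_le [:a, b:] (n - 1)"
        if "degree a \<le> n - 1" "degree b \<le> n - 1" for a b :: "complex poly"
        using that by (auto simp: deg_z1_le_def coeff_pCons split: nat.split)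
      show ?thesis
      proof (cases "j \<le> l")
        case True
        hence jl: "j \<in> {1..l}" using j by simp
        have "degree (b2 * PIo j) \<le> n - 1" "degree (b1 * PIo j) \<le> n - 1"
          using degree_mult_le[of b2 "PIo j"] degree_mult_le[of b1 "PIo j"] degree_PIo[OF jl] bdeg ln ell
          by linarith+
        hence "degree (smult (of_real (d j)) (b2 * PIo j)) \<le> n - 1"
          "degree (- smult (of_real (d j)) (b1 * PIo j)) \<le> n - 1"
          unfolding degree_minus by (auto intro: order.trans[OF degree_smult_le])
        thus ?thesis using True unfolding R'_def R[OF jl] by (simp only: if_True two)
      next
        case False
        hence "j - l - 1 < n - l" using j by auto
        thus ?thesis using False deg unfolding R'_def by (simp only: if_False two)
      qed
    qed
    have sum_split: "(\<Sum>j=1..n. eval2 (R' j) z1 z2 * cnj (eval2 (R' j) w1 w2)) =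
        (\<Sum>j\<in>{1..l}. Rf j z1 z2 * cnj (Rf j w1 w2)) +
        (\<Sum>i<n - l. (poly (r i) z1 + z2 * poly (s i) z1) * cnj (poly (r i) w1 + w2 * poly (s i) w1))"
      for z1 z2 w1 w2
    proof -
      have "{1..n} = {1..l} \<union> {l+1..n}" using ln by auto
      hence "(\<Sum>j=1..n. eval2 (R' j) z1 z2 * cnj (eval2 (R' j) w1 w2)) =
          (\<Sum>j\<in>{1..l}. eval2 (R' j) z1 z2 * cnj (eval2 (R' j) w1 w2)) +
          (\<Sum>j\<in>{l+1..n}. eval2 (R' j) z1 z2 * cnj (eval2 (R' j) w1 w2))"
        by (simp only:) (rule sum.union_disjoint, auto)
      also have "(\<Sum>j\<in>{1..l}. eval2 (R' j) z1 z2 * cnj (eval2 (R' j) w1 w2)) =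
          (\<Sum>j\<in>{1..l}. Rf j z1 z2 * cnj (Rf j w1 w2))"
        by (rule sum.cong) (auto simp: R'_def evR Rf_def)
      also have "(\<Sum>j\<in>{l+1..n}. eval2 (R' j) z1 z2 * cnj (eval2 (R' j) w1 w2)) =
          (\<Sum>i<n - l. (poly (r i) z1 + z2 * poly (s i) z1) * cnj (poly (r i) w1 + w2 * poly (s i) w1))"
        by (rule sum.reindex_bij_witness[of _ "\<lambda>i. i + l + 1" "\<lambda>j. j - l - 1"])
           (auto simp: R'_def eval2_linear)
      finally show ?thesis .
    qed
    show ?thesis
    proof (intro exI[of _ R'] exI[of _ "[:q:]"] conjI ballI allI)
      show "R' j = R j" if "j \<in> {1..l}" for j using that by (simp add: R'_def)
      show "degree [:q:] = 0" by simp
      show "deg_z1_le [:q:] n" using deg(1) by (auto simp: deg_z1_le_def coeff_pCons split: nat.split)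
      show "degree (R' j) \<le> 1" "deg_z1_le (R' j) (n - 1)" if "j \<in> {1..n}" for j using degR[OF that] by auto
      show "eval2 P z1 z2 * cnj (eval2 P w1 w2) - eval2 (refl2 n 1 P) z1 z2 * cnj (eval2 (refl2 n 1 P) w1 w2)
        = (1 - z1 * cnj w1) * (\<Sum>j=1..n. eval2 (R' j) z1 z2 * cnj (eval2 (R' j) w1 w2))
          + (1 - z2 * cnj w2) * (eval2 [:q:] z1 z2 * cnj (eval2 [:q:] w1 w2))" for z1 z2 w1 w2
        unfolding sum_split evP' evPt' sos by (simp add: eval2_eq)
      show "(\<lambda>z1 z2. eval2 (R j) z1 z2 / eval2 P z1 z2) \<in> model_space (rif P (refl2 n 1 P))" if "j \<in> {1..l}" for j
        unfolding fR[OF that] phi_eq by (rule f_in_model_space[OF that])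
      show "H2_inner (\<lambda>z1 z2. eval2 (R j) z1 z2 / eval2 P z1 z2) (\<lambda>z1 z2. eval2 (R k) z1 z2 / eval2 P z1 z2)
        = (if j = k then 1 else 0)" if "j \<in> {1..l}" "k \<in> {1..l}" for j k
        unfolding fR[OF that(1)] fR[OF that(2)] by (rule f_orthonormal[OF that])
    qed
  qed
qed

end
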